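(* Let $v\in B^0$, and let $\tau(v)=\prod_{i=1}^{q}z_{c'_{i-1}}(k'_i)\in B^0$ be its dual. Then the following hold. (i) $$Z(\sigma^{b,1}_{r}(v);(\alpha,\beta))=\sum_{\substack{c'_{1}r_1+\sum_{i=2}^{q}r_i=r\\ c'_{1}r_1,\, r_i\ge0}} Z^{*}_{(c'_1r_1,\{r_i\}_{i=2}^{q})}(\tau(v);(\beta,\alpha))$$ for all integers $r\ge0$ and all $\alpha,\beta\in\mathbb{C}$ with $\mathrm{Re}(\alpha)>0$, $\mathrm{Re}(\beta)>0$. (ii) $$Z(\sigma_{r}(v);\alpha)=Z(\sigma_{r}(\tau(v));\alpha)$$ for all integers $r\ge0$ and all $\alpha\in\mathbb{C}$ with $\mathrm{Re}(\alpha)>0$, where $Z(w;\alpha):=Z(w;(\alpha,\alpha))$.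
   Context: Notation. All summation indices, $p,q,r,r_i,k_i,m_i,M^{(i)}_j$, etc., are integers. For $c\in\{0,1\}$ the symbol $<_{c}$ means $<$ if $c=1$ and $\le$ if $c=0$. $(a)_m$ is the Pochhammer symbol: $(a)_0=1$, $(a)_m=a(a+1)\cdots(a+m-1)$ for $m\ge1$. Words. Let $x_0,x_1,x_{-1}$ be non-commuting variables and, for $c\in\{0,1\}$, $k\ge1$, put $z_c(k):=x_c x_{-1}^{k-1}$. Products $\prod$ of words are taken in order from left to right. Let $$B^0=\Bigl\{\prod_{i=1}^{p}z_{c_{i-1}}(k_i)\ \Big|\ p\ge0,\ c_0=1,\ c_i\in\{0,1\},\ k_i\ge1\ (1\le i\le p-1),\ k_p\ge2\Bigr\},$$ where the empty product ($p=0$) is $1$, and let $V^0$ be the $\mathbb{Q}$-vector space with basis $B^0$. All maps below are defined on $B^0$ and extended $\mathbb{Q}$-linearly to $V^0$. Dual. $\tau:B^0\to B^0$ is given by $\tau(1)=1$ and $\tau(x_{1}x_{e_1}\cdots x_{e_{n-1}}x_{-1})=x_{1}x_{-e_{n-1}}\cdots x_{-e_1}x_{-1}$ for $n\ge1$, $e_i\in\{-1,0,1\}$. Thus $\tau(v)$ can be written as $\prod_{i=1}^{q}z_{c'_{i-1}}(k'_i)$ with $q\ge0$, $c'_0=1$, $c'_i\in\{0,1\}$, $k'_i\ge1$ ($1\le i\le q-1$), $k'_q\ge2$; moreover $c'_q:=1$. The map $Z$. For $\mathrm{Re}(\alpha)>0$, $\beta\in\mathbb{C}\setminus\{0,-1,-2,\ldots\}$: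 $Z(1;(\alpha,\beta))=1$ and, for $p\ge1$, $$Z\Bigl(\prod_{i=1}^{p}z_{c_{i-1}}(k_i);(\alpha,\beta)\Bigr)=\sum_{0\le m_1<_{c_1}\cdots<_{c_{p-1}}m_p<\infty}\frac{(\alpha)_{m_1}}{m_1!}\frac{m_p!}{(\alpha)_{m_p+1}}\Bigl\{\prod_{i=1}^{p-1}\frac{1}{(m_i+\beta)^{k_i}}\Bigr\}\frac{1}{(m_p+\beta)^{k_p-1}}.$$ The map $Z^*$. For $q\ge1$, integers $r_1,\ldots,r_q\ge0$, $\mathrm{Re}(\beta)>0$, $\alpha\in\mathbb{C}\setminus\{0,-1,-2,\ldots\}$, and with $c_q:=1$, $$Z^{*}_{(\{r_i\}_{i=1}^{q})}\Bigl(\prod_{i=1}^{q}z_{c_{i-1}}(k_i);(\beta,\alpha)\Bigr)=\sum\frac{(\beta)_{m_1}}{m_1!}\frac{m_q!\,(m_q+\alpha)}{(\beta)_{m_q+1}}\cdot\frac{1}{(m_1+\beta)^{r_1}(m_1+\alpha)^{k_1}}\prod_{i=2}^{q}\Bigl\{\Bigl(\prod_{j=1}^{r_i}\frac{1}{M^{(i)}_j+\beta}\Bigr)\frac{1}{(m_i+\alpha)^{k_i}}\Bigr\},$$ where the sum is over all integers $m_1\ge 0$, $m_2,\ldots,m_q$ and $M^{(i)}_j$ ($2\le i\le q$, $1\le j\le r_i$) satisfying, for each $i=2,\ldots,q$, $$m_{i-1}<_{c_{i-1}}M^{(i)}_1\le\cdots\le M^{(i)}_{r_i}<_{1-c_i}m_i,$$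 this condition being read as $m_{i-1}<_{c_{i-1}}m_i$ when $r_i=0$. Also $Z^*(1;(\beta,\alpha))=1$. The maps $\sigma^{b,1}_r,\sigma_r$ ($r\ge0$). $\sigma_r^{b,1}(1)=\sigma_r(1)=1$ and, for $p\ge1$, $$\sigma_r^{b,1}\Bigl(\prod_{i=1}^{p}z_{c_{i-1}}(k_i)\Bigr)=\sum_{\substack{r_1+\cdots+r_p=r\\ r_i\ge0}}\Bigl\{\prod_{i=1}^{p-1}\binom{k_i+r_i-1}{r_i}\Bigr\}\binom{k_p+r_p-2}{r_p}\prod_{i=1}^{p}z_{c_{i-1}}(k_i+r_i),$$ $$\sigma_r\Bigl(\prod_{i=1}^{p}z_{c_{i-1}}(k_i)\Bigr)=\sum_{\substack{\sum_{i=1}^{p-1}c_ir_i+r_p=r\\ c_ir_i,\,r_p\ge0}}\Bigl\{\prod_{i=1}^{p-1}z_{c_{i-1}}(k_i+c_ir_i)\Bigr\}z_{c_{p-1}}(k_p+r_p).$$ Convention. In sums over conditions involving products such as $c_ir_i$ (or $c'_1r_1$), one sums over the values of these products: $r_i$ ranges over integers $\ge0$ if $c_i=1$, and there is only the single value $c_ir_i=0$ (i.e. $r_i$ is taken to be $0$) if $c_i=0$. In (i), if $v=1$ (so $q=0$) the right-hand side is read as $1$. *)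

theory Defs
  imports "HOL-Analysis.Analysis" "HOL-Library.Poly_Mapping"
begin

section \<open>Words\<close>

text \<open>A word in the non-commuting variables \<open>x\<^sub>0, x\<^sub>1, x\<^sub>-\<^sub>1\<close> is represented by the list of
  subscripts of its letters; the empty list is the word \<open>1\<close>.\<close>

type_synonym word = "int list"

definition zword :: "nat \<Rightarrow> nat \<Rightarrow> word" where
  "zword c k = int c # replicate (k - 1) (-1)"

text \<open>The list \<open>[(c\<^sub>0, k\<^sub>1), \<dots>, (c\<^bsub>p-1\<^esub>, k\<^sub>p)]\<close> of length \<open>p\<close> encodes the factors of
  \<open>z\<^bsub>c\<^sub>0\<^esub>(k\<^sub>1) \<cdots> z\<^bsub>c\<^bsub>p-1\<^esub>\<^esub>(k\<^sub>p)\<close>.  Below, \<open>cc s i\<close> is \<open>c\<^sub>i\<close> for \<open>0 \<le> i < p\<close>, with the convention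
  \<open>c\<^sub>p = 1\<close>, and \<open>kk s i\<close> is \<open>k\<^sub>i\<close> for \<open>1 \<le> i \<le> p\<close>.\<close>

type_synonym index = "(nat \<times> nat) list"

definition cc :: "index \<Rightarrow> nat \<Rightarrow> nat" where
  "cc s i = (if i < length s then fst (s ! i) else 1)"

definition kk :: "index \<Rightarrow> nat \<Rightarrow> nat" where
  "kk s i = snd (s ! (i - 1))"

definition word_of :: "index \<Rightarrow> word" where
  "word_of s = concat (map (\<lambda>(c, k). zword c k) s)"

definition indices :: "index set" where
  "indices = {s. s \<noteq> [] \<longrightarrow>
     cc s 0 = 1 \<and> (\<forall>i<length s. cc s i \<in> {0, 1}) \<and>
     (\<forall>i\<in>{1..<length s}. kk s i \<ge> 1) \<and> kk s (length s) \<ge> 2}"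

definition B0 :: "word set" where
  "B0 = word_of ` indices"

text \<open>\<open>word_of\<close> is injective on \<open>indices\<close> (lemma \<open>inj_on_word_of\<close>), so a word of \<open>B0\<close> has a
  unique factorisation.\<close>

definition index_of :: "word \<Rightarrow> index" where
  "index_of = the_inv_into indices word_of"

text \<open>The finitely supported functions \<open>word \<Rightarrow>\<^sub>0 rat\<close> are the rational linear combinations of
  words.\<close>

definition V0 :: "(word \<Rightarrow>\<^sub>0 rat) set" where
  "V0 = {f. Poly_Mapping.keys f \<subseteq> B0}"

definition tau :: "word \<Rightarrow> word" where
  "tau w = (if w = [] then [] else 1 # map uminus (rev (butlast (tl w))) @ [-1])"


section \<open>The multiple series\<close>

definition ltc :: "nat \<Rightarrow> nat \<Rightarrow> nat \<Rightarrow> bool" where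
  "ltc c a b = (if c = 1 then a < b else a \<le> b)"

text \<open>Summation variables \<open>m\<^sub>1, \<dots>, m\<^sub>p\<close> are extensional functions on \<open>{1..p}\<close>.  The series are
  unordered sums; they converge absolutely for the parameters considered, so that the value \<open>0\<close>
  of a divergent \<open>infsum\<close> does not come into play.\<close>

definition Z_dom :: "index \<Rightarrow> (nat \<Rightarrow> nat) set" where
  "Z_dom s = {m \<in> {1..length s} \<rightarrow>\<^sub>E UNIV.
     \<forall>i\<in>{1..<length s}. ltc (cc s i) (m i) (m (i + 1))}"

definition Z_word :: "word \<Rightarrow> complex \<Rightarrow> complex \<Rightarrow> complex" where
  "Z_word w \<alpha> \<beta> = (let s = index_of w; p = length s in
     if w = [] then 1
     else \<Sum>\<^sub>\<infinity>m\<in>Z_dom s.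
       pochhammer \<alpha> (m 1) / fact (m 1) * (fact (m p) / pochhammer \<alpha> (m p + 1)) *
       (\<Prod>i=1..<p. 1 / (of_nat (m i) + \<beta>) ^ kk s i) *
       (1 / (of_nat (m p) + \<beta>) ^ (kk s p - 1)))"

definition Z :: "(word \<Rightarrow>\<^sub>0 rat) \<Rightarrow> complex \<Rightarrow> complex \<Rightarrow> complex" where
  "Z f \<alpha> \<beta> =
     (\<Sum>w\<in>Poly_Mapping.keys f. of_rat (Poly_Mapping.lookup f w) * Z_word w \<alpha> \<beta>)"

definition Z1 :: "(word \<Rightarrow>\<^sub>0 rat) \<Rightarrow> complex \<Rightarrow> complex" where
  "Z1 f \<alpha> = Z f \<alpha> \<alpha>"

text \<open>In a pair \<open>(m, M)\<close>, \<open>m i\<close> is \<open>m\<^sub>i\<close> for \<open>1 \<le> i \<le> q\<close> and \<open>M i j\<close> is the \<open>j\<close>-th of the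
  variables interpolated between \<open>m\<^bsub>i-1\<^esub>\<close> and \<open>m\<^sub>i\<close>.  All of them may be taken in \<open>nat\<close>, since
  the inequalities bound them below by \<open>m\<^sub>1 \<ge> 0\<close>.\<close>

definition Zstar_dom :: "(nat \<Rightarrow> nat) \<Rightarrow> index \<Rightarrow> ((nat \<Rightarrow> nat) \<times> (nat \<Rightarrow> nat \<Rightarrow> nat)) set" where
  "Zstar_dom r s = {(m, M).
     m \<in> {1..length s} \<rightarrow>\<^sub>E UNIV \<and>
     M \<in> (\<Pi>\<^sub>E i\<in>{2..length s}. {1..r i} \<rightarrow>\<^sub>E UNIV) \<and>
     (\<forall>i\<in>{2..length s}.
        if r i = 0 then ltc (cc s (i - 1)) (m (i - 1)) (m i)
        else ltc (cc s (i - 1)) (m (i - 1)) (M i 1) \<and>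
             (\<forall>j\<in>{1..<r i}. M i j \<le> M i (j + 1)) \<and>
             ltc (1 - cc s i) (M i (r i)) (m i))}"

definition Zstar :: "(nat \<Rightarrow> nat) \<Rightarrow> word \<Rightarrow> complex \<Rightarrow> complex \<Rightarrow> complex" where
  "Zstar r w \<beta> \<alpha> = (let s = index_of w; q = length s in
     if w = [] then 1
     else \<Sum>\<^sub>\<infinity>(m, M)\<in>Zstar_dom r s.
       pochhammer \<beta> (m 1) / fact (m 1) *
       (fact (m q) * (of_nat (m q) + \<alpha>) / pochhammer \<beta> (m q + 1)) *
       (1 / ((of_nat (m 1) + \<beta>) ^ r 1 * (of_nat (m 1) + \<alpha>) ^ kk s 1)) *
       (\<Prod>i=2..q. (\<Prod>j=1..r i. 1 / (of_nat (M i j) + \<beta>)) *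
                    (1 / (of_nat (m i) + \<alpha>) ^ kk s i)))"


section \<open>The maps on words\<close>

definition sigma_b1 :: "nat \<Rightarrow> word \<Rightarrow> (word \<Rightarrow>\<^sub>0 rat)" where
  "sigma_b1 n w = (let s = index_of w; p = length s in
     if w = [] then Poly_Mapping.single [] 1
     else \<Sum>r | r \<in> {1..p} \<rightarrow>\<^sub>E UNIV \<and> (\<Sum>i=1..p. r i) = n.
       Poly_Mapping.single
         (word_of (map (\<lambda>i. (cc s (i - 1), kk s i + r i)) [1..<p+1]))
         (of_nat ((\<Prod>i=1..<p. (kk s i + r i - 1) choose r i) *
                  ((kk s p + r p - 2) choose r p))))"

text \<open>Where \<open>c\<^sub>i = 0\<close> the summation variable \<open>r\<^sub>i\<close> is pinned to \<open>0\<close>, so that each value of the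
  product \<open>c\<^sub>i r\<^sub>i\<close> is summed over exactly once.\<close>

definition sigma_r :: "nat \<Rightarrow> word \<Rightarrow> (word \<Rightarrow>\<^sub>0 rat)" where
  "sigma_r n w = (let s = index_of w; p = length s in
     if w = [] then Poly_Mapping.single [] 1
     else \<Sum>r | r \<in> {1..p} \<rightarrow>\<^sub>E UNIV \<and> (\<forall>i\<in>{1..<p}. cc s i = 0 \<longrightarrow> r i = 0) \<and>
               (\<Sum>i=1..<p. cc s i * r i) + r p = n.
       Poly_Mapping.single
         (word_of (map (\<lambda>i. (cc s (i - 1), kk s i + cc s i * r i)) [1..<p] @
                   [(cc s (p - 1), kk s p + r p)]))
         1)"


section \<open>Well-definedness\<close>

lemma indices_iff:
  "s \<in> indices \<longleftrightarrow> s = [] \<or>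
     (fst (hd s) = 1 \<and> (\<forall>(c, k)\<in>set s. c \<in> {0, 1} \<and> k \<ge> 1) \<and> snd (last s) \<ge> 2)"
proof (cases "s = []")
  case False
  have "(\<forall>i\<in>{1..<length s}. kk s i \<ge> 1) \<and> kk s (length s) \<ge> 2 \<longleftrightarrow>
        (\<forall>i<length s. snd (s ! i) \<ge> 1) \<and> snd (last s) \<ge> 2" (is "?L \<longleftrightarrow> ?R")
  proof
    assume L: ?L
    have l: "snd (last s) \<ge> 2" using L False by (simp add: kk_def last_conv_nth)
    have "snd (s ! i) \<ge> 1" if "i < length s" for i
    proof (cases "Suc i = length s")
      case True
      then show ?thesis using l False by (auto simp: last_conv_nth dest: arg_cong[of _ _ "\<lambda>x. x - 1"])
    next
      case F: False
      then have "Suc i \<in> {1..<length s}" using that by auto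
      then have "kk s (Suc i) \<ge> 1" using L by blast
      then show ?thesis by (simp add: kk_def)
    qed
    then show ?R using l by blast
  next
    assume ?R then show ?L using False by (auto simp: kk_def last_conv_nth)
  qed
  then show ?thesis using False
    by (auto simp: indices_def cc_def hd_conv_nth all_set_conv_all_nth case_prod_beta)
qed (simp add: indices_def)

lemma word_of_inj:
  assumes "\<forall>(c, k)\<in>set s. k \<ge> 1" "\<forall>(c, k)\<in>set t. k \<ge> 1" "word_of s = word_of t"
  shows "s = t"
  using assms
proof (induction s arbitrary: t)
  case Nil
  then show ?case by (cases t) (auto simp: word_of_def zword_def)
next
  case (Cons a s)
  obtain c k where a: "a = (c, k)" by (cases a)
  obtain d l t' where t: "t = (d, l) # t'"
    using Cons.prems by (cases t) (auto simp: word_of_def zword_def a)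
  have tw: "takeWhile ((=) (-1)) (replicate n (-1) @ word_of u) = replicate n (-1)" for n u
  proof -
    have "takeWhile ((=) (-1)) (word_of u) = []"
      by (cases u) (auto simp: word_of_def zword_def)
    then show ?thesis by (simp add: takeWhile_append)
  qed
  have eq: "int c # (replicate (k - 1) (-1) @ word_of s) =
            int d # (replicate (l - 1) (-1) @ word_of t')"
    using Cons.prems(3) by (simp add: a t word_of_def zword_def)
  then have cd: "c = d" and e2: "replicate (k - 1) (-1) @ word_of s = replicate (l - 1) (-1) @ word_of t'"
    by auto
  from arg_cong[OF e2, of "takeWhile ((=) (-1))"]
  have "replicate (k - 1) (-1::int) = replicate (l - 1) (-1)" by (simp only: tw)
  then have "k - 1 = l - 1" by (metis length_replicate)
  moreover have "k \<ge> 1" "l \<ge> 1" using Cons.prems by (auto simp: a t)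
  ultimately have kl: "k = l" by simp
  have "word_of s = word_of t'" using e2 kl by simp
  then have "s = t'" using Cons.IH[of t'] Cons.prems by (auto simp: t)
  then show ?case by (simp add: a t cd kl)
qed

lemma inj_on_word_of: "inj_on word_of indices"
proof (rule inj_onI)
  fix s t assume "s \<in> indices" "t \<in> indices" "word_of s = word_of t"
  then show "s = t" by (intro word_of_inj) (auto simp: indices_iff)
qed

lemma index_of_word_of: "s \<in> indices \<Longrightarrow> index_of (word_of s) = s"
  unfolding index_of_def by (rule the_inv_into_f_f[OF inj_on_word_of])

lemma exists_index:
  assumes "set w \<subseteq> {-1, 0, 1}" "w \<noteq> []" "hd w = 1"
  shows "\<exists>s. s \<noteq> [] \<and> fst (hd s) = 1 \<and> (\<forall>(c, k)\<in>set s. c \<in> {0, 1} \<and> k \<ge> 1) \<and>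
             word_of s = w \<and> (last w = -1 \<longrightarrow> snd (last s) \<ge> 2)"
  using assms
proof (induction w rule: rev_induct)
  case (snoc x w)
  show ?case
  proof (cases "w = []")
    case True
    then show ?thesis using snoc.prems
      by (intro exI[of _ "[(1, 1)]"]) (auto simp: word_of_def zword_def)
  next
    case False
    then obtain s where s: "s \<noteq> []" "fst (hd s) = 1"
      "\<forall>(c, k)\<in>set s. c \<in> {0, 1} \<and> k \<ge> 1" "word_of s = w"
      using snoc by auto
    show ?thesis
    proof (cases "x = -1")
      case True
      obtain u c k where u: "s = u @ [(c, k)]" using s(1) by (metis rev_exhaust surj_pair)
      have k: "k \<ge> 1" "c \<in> {0, 1}" using s(3) by (auto simp: u)
      have "zword c (Suc k) = zword c k @ [-1]" using k
        by (cases k) (auto simp: zword_def replicate_append_same)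
      then have "word_of (u @ [(c, Suc k)]) = w @ [x]"
        using s(4) True by (simp add: word_of_def u)
      moreover have "fst (hd (u @ [(c, Suc k)])) = 1" using s(2) by (cases u) (auto simp: u)
      moreover have "\<forall>(c, k)\<in>set (u @ [(c, Suc k)]). c \<in> {0, 1} \<and> k \<ge> 1" using s(3) by (auto simp: u)
      ultimately show ?thesis using k by (intro exI[of _ "u @ [(c, Suc k)]"]) auto
    next
      case F: False
      then have x: "x \<in> {0, 1}" using snoc.prems by auto
      then show ?thesis using s F
        by (intro exI[of _ "s @ [(nat x, 1)]"]) (auto simp: word_of_def zword_def)
    qed
  qed
qed simp

lemma B0_iff:
  "w \<in> B0 \<longleftrightarrow> w = [] \<or> (set w \<subseteq> {-1, 0, 1} \<and> w \<noteq> [] \<and> hd w = 1 \<and> last w = -1)"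
proof
  assume "w \<in> B0"
  then obtain s where s: "s \<in> indices" "w = word_of s" by (auto simp: B0_def)
  show "w = [] \<or> (set w \<subseteq> {-1, 0, 1} \<and> w \<noteq> [] \<and> hd w = 1 \<and> last w = -1)"
  proof (cases "s = []")
    case True
    then show ?thesis using s by (simp add: word_of_def)
  next
    case False
    with s have s': "fst (hd s) = 1" "\<forall>(c, k)\<in>set s. c \<in> {0, 1} \<and> k \<ge> 1" "snd (last s) \<ge> 2"
      by (auto simp: indices_iff)
    obtain u c k where u: "s = u @ [(c, k)]" using False by (metis rev_exhaust surj_pair)
    have "set w \<subseteq> {-1, 0, 1}" using s(2) s'(2) by (fastforce simp: word_of_def zword_def)
    moreover have "hd w = 1" using False s(2) s'(1) by (cases s) (auto simp: word_of_def zword_def)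
    moreover have "w \<noteq> []" "last w = -1" using s(2) s'(3) by (auto simp: u word_of_def zword_def)
    ultimately show ?thesis by blast
  qed
next
  assume "w = [] \<or> (set w \<subseteq> {-1, 0, 1} \<and> w \<noteq> [] \<and> hd w = 1 \<and> last w = -1)"
  then show "w \<in> B0"
  proof
    assume "w = []"
    then have "w = word_of []" by (simp add: word_of_def)
    then show ?thesis by (auto simp: B0_def indices_iff)
  next
    assume w: "set w \<subseteq> {-1, 0, 1} \<and> w \<noteq> [] \<and> hd w = 1 \<and> last w = -1"
    then obtain s where "s \<noteq> []" "fst (hd s) = 1"
      "\<forall>(c, k)\<in>set s. c \<in> {0, 1} \<and> k \<ge> 1" "word_of s = w" "snd (last s) \<ge> 2"
      using exists_index[of w] by auto
    then show ?thesis unfolding B0_def by (intro image_eqI[of _ _ s]) (simp_all add: indices_iff)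
  qed
qed

lemma tau_B0:
  assumes "w \<in> B0"
  shows "tau w \<in> B0"
proof (cases "w = []")
  case False
  with assms have "set w \<subseteq> {-1, 0, 1}" by (simp add: B0_iff)
  moreover have "set (butlast (tl w)) \<subseteq> set w"
    using False by (auto dest!: in_set_butlastD list.set_sel(2))
  ultimately show ?thesis using False by (auto simp: B0_iff tau_def)
qed (simp add: B0_iff tau_def)

lemma finite_bounded_PiE:
  assumes "\<And>r i. P r \<Longrightarrow> i \<in> {1..p} \<Longrightarrow> r i \<le> n"
  shows "finite {r. r \<in> {1..p::nat} \<rightarrow>\<^sub>E UNIV \<and> P (r :: nat \<Rightarrow> nat)}"
proof (rule finite_subset)
  show "{r. r \<in> {1..p} \<rightarrow>\<^sub>E UNIV \<and> P r} \<subseteq> {1..p} \<rightarrow>\<^sub>E {..n}"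
    using assms by (auto simp del: atLeastAtMost_iff One_nat_def simp: PiE_iff extensional_def)
qed (simp add: finite_PiE)

lemma finite_sigma_b1_range:
  "finite {r. r \<in> {1..p::nat} \<rightarrow>\<^sub>E UNIV \<and> (\<Sum>i=1..p. r i) = (n::nat)}"
proof (rule finite_bounded_PiE)
  fix r :: "nat \<Rightarrow> nat" and i
  assume "(\<Sum>i=1..p. r i) = n" "i \<in> {1..p}"
  then show "r i \<le> n" using member_le_sum[of i "{1..p}" r] by auto
qed

lemma finite_sigma_range:
  "finite {r. r \<in> {1..p::nat} \<rightarrow>\<^sub>E UNIV \<and> (\<forall>i\<in>{1..<p}. c i = 0 \<longrightarrow> r i = 0) \<and>
              (\<Sum>i=1..<p. c i * r i) + r p = (n::nat)}"
proof (rule finite_bounded_PiE)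
  fix r :: "nat \<Rightarrow> nat" and i
  assume r: "(\<forall>i\<in>{1..<p}. c i = 0 \<longrightarrow> r i = 0) \<and> (\<Sum>i=1..<p. c i * r i) + r p = n"
    and i: "i \<in> {1..p}"
  show "r i \<le> n"
  proof (cases "i = p")
    case False
    then have i': "i \<in> {1..<p}" using i by auto
    have "r i \<le> c i * r i" using r i' by (cases "c i") auto
    also have "\<dots> \<le> (\<Sum>i=1..<p. c i * r i)"
      using member_le_sum[of i "{1..<p}" "\<lambda>i. c i * r i"] i' by auto
    finally show ?thesis using r by linarith
  next
    case True
    then show ?thesis using r by auto
  qed
qed

lemma finite_Zstar_range:
  "finite {r. r \<in> {1..q::nat} \<rightarrow>\<^sub>E UNIV \<and> (c 1 = 0 \<longrightarrow> r 1 = 0) \<and>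
              c 1 * r 1 + (\<Sum>i=2..q. r i) = (n::nat)}"
proof (rule finite_bounded_PiE)
  fix r :: "nat \<Rightarrow> nat" and i
  assume r: "(c 1 = 0 \<longrightarrow> r 1 = 0) \<and> c 1 * r 1 + (\<Sum>i=2..q. r i) = n"
    and i: "i \<in> {1..q}"
  show "r i \<le> n"
  proof (cases "i = 1")
    case True
    have "r 1 \<le> c 1 * r 1" using r by (cases "c 1") auto
    then have "r 1 \<le> n" using r by linarith
    then show ?thesis using True by simp
  next
    case False
    then have "r i \<le> (\<Sum>i=2..q. r i)"
      using member_le_sum[of i "{2..q}" r] i by auto
    then show ?thesis using r by linarith
  qed
qed

lemma indices_add:
  assumes "s \<in> indices"
  shows "map (\<lambda>i. (cc s (i - 1), kk s i + r i)) [1..<length s + 1] \<in> indices"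
proof (cases "s = []")
  case False
  let ?t = "map (\<lambda>i. (cc s (i - 1), kk s i + r i)) [1..<length s + 1]"
  have nth: "?t ! i = (cc s i, kk s (i + 1) + r (i + 1))" if "i < length s" for i
    using that by (simp del: upt_Suc)
  have len: "length ?t = length s" by (simp del: upt_Suc)
  have "cc ?t i = cc s i" for i
    using nth[of i] len by (auto simp: cc_def simp del: upt_Suc length_map)
  moreover have "kk ?t i = kk s i + r i" if "i \<in> {1..length s}" for i
  proof -
    have "i - 1 < length s" "i - 1 + 1 = i" using that by auto
    then show ?thesis using nth[of "i - 1"] by (simp only: kk_def[of ?t] snd_conv)
  qed
  ultimately show ?thesis
    using assms False unfolding indices_def len mem_Collect_eq
    by (auto simp del: upt_Suc simp: Suc_le_eq intro: trans_le_add1)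
qed (simp add: indices_def)

lemma sum_V0:
  assumes "\<And>x. x \<in> A \<Longrightarrow> f x \<in> B0"
  shows "(\<Sum>x\<in>A. Poly_Mapping.single (f x) (g x)) \<in> V0"
  using assms
proof (induction A rule: infinite_finite_induct)
  case (insert x A)
  then show ?case
    using Poly_Mapping.keys_add[of "Poly_Mapping.single (f x) (g x)" "\<Sum>x\<in>A. Poly_Mapping.single (f x) (g x)"]
    by (fastforce simp: V0_def split: if_splits)
qed (auto simp: V0_def)

lemma sigma_b1_V0:
  assumes "w \<in> B0"
  shows "sigma_b1 n w \<in> V0"
proof (cases "w = []")
  case True
  then show ?thesis using assms by (simp add: sigma_b1_def V0_def)
next
  case False
  have "index_of w \<in> indices" using assms by (auto simp: B0_def index_of_word_of)
  from indices_add[OF this] show ?thesis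
    unfolding sigma_b1_def Let_def if_not_P[OF False]
    by (intro sum_V0) (simp add: B0_def del: upt_Suc)
qed

lemma sigma_r_V0:
  assumes "w \<in> B0"
  shows "sigma_r n w \<in> V0"
proof (cases "w = []")
  case True
  then show ?thesis using assms by (simp add: sigma_r_def V0_def)
next
  case False
  let ?s = "index_of w"
  let ?p = "length ?s"
  have s: "?s \<in> indices" using assms by (auto simp: B0_def index_of_word_of)
  have "word_of ?s = w" using assms by (auto simp: B0_def index_of_word_of)
  then have "?s \<noteq> []" using False by (auto simp: word_of_def)
  then have p: "[1..<?p + 1] = [1..<?p] @ [?p]" by (simp add: Suc_le_eq)
  have "map (\<lambda>i. (cc ?s (i - 1), kk ?s i + cc ?s i * r i)) [1..<?p] @ [(cc ?s (?p - 1), kk ?s ?p + r ?p)]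
        = map (\<lambda>i. (cc ?s (i - 1), kk ?s i + cc ?s i * r i)) [1..<?p + 1]" for r
    unfolding p by (simp add: cc_def)
  then show ?thesis
    unfolding sigma_r_def Let_def if_not_P[OF False]
    using indices_add[OF s] by (intro sum_V0) (simp add: B0_def del: upt_Suc)
qed

end

theory Submission
  imports Defs
begin

text \<open>
  Both identities compare two sequences indexed by \<open>r\<close>, and both are proved by comparing the power
  series in an auxiliary variable \<open>z\<close> that have these sequences as coefficients
  (\<open>power_series_coeff_eq\<close>).

  For (i), \<open>\<Sum>\<^sub>r C(k + r - 1, r) z\<^sup>r / (m + \<beta>)\<^bsup>k + r\<^esup> = 1 / (m + \<beta> - z)\<^sup>k\<close>, so the left-hand sides have the
  generating function \<open>Z(v; (\<alpha>, \<beta> - z))\<close>. On the right, the ranges of the variables between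
  consecutive \<open>m\<^sub>i\<close>, together with the optional factor at \<open>m\<^sub>1\<close>, cut the interval \<open>[m\<^sub>1, m\<^sub>q]\<close> into
  disjoint pieces, so summing over everything but the \<open>m\<^sub>i\<close> yields
  \<open>\<Prod>\<^sub>j 1 / (1 - z / (j + \<beta>))\<close> over \<open>m\<^sub>1 \<le> j \<le> m\<^sub>q\<close>. This turns \<open>(\<beta>)\<^bsub>m\<^sub>1\<^esub> / (\<beta>)\<^bsub>m\<^sub>q + 1\<^esub>\<close> into the same
  quotient for \<open>\<beta> - z\<close>, and the generating function is \<open>Z(\<tau>(v); (\<beta> - z, \<alpha>))\<close>. For (ii), the
  generating function is \<open>Z(v; \<alpha>)\<close> with an additional factor \<open>(m\<^sub>i + \<alpha>) / (m\<^sub>i + \<alpha> - z)\<close> wherever the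
  inequality after \<open>m\<^sub>i\<close> is strict.

  What remains is the duality \<open>Z(v; (a, b)) = Z(\<tau>(v); (b, a))\<close> and its deformation by
  \<open>(m + a) / (m + a - l)\<close> in the case \<open>a = b\<close>. Both are instances of one connected sum. Reading a word as
  a product of operators on functions of \<open>m\<close> (multiplication by \<open>1 / (m + b)\<close> for \<open>x\<^sub>-\<^sub>1\<close>, weighted sums
  over \<open>j \<ge> m\<close> and over \<open>j > m\<close> for \<open>x\<^sub>0\<close> and \<open>x\<^sub>1\<close>), one applies it to a function \<open>C(m, n)\<close> of two
  variables, a quotient of Pochhammer symbols symmetric under exchanging \<open>(m, a)\<close> and \<open>(n, b)\<close>. It is chosen
  such that the letter \<open>e\<close> acting on \<open>m\<close> has the same effect as the letter \<open>-e\<close> acting on \<open>n\<close> (lemma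
  \<open>transport\<close>). Operators in \<open>m\<close> commute with operators in \<open>n\<close>, so the letters of a word can be carried over
  one after the other; they arrive negated and in reversed order, which is the dual word
  (\<open>connected_sum_duality\<close>). At either end the sum over the free variable is a
  Gauss hypergeometric series at \<open>1\<close>. For \<open>l = 0\<close> and for \<open>a = b\<close> it produces the
  factor \<open>m! / (a)\<^bsub>m + 1\<^esub>\<close> of \<open>Z\<close>, with its deformation, times a nonzero constant which is the same at
  both ends.

  All interchanges of summations rest on absolute convergence. It is controlled by comparison with
  \<open>\<phi>\<^sub>s(m) = m! / (s + 1)\<^sub>m\<close>, of order \<open>m\<^bsup>-s\<^esup>\<close>: the class of functions dominated by \<open>\<phi>\<^sub>s\<close> is
  stable under all letters, since \<open>\<phi>\<^sub>s(m) - \<phi>\<^sub>s(m + 1) = s \<phi>\<^sub>s(m) / (m + s + 1)\<close>.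
\<close>

section \<open>Growth of Pochhammer symbols\<close>

lemma summable_inverse_square: "(\<lambda>n. c / (real n + 1) ^ 2) summable_on UNIV"
proof -
  have "summable (\<lambda>n. inverse ((real (Suc n)) ^ 2))"
    using inverse_power_summable[of 2, where 'a = real] by (subst summable_Suc_iff) simp
  moreover have "(\<lambda>n. inverse ((real (Suc n)) ^ 2)) = (\<lambda>n. 1 / (real n + 1) ^ 2)"
    by (simp add: divide_inverse add.commute fun_eq_iff)
  ultimately have "(\<lambda>n. 1 / (real n + 1) ^ 2) summable_on UNIV"
    by (intro summable_nonneg_imp_summable_on) (simp_all only:, simp)
  from summable_on_cmult_right[OF this, of c] show ?thesis by simp
qed

text \<open>The product \<open>\<Prod> (1 + c / (n + 1)\<^sup>2)\<close> converges, which bounds every sequence with such growth ratios.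
  The two comparisons of Pochhammer symbols below are of this kind.\<close>

lemma bounded_if_ratio_le:
  fixes f :: "nat \<Rightarrow> real"
  assumes nonneg: "\<And>n. 0 \<le> f n" and c: "0 \<le> c"
    and ratio: "\<And>n. f (Suc n) \<le> f n * (1 + c / (real n + 1) ^ 2)"
  obtains B where "0 < B" "\<And>n. f n \<le> B"
proof -
  define g where "g n = c / (real n + 1) ^ 2" for n
  have sg: "summable g"
    using summable_on_imp_summable[OF summable_inverse_square[of c]] by (simp add: g_def[abs_def])
  have g0: "0 \<le> g n" for n using c by (simp add: g_def)
  have step: "f n \<le> f 0 * exp (sum g {..<n})" for n
  proof (induction n)
    case (Suc n)
    have "f (Suc n) \<le> f n * (1 + g n)" using ratio[of n] by (simp add: g_def)
    also have "\<dots> \<le> f n * exp (g n)" using nonneg by (intro mult_left_mono) (auto intro: exp_ge_add_one_self)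
    also have "\<dots> \<le> f 0 * exp (sum g {..<n}) * exp (g n)" using Suc by (intro mult_right_mono) auto
    finally show ?case by (simp add: exp_add mult.assoc)
  qed simp
  have "f n \<le> f 0 * exp (suminf g) + 1" for n
  proof -
    have "sum g {..<n} \<le> suminf g" using sg g0 by (intro sum_le_suminf) auto
    then have "f 0 * exp (sum g {..<n}) \<le> f 0 * exp (suminf g)"
      using nonneg by (intro mult_left_mono) auto
    then show ?thesis using step[of n] by linarith
  qed
  moreover have "0 < f 0 * exp (suminf g) + 1" using nonneg[of 0] by (simp add: add_nonneg_pos)
  ultimately show ?thesis using that by blast
qed

lemma norm_add_of_nat_ge: "Re z > 0 \<Longrightarrow> real m + Re z \<le> norm (of_nat m + z :: complex)"
  by (metis abs_Re_le_cmod abs_le_D1 plus_complex.sel(1) complex_Re_of_nat)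

lemma of_nat_add_neq_0: "Re z > 0 \<Longrightarrow> of_nat m + z \<noteq> (0 :: complex)"
  by (metis add_nonneg_pos norm_add_of_nat_ge norm_zero not_less of_nat_0_le_iff)

lemma pochhammer_neq_0: "Re z > 0 \<Longrightarrow> pochhammer z n \<noteq> (0 :: complex)"
  using of_nat_add_neq_0 by (metis add.commute add.right_inverse pochhammer_eq_0_iff)

lemma pochhammer_le_norm:
  assumes "Re z > 0" shows "pochhammer (Re z) n \<le> norm (pochhammer z n)"
proof (induction n)
  case (Suc n)
  then show ?case using norm_add_of_nat_ge[OF assms, of n] assms
    by (auto simp: pochhammer_Suc norm_mult add.commute intro!: mult_mono)
qed simp

lemma norm_add_of_nat_le:
  assumes "Re z > 0" "x > 0"
  obtains c where "c > 0" "\<And>m. norm (of_nat m + z :: complex) \<le> c * (real m + x)"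
proof (rule that[of "max 1 (norm z / x)"])
  fix m
  have "norm (of_nat m + z) \<le> real m + norm z" by (metis norm_of_nat norm_triangle_ineq)
  also have "\<dots> \<le> max 1 (norm z / x) * real m + max 1 (norm z / x) * x"
    using assms by (intro add_mono mult_le_cancel_right1[THEN iffD2])
      (auto simp: max_def field_simps mult_le_cancel_right1)
  finally show "norm (of_nat m + z) \<le> max 1 (norm z / x) * (real m + x)" by (simp add: distrib_left)
qed auto

text \<open>Together with \<open>pochhammer_le_norm\<close> this lets real parameters majorise complex ones:
  \<open>\<bar>z + n\<bar> / (Re z + n) \<le> 1 + (Im z / (Re z + n))\<^sup>2\<close>.\<close>

lemma norm_pochhammer_le:
  assumes z: "Re z > 0"
  obtains A where "A > 0" "\<And>n. norm (pochhammer z n) \<le> A * pochhammer (Re z) n"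
proof -
  define f where "f n = norm (pochhammer z n) / pochhammer (Re z) n" for n
  define d where "d = min (Re z) 1"
  have d: "0 < d" "d \<le> 1" "d \<le> Re z" using z by (auto simp: d_def)
  have pos: "0 < pochhammer (Re z) n" for n using z by (rule pochhammer_pos)
  have ratio: "f (Suc n) \<le> f n * (1 + (Im z / d) ^ 2 / (real n + 1) ^ 2)" for n
  proof -
    have a: "0 < real n + Re z" using z by linarith
    have b: "d * (real n + 1) \<le> real n + Re z"
      using mult_right_mono[OF d(2), of "real n"] d by (simp add: distrib_left)
    define t where "t = Im z / (real n + Re z)"
    have "Im z = t * (real n + Re z)" using a by (simp add: t_def)
    then have "norm (z + of_nat n) = sqrt ((real n + Re z) ^ 2 + (t * (real n + Re z)) ^ 2)"
      by (simp add: cmod_def add.commute)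
    also have "\<dots> \<le> (real n + Re z) * (1 + t ^ 2)"
    proof (rule real_le_lsqrt)
      have "((real n + Re z) * (1 + t ^ 2)) ^ 2 - ((real n + Re z) ^ 2 + (t * (real n + Re z)) ^ 2)
          = (real n + Re z) ^ 2 * (t ^ 2 + t ^ 4)"
        by algebra
      moreover have "\<dots> \<ge> 0" by simp
      ultimately show "(real n + Re z) ^ 2 + (t * (real n + Re z)) ^ 2 \<le> ((real n + Re z) * (1 + t ^ 2)) ^ 2"
        by linarith
    qed (use a in simp)
    finally have "norm (z + of_nat n) / (Re z + real n) \<le> 1 + t ^ 2"
      using a by (simp add: divide_le_eq mult.commute add.commute)
    also note t_def
    also have "(Im z / (real n + Re z)) ^ 2 \<le> (Im z / (d * (real n + 1))) ^ 2"
      unfolding power_divide using a b d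
      by (intro divide_left_mono power_mono) (auto intro!: mult_pos_pos add_nonneg_pos)
    finally have "norm (z + of_nat n) / (Re z + real n) \<le> 1 + (Im z / d) ^ 2 / (real n + 1) ^ 2"
      by (simp add: power_divide power_mult_distrib)
    moreover have "f (Suc n) = f n * (norm (z + of_nat n) / (Re z + real n))"
      by (simp add: f_def pochhammer_Suc norm_mult)
    moreover have "0 \<le> f n" using pos[of n] by (simp add: f_def)
    ultimately show ?thesis by (metis mult_left_mono)
  qed
  have f0: "\<And>n. 0 \<le> f n" using pos by (simp add: f_def less_imp_le)
  obtain B where "0 < B" "\<And>n. f n \<le> B"
    using bounded_if_ratio_le[of f, OF f0 _ ratio] by auto
  then show ?thesis using pos that[of B] by (simp add: f_def divide_le_eq)
qed

text \<open>The comparison functions for all convergence arguments. They are of order \<open>m\<^bsup>-s\<^esup>\<close>, but, unlike powers,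
  their differences have a closed form, so that weighted tail sums telescope exactly.\<close>

definition phi :: "real \<Rightarrow> nat \<Rightarrow> real" where
  "phi s m = fact m / pochhammer (s + 1) m"

lemma phi_pos: "s > 0 \<Longrightarrow> 0 < phi s m"
  by (simp add: phi_def pochhammer_pos)

lemma phi_nonneg [simp]: "s > 0 \<Longrightarrow> 0 \<le> phi s m"
  by (simp add: phi_pos less_imp_le)

lemma phi_Suc_diff:
  assumes "s > 0" shows "phi s m - phi s (Suc m) = s * (phi s m / (real m + s + 1))"
proof -
  have "phi s (Suc m) = phi s m * ((real m + 1) / (real m + s + 1))"
    by (simp add: phi_def pochhammer_Suc add_ac)
  then show ?thesis using assms by (simp add: field_simps)
qed

text \<open>\<open>1 / \<phi>\<^sub>s(m) = \<Prod> (1 + s / k)\<close> over \<open>1 \<le> k \<le> m\<close>, which is at least \<open>1 + s H\<^sub>m\<close> for the harmonic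
  number \<open>H\<^sub>m\<close>.\<close>

lemma phi_tendsto_0:
  assumes "s > 0" shows "phi s \<longlonglongrightarrow> 0"
proof -
  have b: "1 + s * harm m \<le> 1 / phi s m" for m
  proof (induction m)
    case (Suc m)
    have h: "0 \<le> (harm m :: real)" by (simp add: harm_nonneg)
    have "1 + s * harm (Suc m) \<le> (1 + s * harm m) * (1 + s / (real m + 1))"
      using assms h by (simp add: harm_Suc field_simps)
    also have "\<dots> \<le> 1 / phi s m * (1 + s / (real m + 1))" 
      using Suc assms by (intro mult_right_mono) auto
    also have "\<dots> = 1 / phi s (Suc m)"
      using assms by (simp add: phi_def pochhammer_Suc field_simps)
    finally show ?case .
  qed (simp add: phi_def harm_def)
  have "filterlim (\<lambda>m. 1 + s * harm m :: real) at_top sequentially"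
    by (intro filterlim_tendsto_add_at_top[OF tendsto_const]
        filterlim_tendsto_pos_mult_at_top[OF tendsto_const assms harm_at_top])
  then have "filterlim (\<lambda>m. 1 / phi s m) at_top sequentially"
    by (rule filterlim_at_top_mono) (simp add: b)
  then have "(\<lambda>m. inverse (1 / phi s m)) \<longlonglongrightarrow> 0" by (rule tendsto_inverse_0_at_top)
  then show ?thesis by simp
qed

lemma telescope_sums_to_0:
  fixes G :: "nat \<Rightarrow> 'a :: real_normed_vector"
  assumes "G \<longlonglongrightarrow> 0" shows "(\<lambda>j. G j - G (Suc j)) sums G 0"
  using telescope_sums'[OF assms] by simp

lemma phi_tail_has_sum:
  assumes s: "s > 0"
  shows "((\<lambda>j. if m \<le> j then phi s j / (real j + s + 1) else 0) has_sum phi s m / s) UNIV"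
proof -
  define G where "G j = phi s (max m j) / s" for j
  have "(\<lambda>j. phi s (j + m)) \<longlonglongrightarrow> 0" using LIMSEQ_ignore_initial_segment[OF phi_tendsto_0[OF s]] .
  then have "(\<lambda>j. phi s (max m (j + m))) \<longlonglongrightarrow> 0" by (simp add: max_def)
  then have "(\<lambda>j. phi s (max m j)) \<longlonglongrightarrow> 0" by (rule LIMSEQ_offset)
  then have "G \<longlonglongrightarrow> 0 / s" unfolding G_def by (intro tendsto_divide) (use s in auto)
  then have "(\<lambda>j. G j - G (Suc j)) sums G 0" by (intro telescope_sums_to_0) simp
  moreover have "G j - G (Suc j) = (if m \<le> j then phi s j / (real j + s + 1) else 0)" for j
    using phi_Suc_diff[OF s, of j] s
    by (auto simp: G_def max_def not_less_eq_eq Suc_le_eq le_Suc_eq diff_divide_distrib[symmetric])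
  ultimately have "(\<lambda>j. if m \<le> j then phi s j / (real j + s + 1) else 0) sums (phi s m / s)"
    by (simp add: G_def)
  then show ?thesis using s by (intro sums_nonneg_imp_has_sum) auto
qed

text \<open>The quotient of the two sides grows by the factor \<open>1 + x y / ((n + 1) (x + y + 1 + n))\<close>.\<close>

lemma pochhammer_product_le:
  fixes x y :: real
  assumes x: "x > 0" and y: "y > 0"
  obtains B where "B > 0" "\<And>n. pochhammer (x + 1) n * pochhammer (y + 1) n \<le> B * (fact n * pochhammer (x + y + 1) n)"
proof -
  define f where "f n = pochhammer (x + 1) n * pochhammer (y + 1) n / (fact n * pochhammer (x + y + 1) n)" for n
  have p: "0 < pochhammer (x + y + 1) n" "0 < pochhammer (x + 1) n" "0 < pochhammer (y + 1) n" for n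
    using assms by (auto intro!: pochhammer_pos)
  have f0: "0 \<le> f n" for n using p[of n] by (simp add: f_def)
  have ratio: "f (Suc n) \<le> f n * (1 + (x * y) / (real n + 1) ^ 2)" for n
  proof -
    have "f (Suc n) = f n * ((x + 1 + n) * (y + 1 + n) / ((real n + 1) * (x + y + 1 + n)))"
      by (simp add: f_def pochhammer_Suc add_ac mult_ac)
    also have "(x + 1 + n) * (y + 1 + n) = (real n + 1) * (x + y + 1 + n) + x * y"
      by (simp add: algebra_simps)
    also have "\<dots> / ((real n + 1) * (x + y + 1 + n))
        = 1 + (x * y) / ((real n + 1) * (x + y + 1 + n))"
      using x y by (simp add: add_divide_distrib)
    also have "f n * \<dots> \<le> f n * (1 + (x * y) / (real n + 1) ^ 2)"
      using x y f0 unfolding power2_eq_square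
      by (intro mult_left_mono add_left_mono divide_left_mono) (auto intro!: mult_pos_pos)
    finally show ?thesis .
  qed
  obtain B where "0 < B" "\<And>n. f n \<le> B"
    using bounded_if_ratio_le[of f, OF f0 _ ratio] x y by auto
  then show ?thesis using p that[of B] by (simp add: f_def divide_le_eq)
qed

text \<open>This is the bound for the connector at real parameters. The quotient of the two sides is
  decreasing in \<open>m\<close> as soon as \<open>n \<ge> x y\<close>, and in \<open>n\<close> as soon as \<open>m \<ge> x' y'\<close>; outside a finite square it is
  therefore bounded by its values on the axes, where \<open>pochhammer_product_le\<close> applies.\<close>

lemma pochhammer_quotient_le:
  fixes x y x' y' :: real
  assumes x: "x > 0" and y: "y > 0" and x': "x' > 0" and y': "y' > 0" and S: "x + y = x' + y'"
  obtains B where "B > 0"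
    "\<And>m n. pochhammer (x + 1) m * pochhammer (y + 1) m * (pochhammer (x' + 1) n * pochhammer (y' + 1) n)
        \<le> B * (fact m * fact n * pochhammer (x + y + 1) (m + n))"
proof -
  define D where "D m n = pochhammer (x + 1) m * pochhammer (y + 1) m * (pochhammer (x' + 1) n * pochhammer (y' + 1) n)
        / (fact m * fact n * pochhammer (x + y + 1) (m + n))" for m n
  have p: "0 < pochhammer (x + y + 1) n" "0 < pochhammer (x + 1) n" "0 < pochhammer (y + 1) n"
     "0 < pochhammer (x' + 1) n"  "0 < pochhammer (y' + 1) n" for n
    using assms by (auto intro!: pochhammer_pos)
  have D0: "0 \<le> D m n" for m n using p[of m] p[of n] p(1)[of "m+n"] by (simp add: D_def)
  obtain B1 where B1: "B1 > 0" "\<And>n. pochhammer (x + 1) n * pochhammer (y + 1) n \<le> B1 * (fact n * pochhammer (x + y + 1) n)"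
    using pochhammer_product_le[OF x y] by blast
  obtain B2 where B2: "B2 > 0" "\<And>n. pochhammer (x' + 1) n * pochhammer (y' + 1) n \<le> B2 * (fact n * pochhammer (x' + y' + 1) n)"
    using pochhammer_product_le[OF x' y'] by blast
  have Dm0: "D m 0 \<le> B1" for m using B1(2)[of m] p(1)[of m] by (simp add: D_def divide_le_eq)
  have D0n: "D 0 n \<le> B2" for n using B2(2)[of n] p(1)[of n] by (simp add: D_def divide_le_eq S)
  have stepm: "D (Suc m) n \<le> D m n" if "x * y \<le> real n" for m n
  proof -
    have "D (Suc m) n = D m n * ((x + 1 + m) * (y + 1 + m) / ((real m + 1) * (x + y + 1 + m + n)))"
      by (simp add: D_def pochhammer_Suc add_ac mult_ac)
    also have "\<dots> \<le> D m n * 1"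
    proof (intro mult_left_mono D0)
      have "x * y \<le> real n * (real m + 1)" using that by (simp add: distrib_left add_increasing)
      then have "(x + 1 + m) * (y + 1 + m) \<le> (real m + 1) * (x + y + 1 + m + n)"
        by (simp add: algebra_simps)
      then show "(x + 1 + m) * (y + 1 + m) / ((real m + 1) * (x + y + 1 + m + n)) \<le> 1"
        using x y by (subst divide_le_eq_1_pos) (auto intro!: mult_pos_pos)
    qed
    finally show ?thesis by simp
  qed
  have stepn: "D m (Suc n) \<le> D m n" if "x' * y' \<le> real m" for m n
  proof -
    have "D m (Suc n) = D m n * ((x' + 1 + n) * (y' + 1 + n) / ((real n + 1) * (x + y + 1 + m + n)))"
      by (simp add: D_def pochhammer_Suc add_ac mult_ac)
    also have "\<dots> \<le> D m n * 1"
    proof (intro mult_left_mono D0)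
      have "x' * y' \<le> real m * (real n + 1)" using that by (simp add: distrib_left add_increasing)
      then have "(x' + 1 + n) * (y' + 1 + n) \<le> (real n + 1) * (x' + y' + 1 + m + n)"
        by (simp add: algebra_simps)
      then show "(x' + 1 + n) * (y' + 1 + n) / ((real n + 1) * (x + y + 1 + m + n)) \<le> 1"
        using x y x' y' unfolding S by (subst divide_le_eq_1_pos) (auto intro!: mult_pos_pos)
    qed
    finally show ?thesis by simp
  qed
  obtain N :: nat where N: "x * y \<le> real N" "x' * y' \<le> real N"
    using real_arch_simple[of "max (x * y) (x' * y')"] by auto
  define B where "B = B1 + B2 + (\<Sum>m<N. \<Sum>n<N. D m n)"
  have nn: "0 \<le> (\<Sum>m<N. \<Sum>n<N. D m n)" by (intro sum_nonneg D0)
  have "D m n \<le> B" for m n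
  proof -
    consider "N \<le> n" | "N \<le> m" | "m < N" "n < N" by linarith
    then show ?thesis
    proof cases
      case 1
      then have "x * y \<le> real n" using N by linarith
      then have "D m n \<le> D 0 n" using lift_Suc_antimono_le[of "\<lambda>m. D m n" 0 m] stepm by blast
      then show ?thesis using D0n[of n] nn B1 by (simp add: B_def)
    next
      case 2
      then have "x' * y' \<le> real m" using N by linarith
      then have "D m n \<le> D m 0" using lift_Suc_antimono_le[of "D m" 0 n] stepn by blast
      then show ?thesis using Dm0[of m] nn B2 by (simp add: B_def)
    next
      case 3
      have "D m n \<le> (\<Sum>n<N. D m n)" using 3 D0 by (intro member_le_sum) auto
      also have "\<dots> \<le> (\<Sum>m<N. \<Sum>n<N. D m n)"
        using 3 D0 by (intro member_le_sum[of m "{..<N}" "\<lambda>m. \<Sum>n<N. D m n"] sum_nonneg) auto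
      finally show ?thesis using B1 B2 by (simp add: B_def)
    qed
  qed
  moreover have "B > 0" using B1 B2 nn by (simp add: B_def)
  ultimately show ?thesis using that[of B] p by (simp add: D_def divide_le_eq)
qed

section \<open>Letters as operators\<close>

text \<open>The operators of the letters are infinite upper triangular matrices. A strict inequality
  carries the deformation factor \<open>(m + b) / (m + b - l)\<close> at the variable \<open>m\<close> that precedes it.\<close>

definition letter_kernel :: "complex \<Rightarrow> complex \<Rightarrow> int \<Rightarrow> nat \<Rightarrow> nat \<Rightarrow> complex" where
  "letter_kernel b l e m j =
     (if e = -1 then (if j = m then 1 / (of_nat j + b) else 0)
      else if e = 0 then (if m \<le> j then 1 / (of_nat j + b) else 0)
      else (if m < j then (of_nat m + b) / (of_nat m + (b - l)) * (1 / (of_nat j + b)) else 0))"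

definition letter_op :: "complex \<Rightarrow> complex \<Rightarrow> int \<Rightarrow> (nat \<Rightarrow> complex) \<Rightarrow> nat \<Rightarrow> complex" where
  "letter_op b l e f m = (\<Sum>\<^sub>\<infinity>j. letter_kernel b l e m j * f j)"

definition word_op :: "complex \<Rightarrow> complex \<Rightarrow> word \<Rightarrow> (nat \<Rightarrow> complex) \<Rightarrow> nat \<Rightarrow> complex" where
  "word_op b l w = foldr (letter_op b l) w"

lemma word_op_simps [simp]:
  "word_op b l [] f = f"
  "word_op b l (e # w) f = letter_op b l e (word_op b l w f)"
  "word_op b l (w @ w') f = word_op b l w (word_op b l w' f)"
  by (simp_all add: word_op_def)

definition dominated :: "real \<Rightarrow> real \<Rightarrow> (nat \<Rightarrow> complex) \<Rightarrow> bool" where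
  "dominated s C f \<longleftrightarrow> (\<forall>m. norm (f m) \<le> C * phi s m)"

definition decays :: "real \<Rightarrow> (nat \<Rightarrow> complex) \<Rightarrow> bool" where
  "decays s f \<longleftrightarrow> (\<exists>C. dominated s C f)"

text \<open>A product bound, so that double sums against two tame sequences converge absolutely.\<close>

definition decays2 :: "real \<Rightarrow> real \<Rightarrow> (nat \<Rightarrow> nat \<Rightarrow> complex) \<Rightarrow> bool" where
  "decays2 s t f \<longleftrightarrow> (\<exists>C. \<forall>m n. norm (f m n) \<le> C * phi s m * phi t n)"

text \<open>The linear functionals that are absolutely convergent on all functions dominated by \<open>\<phi>\<^sub>s\<close>.\<close>

definition tame :: "real \<Rightarrow> (nat \<Rightarrow> complex) \<Rightarrow> bool" where
  "tame s g \<longleftrightarrow> (\<lambda>j. norm (g j) * phi s j) summable_on UNIV"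

lemma letter_kernel_le:
  assumes b: "Re b > 0" and l: "Re (b - l) > 0" and s: "s > 0"
  obtains c where "c > 0" "\<And>e m j. norm (letter_kernel b l e m j) \<le> (if m \<le> j then c / (real j + s + 1) else 0)"
proof -
  obtain c1 where c1: "c1 > 0" "\<And>j. norm (of_nat j + complex_of_real (s + 1)) \<le> c1 * (real j + Re b)"
    using norm_add_of_nat_le[of "complex_of_real (s + 1)" "Re b"] s b by auto
  obtain c2 where c2: "c2 > 0" "\<And>j. norm (of_nat j + b) \<le> c2 * (real j + Re (b - l))"
    using norm_add_of_nat_le[of b "Re (b - l)"] l b by auto
  have n: "norm (of_nat j + complex_of_real (s + 1)) = real j + s + 1" for j
    using s norm_of_real[of "real j + s + 1", where 'a = complex] by (simp add: add_ac)
  have inv: "norm (1 / (of_nat j + b)) \<le> c1 / (real j + s + 1)" for j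
  proof -
    have "real j + s + 1 \<le> c1 * norm (of_nat j + b)"
      using c1(2)[of j] norm_add_of_nat_ge[OF b, of j] c1(1) unfolding n
      by (meson mult_left_mono less_imp_le order_trans)
    moreover have "0 < real j + s + 1" using s by linarith
    moreover have "0 < norm (of_nat j + b)" using of_nat_add_neq_0[OF b] by simp
    ultimately show ?thesis by (simp add: norm_divide field_simps)
  qed
  have quo: "norm ((of_nat m + b) / (of_nat m + (b - l))) \<le> c2" for m
  proof -
    have "norm (of_nat m + b) \<le> c2 * norm (of_nat m + (b - l))"
      using c2(2)[of m] norm_add_of_nat_ge[OF l, of m] c2(1)
      by (meson mult_left_mono less_imp_le order_trans)
    moreover have "0 < norm (of_nat m + (b - l))" using of_nat_add_neq_0[OF l, of m] by simp
    ultimately show ?thesis by (simp add: norm_divide divide_le_eq)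
  qed
  define c where "c = (c2 + 1) * c1"
  have le: "c1 / (real j + s + 1) \<le> c / (real j + s + 1)" for j
    using c1(1) c2(1) s by (intro divide_right_mono) (auto simp: c_def)
  have le2: "norm ((of_nat m + b) / (of_nat m + (b - l)) * (1 / (of_nat j + b))) \<le> c / (real j + s + 1)" for m j
  proof -
    have "norm ((of_nat m + b) / (of_nat m + (b - l)) * (1 / (of_nat j + b))) \<le> (c2 + 1) * (c1 / (real j + s + 1))"
      unfolding norm_mult using quo[of m] inv[of j] c2(1) by (intro mult_mono) auto
    then show ?thesis by (simp add: c_def)
  qed
  have "norm (letter_kernel b l e m j) \<le> (if m \<le> j then c / (real j + s + 1) else 0)" for e m j
    using order_trans[OF inv le, of j] le2[of m j] c1(1) c2(1) s
    by (auto simp: letter_kernel_def c_def)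
  moreover have "c > 0" using c1(1) c2(1) by (simp add: c_def)
  ultimately show ?thesis using that by blast
qed

text \<open>All entries of the matrices are \<open>O(1 / (j + s + 1))\<close> with \<open>j \<ge> m\<close>, so that a function dominated by
  \<open>\<phi>\<^sub>s\<close> is summed to a multiple of the telescoping tail \<open>phi_tail_has_sum\<close>. The constant is uniform in the
  function, which yields bounds for functions of two variables as well.\<close>

lemma letter_op_abs_le:
  assumes b: "Re b > 0" and l: "Re (b - l) > 0" and s: "s > 0"
  shows "\<exists>K>0. \<forall>e f C m. dominated s C f \<longrightarrow>
    (\<lambda>j. norm (letter_kernel b l e m j * f j)) summable_on UNIV \<and>
    (\<Sum>\<^sub>\<infinity>j. norm (letter_kernel b l e m j * f j)) \<le> K * C * phi s m"
proof -
  obtain c where c: "c > 0"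
    "\<And>e m j. norm (letter_kernel b l e m j) \<le> (if m \<le> j then c / (real j + s + 1) else 0)"
    by (rule letter_kernel_le[OF assms]) (rule that)
  have main: "(\<lambda>j. norm (letter_kernel b l e m j * f j)) summable_on UNIV \<and>
    (\<Sum>\<^sub>\<infinity>j. norm (letter_kernel b l e m j * f j)) \<le> c / s * C * phi s m"
    if f: "dominated s C f" for e f C m
  proof -
    define g where "g = (\<lambda>j. c * C * (if m \<le> j then phi s j / (real j + s + 1) else 0))"
    have g: "(g has_sum c * C * (phi s m / s)) UNIV"
      unfolding g_def by (intro has_sum_cmult_right phi_tail_has_sum s)
    have le: "norm (letter_kernel b l e m j * f j) \<le> g j" for j
    proof -
      have "norm (f j) \<le> C * phi s j" using f by (simp add: dominated_def)
      then have "norm (letter_kernel b l e m j * f j) \<le> (if m \<le> j then c / (real j + s + 1) else 0) * (C * phi s j)"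
        unfolding norm_mult using c(1) s by (intro mult_mono c(2)) auto
      then show ?thesis by (auto simp: g_def split: if_splits)
    qed
    have su: "(\<lambda>j. norm (letter_kernel b l e m j * f j)) summable_on UNIV"
      by (rule Infinite_Sum.abs_summable_on_comparison_test'[OF has_sum_imp_summable[OF g]]) (rule le)
    have "(\<Sum>\<^sub>\<infinity>j. norm (letter_kernel b l e m j * f j)) \<le> infsum g UNIV"
      by (intro infsum_mono le su has_sum_imp_summable[OF g])
    also have "\<dots> = c / s * C * phi s m" using infsumI[OF g] by simp
    finally show ?thesis using su by blast
  qed
  show ?thesis using main c(1) s by (intro exI[of _ "c / s"]) auto
qed

lemma tame_letter_kernel:
  assumes "Re b > 0" and "Re (b - l) > 0" and "s > 0"
  shows "tame s (letter_kernel b l e m)"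
proof -
  have "dominated s 1 (\<lambda>j. of_real (phi s j))" using assms(3) by (simp add: dominated_def)
  then have "(\<lambda>j. norm (letter_kernel b l e m j * of_real (phi s j))) summable_on UNIV"
    using letter_op_abs_le[OF assms] by blast
  then show ?thesis using assms(3) by (simp add: tame_def norm_mult)
qed

lemma tame_abs_summable:
  assumes "tame s g" "decays s f"
  shows "(\<lambda>j. norm (g j * f j)) summable_on UNIV"
proof -
  obtain C where C: "\<And>m. norm (f m) \<le> C * phi s m" using assms(2) by (auto simp: decays_def dominated_def)
  have "(\<lambda>j. C * (norm (g j) * phi s j)) summable_on UNIV"
    using assms(1) by (intro summable_on_cmult_right) (simp add: tame_def)
  then show ?thesis
  proof (rule Infinite_Sum.abs_summable_on_comparison_test')
    fix j show "norm (g j * f j) \<le> C * (norm (g j) * phi s j)"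
      using mult_left_mono[OF C[of j] norm_ge_zero[of "g j"]] by (simp add: norm_mult mult_ac)
  qed
qed

lemma dominated_letter_op:
  assumes b: "Re b > 0" and l: "Re (b - l) > 0" and s: "s > 0"
  shows "\<exists>K>0. \<forall>e f C. dominated s C f \<longrightarrow> dominated s (K * C) (letter_op b l e f)"
proof -
  obtain K where K: "K > 0" "\<forall>e f C m. dominated s C f \<longrightarrow>
    (\<lambda>j. norm (letter_kernel b l e m j * f j)) summable_on UNIV \<and>
    (\<Sum>\<^sub>\<infinity>j. norm (letter_kernel b l e m j * f j)) \<le> K * C * phi s m"
    using letter_op_abs_le[OF assms] by blast
  have "dominated s (K * C) (letter_op b l e f)" if "dominated s C f" for e f C
  proof -
    have "norm (letter_op b l e f m) \<le> K * C * phi s m" for m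
      unfolding letter_op_def
      by (rule order_trans[OF norm_infsum_bound]) (use K(2) that in blast)+
    then show ?thesis by (simp add: dominated_def)
  qed
  then show ?thesis using K(1) by blast
qed

lemma dominated_word_op:
  assumes "Re b > 0" and "Re (b - l) > 0" and "s > 0"
  shows "\<exists>K>0. \<forall>f C. dominated s C f \<longrightarrow> dominated s (K * C) (word_op b l w f)"
proof (induction w)
  case Nil
  show ?case by (intro exI[of _ 1]) auto
next
  case (Cons e w)
  obtain K where K: "K > 0" "\<forall>e f C. dominated s C f \<longrightarrow> dominated s (K * C) (letter_op b l e f)"
    using dominated_letter_op[OF assms] by blast
  obtain K' where K': "K' > 0" "\<forall>f C. dominated s C f \<longrightarrow> dominated s (K' * C) (word_op b l w f)"
    using Cons by blast
  show ?case using K K' by (intro exI[of _ "K * K'"]) (simp add: mult.assoc)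
qed

lemma decays_word_op:
  assumes "Re b > 0" and "Re (b - l) > 0" and "s > 0" and "decays s f"
  shows "decays s (word_op b l w f)"
  using dominated_word_op[OF assms(1-3), of w] assms(4) unfolding decays_def by blast

lemma decays2_fst:
  assumes "decays2 s t f" shows "decays s (\<lambda>j. f j n)"
proof -
  obtain C where "\<And>m n. norm (f m n) \<le> C * phi s m * phi t n" using assms by (auto simp: decays2_def)
  then have "norm (f m n) \<le> (C * phi t n) * phi s m" for m by (simp add: mult_ac)
  then show ?thesis unfolding decays_def dominated_def by (intro exI allI)
qed

lemma decays2_flip:
  assumes "decays2 s t f" shows "decays2 t s (\<lambda>n m. f m n)"
proof -
  obtain C where "\<And>m n. norm (f m n) \<le> C * phi s m * phi t n" using assms by (auto simp: decays2_def)
  then have "norm (f m n) \<le> C * phi t n * phi s m" for m n by (simp add: mult_ac)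
  then show ?thesis unfolding decays2_def by (intro exI allI)
qed

lemma decays2_word_op_fst:
  assumes "Re b > 0" and "Re (b - l) > 0" and "s > 0" and f: "decays2 s t f"
  shows "decays2 s t (\<lambda>m n. word_op b l w (\<lambda>j. f j n) m)"
proof -
  obtain C where C: "\<And>m n. norm (f m n) \<le> C * phi s m * phi t n" using f by (auto simp: decays2_def)
  then have "dominated s (C * phi t n) (\<lambda>j. f j n)" for n by (simp add: dominated_def mult_ac)
  then obtain K where "\<And>n. dominated s (K * (C * phi t n)) (word_op b l w (\<lambda>j. f j n))"
    using dominated_word_op[OF assms(1-3), of w] by blast
  then have "norm (word_op b l w (\<lambda>j. f j n) m) \<le> (K * C) * phi s m * phi t n" for m n
    by (simp add: dominated_def mult_ac)
  then show ?thesis unfolding decays2_def by (intro exI allI)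
qed

lemma summable_on_times:
  fixes G :: "'a \<Rightarrow> real" and H :: "'b \<Rightarrow> real"
  assumes "G summable_on A" "H summable_on B" "\<And>x. 0 \<le> G x" "\<And>y. 0 \<le> H y"
  shows "(\<lambda>(x, y). G x * H y) summable_on A \<times> B"
proof (rule summable_on_SigmaI)
  fix x
  show "((\<lambda>y. case (x, y) of (x, y) \<Rightarrow> G x * H y) has_sum G x * infsum H B) B"
    using assms by (auto intro!: has_sum_cmult_right has_sum_infsum)
qed (use assms in \<open>auto intro: summable_on_cmult_left\<close>)

lemma infsum_swap_tame:
  assumes s: "s > 0" and t: "t > 0" and g: "tame s g" and h: "tame t h" and f: "decays2 s t f"
  shows "(\<Sum>\<^sub>\<infinity>j. g j * (\<Sum>\<^sub>\<infinity>n. h n * f j n)) = (\<Sum>\<^sub>\<infinity>n. h n * (\<Sum>\<^sub>\<infinity>j. g j * f j n))"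
proof -
  obtain C where C: "\<And>j n. norm (f j n) \<le> C * phi s j * phi t n" using f by (auto simp: decays2_def)
  define G where "G = (\<lambda>j. norm (g j) * phi s j)"
  define H where "H = (\<lambda>n. norm (h n) * phi t n)"
  have "(\<lambda>(j, n). C * (G j * H n)) summable_on UNIV \<times> UNIV"
  proof -
    have "G summable_on UNIV" "H summable_on UNIV" using g h by (simp_all add: tame_def G_def H_def)
    then have "(\<lambda>(j, n). G j * H n) summable_on UNIV \<times> UNIV"
      using s t by (intro summable_on_times) (simp_all add: G_def H_def)
    from summable_on_cmult_right[OF this, of C] show ?thesis by (simp only: case_prod_unfold)
  qed
  then have "(\<lambda>x. norm (case x of (j, n) \<Rightarrow> g j * (h n * f j n))) summable_on UNIV \<times> UNIV"
  proof (rule Infinite_Sum.abs_summable_on_comparison_test', safe)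
    fix j n
    have "norm (g j * (h n * f j n)) \<le> norm (g j) * (norm (h n) * (C * phi s j * phi t n))"
      unfolding norm_mult by (intro mult_left_mono C) auto
    then show "norm (g j * (h n * f j n)) \<le> C * (G j * H n)"
      by (simp only: G_def H_def mult_ac)
  qed
  then have "(\<lambda>(j, n). g j * (h n * f j n)) summable_on UNIV \<times> UNIV" by (rule abs_summable_summable)
  note swap = infsum_swap_banach[OF this]
  have "(\<Sum>\<^sub>\<infinity>j. g j * (\<Sum>\<^sub>\<infinity>n. h n * f j n)) = (\<Sum>\<^sub>\<infinity>n. \<Sum>\<^sub>\<infinity>j. g j * (h n * f j n))"
    using swap by (simp only: infsum_cmult_right')
  also have "\<dots> = (\<Sum>\<^sub>\<infinity>n. \<Sum>\<^sub>\<infinity>j. h n * (g j * f j n))"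
    by (intro infsum_cong mult.left_commute)
  finally show ?thesis by (simp only: infsum_cmult_right')
qed

text \<open>Operators in one variable commute with functionals in the other one; with rows of the matrices as
  functionals this covers the commutation of operators in different variables.\<close>

lemma word_op_infsum:
  assumes b: "Re b > 0" and l: "Re (b - l) > 0" and s: "s > 0" and t: "t > 0"
    and h: "tame t h" and f: "decays2 s t f"
  shows "word_op b l w (\<lambda>j. \<Sum>\<^sub>\<infinity>n. h n * f j n) m = (\<Sum>\<^sub>\<infinity>n. h n * word_op b l w (\<lambda>j. f j n) m)"
proof (induction w arbitrary: m)
  case (Cons e w)
  have "word_op b l (e # w) (\<lambda>j. \<Sum>\<^sub>\<infinity>n. h n * f j n) m
      = (\<Sum>\<^sub>\<infinity>j. letter_kernel b l e m j * (\<Sum>\<^sub>\<infinity>n. h n * word_op b l w (\<lambda>j. f j n) j))"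
    by (simp add: letter_op_def Cons)
  also have "\<dots> = (\<Sum>\<^sub>\<infinity>n. h n * (\<Sum>\<^sub>\<infinity>j. letter_kernel b l e m j * word_op b l w (\<lambda>j. f j n) j))"
    by (rule infsum_swap_tame[OF s t tame_letter_kernel[OF b l s] h decays2_word_op_fst[OF b l s f]])
  finally show ?case by (simp add: letter_op_def)
qed simp

lemma letter_op_word_op_commute:
  assumes b: "Re b > 0" and l: "Re (b - l) > 0" and a: "Re a > 0" and k: "Re (a - k) > 0"
    and s: "s > 0" and t: "t > 0" and f: "decays2 s t f"
  shows "letter_op b l e (\<lambda>j. word_op a k w (f j) n) m = word_op a k w (\<lambda>n. letter_op b l e (\<lambda>j. f j n) m) n"
  unfolding letter_op_def
  by (rule word_op_infsum[OF a k t s tame_letter_kernel[OF b l s] decays2_flip[OF f], symmetric])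

section \<open>The connector and the transport of letters\<close>

text \<open>The function of two variables on which a letter in \<open>m\<close> acts like the opposite letter in \<open>n\<close>. For
  \<open>l = 0\<close> it is a multiple of \<open>\<Gamma>(m + 1 + b) \<Gamma>(n + 1 + a) / \<Gamma>(m + n + 1 + a + b)\<close>.\<close>

definition connector :: "complex \<Rightarrow> complex \<Rightarrow> complex \<Rightarrow> nat \<Rightarrow> nat \<Rightarrow> complex" where
  "connector a b l m n = (of_nat m + b) * (of_nat n + a) * pochhammer (b - l) m * pochhammer (a - l) n
     / pochhammer (a + b + 1 - l) (m + n)"

text \<open>The initial factor \<open>(a)\<^sub>m / m!\<close>, together with the denominator that the first letter \<open>x\<^sub>1\<close> of a word
  contributes.\<close>

definition weight :: "complex \<Rightarrow> complex \<Rightarrow> nat \<Rightarrow> complex" where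
  "weight a b m = pochhammer a m / (fact m * (of_nat m + b))"

lemma connector_commute: "connector a b l m n = connector b a l n m"
  by (simp add: connector_def add_ac mult_ac)

lemma has_sum_single: "((\<lambda>j. if j = m then f j else 0) has_sum f m) (UNIV :: nat set)"
  by (rule has_sum_finite_neutralI[of "{m}"]) auto

locale connector_params =
  fixes a b l :: complex
  assumes a: "Re a > 0" and b: "Re b > 0" and al: "Re (a - l) > 0" and bl: "Re (b - l) > 0"
begin

lemma flip: "connector_params b a l"
  by unfold_locales (use a b al bl in auto)

lemma Re_sum_pos: "Re (a + b - l) > 0"
  using a bl by simp

text \<open>For real parameters, the connector is \<open>\<phi>\<^bsub>a\<^esub>(m) \<phi>\<^bsub>b\<^esub>(n)\<close> times a multiple of the quotient that is bounded in
  \<open>pochhammer_quotient_le\<close>.\<close>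

lemma decays2_connector: "decays2 (Re a) (Re b) (connector a b l)"
proof -
  define x where "x = Re a"
  define y where "y = Re (b - l)"
  define x' where "x' = Re b"
  define y' where "y' = Re (a - l)"
  have pos: "x > 0" "y > 0" "x' > 0" "y' > 0" and S: "x + y = x' + y'"
    using a b al bl by (auto simp: x_def y_def x'_def y'_def)
  obtain c1 where c1: "c1 > 0" "\<And>m. norm (of_nat m + b) \<le> c1 * (real m + y)"
    using norm_add_of_nat_le[of b y] b pos by blast
  obtain c2 where c2: "c2 > 0" "\<And>m. norm (of_nat m + a) \<le> c2 * (real m + y')"
    using norm_add_of_nat_le[of a y'] a pos by blast
  obtain A1 where A1: "A1 > 0" "\<And>m. norm (pochhammer (b - l) m) \<le> A1 * pochhammer y m"
    using norm_pochhammer_le[OF bl] unfolding y_def by blast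
  obtain A2 where A2: "A2 > 0" "\<And>m. norm (pochhammer (a - l) m) \<le> A2 * pochhammer y' m"
    using norm_pochhammer_le[OF al] unfolding y'_def by blast
  obtain B where B: "B > 0"
    "\<And>m n. pochhammer (x + 1) m * pochhammer (y + 1) m * (pochhammer (x' + 1) n * pochhammer (y' + 1) n)
        \<le> B * (fact m * fact n * pochhammer (x + y + 1) (m + n))"
    using pochhammer_quotient_le[OF pos S] by blast
  have p: "0 < pochhammer (x + y + 1) n" "0 < pochhammer (x + 1) n" "0 < pochhammer (y + 1) n"
     "0 < pochhammer (x' + 1) n"  "0 < pochhammer (y' + 1) n" "0 < pochhammer y n" "0 < pochhammer y' n" for n
    using pos by (auto intro!: pochhammer_pos)
  have shift: "(real m + z) * pochhammer z m = z * pochhammer (z + 1) m" for m and z :: real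
    by (metis pochhammer_rec pochhammer_rec' add.commute)
  define C where "C = c1 * A1 * y * (c2 * A2 * y') * B"
  have "norm (connector a b l m n) \<le> C * phi (Re a) m * phi (Re b) n" for m n
  proof -
    have 1: "norm ((of_nat m + b) * pochhammer (b - l) m) \<le> c1 * A1 * y * pochhammer (y + 1) m"
    proof -
      have "norm ((of_nat m + b) * pochhammer (b - l) m) \<le> c1 * (real m + y) * (A1 * pochhammer y m)"
        unfolding norm_mult using pos c1(1) by (intro mult_mono c1 A1) auto
      also have "\<dots> = c1 * A1 * ((real m + y) * pochhammer y m)" by (simp only: mult_ac)
      finally show ?thesis unfolding shift by (simp only: mult.assoc)
    qed
    have 2: "norm ((of_nat n + a) * pochhammer (a - l) n) \<le> c2 * A2 * y' * pochhammer (y' + 1) n"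
    proof -
      have "norm ((of_nat n + a) * pochhammer (a - l) n) \<le> c2 * (real n + y') * (A2 * pochhammer y' n)"
        unfolding norm_mult using pos c2(1) by (intro mult_mono c2 A2) auto
      also have "\<dots> = c2 * A2 * ((real n + y') * pochhammer y' n)" by (simp only: mult_ac)
      finally show ?thesis unfolding shift by (simp only: mult.assoc)
    qed
    have 3: "pochhammer (x + y + 1) (m + n) \<le> norm (pochhammer (a + b + 1 - l) (m + n))"
      using pochhammer_le_norm[of "a + b + 1 - l" "m + n"] pos by (simp add: x_def y_def algebra_simps)
    have "norm (connector a b l m n) = norm ((of_nat m + b) * pochhammer (b - l) m)
        * norm ((of_nat n + a) * pochhammer (a - l) n) / norm (pochhammer (a + b + 1 - l) (m + n))"
      by (simp add: connector_def norm_mult norm_divide mult_ac)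
    also have "\<dots> \<le> (c1 * A1 * y * pochhammer (y + 1) m) * (c2 * A2 * y' * pochhammer (y' + 1) n)
        / pochhammer (x + y + 1) (m + n)"
      by (rule frac_le[OF _ mult_mono[OF 1 2] p(1) 3])
        (use c1(1) A1(1) c2(1) A2(1) pos p(3)[of m] p(5)[of n] in auto)
    also have "\<dots> = (c1 * A1 * y * (c2 * A2 * y')) * (pochhammer (y + 1) m * pochhammer (y' + 1) n
        / pochhammer (x + y + 1) (m + n))"
      by (simp add: mult_ac)
    also have "pochhammer (y + 1) m * pochhammer (y' + 1) n / pochhammer (x + y + 1) (m + n)
        \<le> B * phi x m * phi x' n"
    proof -
      have "pochhammer (y + 1) m * pochhammer (y' + 1) n * (pochhammer (x + 1) m * pochhammer (x' + 1) n)
        \<le> B * (fact m * fact n) * pochhammer (x + y + 1) (m + n)"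
        using B(2)[of m n] by (simp only: mult_ac)
      then show ?thesis using p(1)[of "m + n"] p(2)[of m] p(4)[of n]
        by (simp add: phi_def field_simps)
    qed
    finally show ?thesis
      using c1(1) A1(1) c2(1) A2(1) pos by (simp add: C_def x_def x'_def mult_ac)
  qed
  then show ?thesis unfolding decays2_def by (intro exI allI)
qed

lemma connector_Suc:
  "connector a b l (Suc m) n * (of_nat m + of_nat n + 1 + (a + b - l)) / (of_nat (Suc m) + b)
     = (of_nat m + (b - l)) / (of_nat m + b) * connector a b l m n"
proof -
  have nz: "of_nat m + of_nat n + 1 + (a + b - l) \<noteq> 0"
    using of_nat_add_neq_0[OF Re_sum_pos, of "Suc (m + n)"] by (simp add: add_ac)
  have nz': "of_nat m + b \<noteq> 0" "of_nat (Suc m) + b \<noteq> 0"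
    using of_nat_add_neq_0[OF b] by blast+
  have "pochhammer (a + b + 1 - l) (Suc m + n) = pochhammer (a + b + 1 - l) (m + n) * (of_nat m + of_nat n + 1 + (a + b - l))"
    by (simp add: pochhammer_Suc algebra_simps)
  then show ?thesis using nz nz'
    by (simp add: connector_def pochhammer_Suc[of "b - l"] del: of_nat_Suc add_Suc)
qed

text \<open>The recurrence \<open>connector_Suc\<close> makes the tail sums telescope; the connector is the solution of the
  recurrence that this requires.\<close>

lemma connector_tail_has_sum:
  "((\<lambda>j. if m < j then connector a b l j n / (of_nat j + b) else 0) has_sum
     (of_nat m + (b - l)) / ((of_nat m + b) * (of_nat n + a)) * connector a b l m n) UNIV"
proof -
  \<comment> \<open>For \<open>j > m\<close> the summand is \<open>Q (j - 1) - Q j\<close>. Clamping the argument at \<open>m\<close> makes the differences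
    \<open>G j - G (j + 1)\<close> vanish for \<open>j \<le> m\<close>.\<close>
  define Q where "Q j = (of_nat j + (b - l)) / (of_nat j + b) * connector a b l j n / (of_nat n + a)" for j
  define G where "G j = Q (max m (j - 1))" for j
  have na: "of_nat n + a \<noteq> 0" by (rule of_nat_add_neq_0[OF a])
  have nb: "of_nat j + b \<noteq> 0" for j by (rule of_nat_add_neq_0[OF b])
  have dec: "decays (Re a) (\<lambda>j. connector a b l j n)" by (rule decays2_fst[OF decays2_connector])
  obtain C where C: "\<And>j. norm (connector a b l j n) \<le> C * phi (Re a) j"
    using dec by (auto simp: decays_def dominated_def)
  have "(\<lambda>j. C * phi (Re a) j) \<longlonglongrightarrow> C * 0" by (intro tendsto_mult tendsto_const phi_tendsto_0 a)
  then have "(\<lambda>j. connector a b l j n) \<longlonglongrightarrow> 0"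
    using Lim_null_comparison[of "\<lambda>j. connector a b l j n" "\<lambda>j. C * phi (Re a) j" sequentially] C by simp
  moreover have "(\<lambda>j. (of_nat j + (b - l)) / (of_nat j + b)) \<longlonglongrightarrow> 1"
  proof -
    have "filterlim (\<lambda>j. of_nat j + b) at_infinity sequentially"
      by (rule tendsto_add_filterlim_at_infinity'[OF tendsto_of_nat tendsto_const])
    then have "(\<lambda>j. l / (of_nat j + b)) \<longlonglongrightarrow> 0" by (rule tendsto_divide_0[OF tendsto_const])
    then have "(\<lambda>j. 1 - l / (of_nat j + b)) \<longlonglongrightarrow> 1 - 0" by (intro tendsto_diff tendsto_const)
    moreover have "(\<lambda>j. 1 - l / (of_nat j + b)) = (\<lambda>j. (of_nat j + (b - l)) / (of_nat j + b))"
      using nb by (simp add: fun_eq_iff field_simps)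
    ultimately show ?thesis by simp
  qed
  ultimately have "Q \<longlonglongrightarrow> 1 * 0 / (of_nat n + a)"
    unfolding Q_def by (intro tendsto_divide tendsto_mult tendsto_const na)
  then have "(\<lambda>j. Q (j + m)) \<longlonglongrightarrow> 0" using LIMSEQ_ignore_initial_segment by simp
  then have "(\<lambda>j. G (j + (m + 1))) \<longlonglongrightarrow> 0" by (simp add: G_def max_def)
  then have "G \<longlonglongrightarrow> 0" by (rule LIMSEQ_offset)
  then have "(\<lambda>j. G j - G (Suc j)) sums G 0" by (rule telescope_sums_to_0)
  moreover have "G j - G (Suc j) = (if m < j then connector a b l j n / (of_nat j + b) else 0)" for j
  proof (cases "m < j")
    case True
    then obtain k where k: "j = Suc k" "m \<le> k" by (cases j) auto
    have "Q k = connector a b l (Suc k) n * (of_nat k + of_nat n + 1 + (a + b - l)) / (of_nat (Suc k) + b) / (of_nat n + a)"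
      unfolding Q_def connector_Suc by simp
    also have "\<dots> - Q (Suc k) = connector a b l (Suc k) n / (of_nat (Suc k) + b)"
      using na nb[of "Suc k"] by (simp add: Q_def divide_simps) algebra
    finally show ?thesis using True k by (simp add: G_def max_def)
  next
    case False
    then have "max m (j - 1) = m" "max m j = m" by auto
    then show ?thesis using False by (simp add: G_def)
  qed
  moreover have "G 0 = (of_nat m + (b - l)) / ((of_nat m + b) * (of_nat n + a)) * connector a b l m n"
    by (simp add: G_def Q_def)
  ultimately have sums: "(\<lambda>j. if m < j then connector a b l j n / (of_nat j + b) else 0) sums
     ((of_nat m + (b - l)) / ((of_nat m + b) * (of_nat n + a)) * connector a b l m n)" by simp
  have "(\<lambda>j. norm (letter_kernel b 0 1 m j * connector a b l j n)) summable_on UNIV"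
    using b a by (intro tame_abs_summable[OF tame_letter_kernel dec]) auto
  moreover have "letter_kernel b 0 1 m j * connector a b l j n = (if m < j then connector a b l j n / (of_nat j + b) else 0)" for j
    using nb[of m] by (simp add: letter_kernel_def)
  ultimately have "summable (\<lambda>j. norm (if m < j then connector a b l j n / (of_nat j + b) else 0))"
    by (intro summable_on_imp_summable) simp
  then show ?thesis using sums by (rule norm_summable_imp_has_sum)
qed

text \<open>The three values are exchanged in pairs, or preserved, under \<open>(e, m, b) \<leftrightarrow> (-e, n, a)\<close>.\<close>

lemma letter_op_connector:
  assumes "e \<in> {-1, 0, 1}"
  shows "letter_op b l e (\<lambda>j. connector a b l j n) m =
    (if e = -1 then connector a b l m n / (of_nat m + b)
     else if e = 1 then connector a b l m n / (of_nat n + a)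
     else connector a b l m n * (of_nat m + of_nat n + a + b - l) / ((of_nat m + b) * (of_nat n + a)))"
proof -
  have na: "of_nat n + a \<noteq> 0" by (rule of_nat_add_neq_0[OF a])
  have nb: "of_nat j + b \<noteq> 0" for j by (rule of_nat_add_neq_0[OF b])
  have nbl: "of_nat j + (b - l) \<noteq> 0" for j by (rule of_nat_add_neq_0[OF bl])
  note tail = connector_tail_has_sum[of m n]
  consider "e = -1" | "e = 0" | "e = 1" using assms by blast
  then show ?thesis
  proof cases
    case 1
    have "letter_kernel b l e m j * connector a b l j n = (if j = m then connector a b l j n / (of_nat j + b) else 0)" for j
      by (simp add: letter_kernel_def 1)
    then show ?thesis
      using infsumI[OF has_sum_single[of m "\<lambda>j. connector a b l j n / (of_nat j + b)"]] by (simp add: letter_op_def 1)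
  next
    case 2
    have "letter_kernel b l e m j * connector a b l j n = (if j = m then connector a b l j n / (of_nat j + b) else 0)
        + (if m < j then connector a b l j n / (of_nat j + b) else 0)" for j
      by (auto simp: letter_kernel_def 2)
    then have "letter_op b l e (\<lambda>j. connector a b l j n) m = connector a b l m n / (of_nat m + b) +
      (of_nat m + (b - l)) / ((of_nat m + b) * (of_nat n + a)) * connector a b l m n"
      using infsumI[OF has_sum_add[OF has_sum_single[of m "\<lambda>j. connector a b l j n / (of_nat j + b)"] tail]]
      by (simp only: letter_op_def)
    also have "\<dots> = connector a b l m n * (of_nat m + of_nat n + a + b - l) / ((of_nat m + b) * (of_nat n + a))"
      using na nb[of m] by (simp add: divide_simps) algebra
    finally show ?thesis by (simp add: 2)
  next
    case 3
    have "letter_kernel b l e m j * connector a b l j n = (of_nat m + b) / (of_nat m + (b - l)) *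
        (if m < j then connector a b l j n / (of_nat j + b) else 0)" for j
      by (auto simp: letter_kernel_def 3)
    then have "letter_op b l e (\<lambda>j. connector a b l j n) m = (of_nat m + b) / (of_nat m + (b - l)) *
      ((of_nat m + (b - l)) / ((of_nat m + b) * (of_nat n + a)) * connector a b l m n)"
      using infsumI[OF has_sum_cmult_right[OF tail, of "(of_nat m + b) / (of_nat m + (b - l))"]]
      by (simp only: letter_op_def)
    also have "\<dots> = connector a b l m n / (of_nat n + a)"
      using nbl[of m] nb[of m] by simp
    finally show ?thesis by (simp add: 3)
  qed
qed

lemma transport:
  assumes e: "e \<in> {-1, 0, 1}"
  shows "letter_op b l e (\<lambda>j. connector a b l j n) m = letter_op a l (-e) (connector a b l m) n"
proof -
  interpret flip: connector_params b a l by (rule flip)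
  have "connector a b l m = (\<lambda>j. connector b a l j m)"
    by (rule ext) (rule connector_commute)
  then have "letter_op a l (-e) (connector a b l m) n = letter_op a l (-e) (\<lambda>j. connector b a l j m) n"
    by (rule arg_cong)
  also have "\<dots> = letter_op b l e (\<lambda>j. connector a b l j n) m"
  proof -
    have "-e \<in> {-1, 0, 1}" using e by auto
    note this_op = flip.letter_op_connector[OF this, of m n] letter_op_connector[OF e, of n m]
    consider "e = -1" | "e = 0" | "e = 1" using e by blast
    then show ?thesis unfolding this_op connector_commute[of b a l n m] by cases (simp_all add: add_ac mult_ac)
  qed
  finally show ?thesis by simp
qed

text \<open>The first letter of \<open>w\<close> is the last operator to act on \<open>m\<close>. It passes the letters already carried over to
  \<open>n\<close>, and becomes the innermost operator there: hence the reversal.\<close>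

lemma transport_word:
  assumes "set w \<subseteq> {-1, 0, 1}"
  shows "word_op b l w (\<lambda>j. connector a b l j n) m = word_op a l (map uminus (rev w)) (connector a b l m) n"
  using assms
proof (induction w arbitrary: m n)
  case (Cons e w)
  have "word_op b l (e # w) (\<lambda>j. connector a b l j n) m
      = letter_op b l e (\<lambda>j. word_op a l (map uminus (rev w)) (connector a b l j) n) m"
  proof -
    have "word_op b l w (\<lambda>j. connector a b l j n) = (\<lambda>j. word_op a l (map uminus (rev w)) (connector a b l j) n)"
      using Cons by (intro ext) simp
    then show ?thesis by simp
  qed
  also have "\<dots> = word_op a l (map uminus (rev w)) (\<lambda>n. letter_op b l e (\<lambda>j. connector a b l j n) m) n"
    by (rule letter_op_word_op_commute[OF b bl a al a b decays2_connector])
  also have "(\<lambda>n. letter_op b l e (\<lambda>j. connector a b l j n) m) = letter_op a l (-e) (connector a b l m)"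
    using Cons.prems by (intro ext transport) simp
  finally show ?case by simp
qed simp

text \<open>\<open>(a)\<^sub>m / m!\<close> and \<open>\<phi>\<^sub>a(m)\<close> compensate each other, leaving \<open>O(m\<^bsup>-2\<^esup>)\<close>.\<close>

lemma tame_weight: "tame (Re a) (weight a b)"
proof -
  obtain A where A: "A > 0" "\<And>n. norm (pochhammer a n) \<le> A * pochhammer (Re a) n"
    using norm_pochhammer_le[OF a] by blast
  define d where "d = min 1 (min (Re a) (Re b))"
  have d: "0 < d" "d \<le> 1" "d \<le> Re a" "d \<le> Re b" using a b by (auto simp: d_def)
  have low: "d * (real m + 1) \<le> real m + x" if "d \<le> x" for m x
    using mult_right_mono[OF d(2), of "real m"] that by (simp add: distrib_left)
  have "norm (weight a b m) * phi (Re a) m \<le> (A * Re a / d ^ 2) / (real m + 1) ^ 2" for m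
  proof -
    have "norm (weight a b m) * phi (Re a) m
        = norm (pochhammer a m) / (norm (of_nat m + b) * pochhammer (Re a + 1) m)"
      by (simp add: weight_def phi_def norm_divide norm_mult)
    also have "\<dots> \<le> A * pochhammer (Re a) m / (d * (real m + 1) * pochhammer (Re a + 1) m)"
    proof (rule frac_le)
      show "d * (real m + 1) * pochhammer (Re a + 1) m \<le> norm (of_nat m + b) * pochhammer (Re a + 1) m"
        using order_trans[OF low[OF d(4)] norm_add_of_nat_ge[OF b]] a
        by (intro mult_right_mono) (auto intro!: pochhammer_nonneg)
    qed (use A a d in \<open>auto intro!: mult_pos_pos pochhammer_pos pochhammer_nonneg mult_nonneg_nonneg\<close>)
    also have "pochhammer (Re a) m = Re a * pochhammer (Re a + 1) m / (real m + Re a)"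
      using pochhammer_rec[of "Re a" m] pochhammer_rec'[of "Re a" m] a by (simp add: field_simps)
    also have "A * (Re a * pochhammer (Re a + 1) m / (real m + Re a)) / (d * (real m + 1) * pochhammer (Re a + 1) m)
        = A * Re a / (d * (real m + 1) * (real m + Re a))"
    proof -
      have "pochhammer (Re a + 1) m \<noteq> 0" using pochhammer_pos[of "Re a + 1" m] a by simp
      then show ?thesis by (simp add: mult_ac)
    qed
    also have "\<dots> \<le> A * Re a / (d * (real m + 1) * (d * (real m + 1)))"
      using A a d low[OF d(3)] by (intro divide_left_mono mult_left_mono mult_pos_pos) (auto simp: add_nonneg_pos)
    also have "\<dots> = (A * Re a / d ^ 2) / (real m + 1) ^ 2" by (simp add: power2_eq_square mult_ac)
    finally show ?thesis .
  qed
  then show ?thesis unfolding tame_def using a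
    by (intro summable_on_comparison_test[OF summable_inverse_square[of "A * Re a / d ^ 2"]]) auto
qed

text \<open>What remains of the connected sum at an end where no letter acts on \<open>n\<close>.\<close>

definition endpoint :: "nat \<Rightarrow> complex" where
  "endpoint m = (\<Sum>\<^sub>\<infinity>n. weight b a n * connector a b l m n)"

end

text \<open>Both sides equal the double sum of \<open>weight a b m * weight b a n\<close> times the connector, with the word
  acting on \<open>m\<close> or, equivalently by \<open>transport_word\<close>, its dual acting on \<open>n\<close>.\<close>

lemma (in connector_params) connected_sum_duality:
  assumes w: "set w \<subseteq> {-1, 0, 1}"
  shows "(\<Sum>\<^sub>\<infinity>m. weight a b m * word_op b l w (endpoint) m)
       = (\<Sum>\<^sub>\<infinity>n. weight b a n * word_op a l (map uminus (rev w)) (connector_params.endpoint b a l) n)"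
proof -
  interpret flip: connector_params b a l by (rule flip)
  let ?w' = "map uminus (rev w)"
  have "word_op b l w endpoint m = (\<Sum>\<^sub>\<infinity>n. weight b a n * word_op b l w (\<lambda>j. connector a b l j n) m)" for m
    using word_op_infsum[OF b bl a b flip.tame_weight decays2_connector, of w m]
    by (simp add: endpoint_def[abs_def])
  moreover have "word_op a l ?w' flip.endpoint n = (\<Sum>\<^sub>\<infinity>m. weight a b m * word_op b l w (\<lambda>j. connector a b l j n) m)" for n
    using word_op_infsum[OF a al b a tame_weight decays2_flip[OF decays2_connector], of ?w' n]
    by (simp add: flip.endpoint_def[abs_def] connector_commute[of b a] transport_word[OF w])
  ultimately show ?thesis
    using infsum_swap_tame[OF a b tame_weight flip.tame_weight decays2_word_op_fst[OF b bl a decays2_connector, of w]]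
    by simp
qed

section \<open>Summation at the ends and duality\<close>

text \<open>The terms of the hypergeometric series \<open>F(a, b; a + b + 1 + m; 1)\<close>, divided by \<open>(a + b + 1)\<^sub>m\<close>.\<close>

definition gauss_term :: "complex \<Rightarrow> complex \<Rightarrow> nat \<Rightarrow> nat \<Rightarrow> complex" where
  "gauss_term a b m n = pochhammer a n * pochhammer b n / (fact n * pochhammer (a + b + 1) (m + n))"

lemma gauss_term_commute: "gauss_term a b = gauss_term b a"
  by (simp add: gauss_term_def fun_eq_iff add_ac mult_ac)

lemma gauss_term_Suc:
  "gauss_term a b (Suc m) n = gauss_term a b m n / (of_nat m + of_nat n + (a + b + 1))"
  by (simp add: gauss_term_def pochhammer_Suc add_ac mult_ac)

lemma norm_gauss_term_le:
  assumes a: "Re a > 0" and b: "Re b > 0"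
  shows "\<exists>c. \<forall>m n. norm (gauss_term a b m n) \<le> c / (real n + 1) ^ 2"
proof -
  define x where "x = Re a"
  define y where "y = Re b"
  have x: "x > 0" and y: "y > 0" using a b by (simp_all add: x_def y_def)
  obtain A1 where A1: "A1 > 0" "\<And>n. norm (pochhammer a n) \<le> A1 * pochhammer x n"
    using norm_pochhammer_le[OF a] unfolding x_def by blast
  obtain A2 where A2: "A2 > 0" "\<And>n. norm (pochhammer b n) \<le> A2 * pochhammer y n"
    using norm_pochhammer_le[OF b] unfolding y_def by blast
  obtain B where B: "B > 0"
    "\<And>n. pochhammer (x + 1) n * pochhammer (y + 1) n \<le> B * (fact n * pochhammer (x + y + 1) n)"
    using pochhammer_product_le[OF x y] by blast
  define d where "d = min 1 (min x y)"
  have d: "0 < d" "d \<le> 1" "d \<le> x" "d \<le> y" using x y by (auto simp: d_def)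
  have low: "d * (real m + 1) \<le> real m + x" if "d \<le> x" for m x
    using mult_right_mono[OF d(2), of "real m"] that by (simp add: distrib_left)
  have shift: "pochhammer z n = z * pochhammer (z + 1) n / (real n + z)" if "z > 0" for z n
    using pochhammer_rec[of z n] pochhammer_rec'[of z n] that by (simp add: field_simps)
  have S: "Re (a + b + 1) = x + y + 1" by (simp add: x_def y_def)
  have "norm (gauss_term a b m n) \<le> (A1 * A2 * x * y * B / d ^ 2) / (real n + 1) ^ 2" for m n
  proof -
    have px: "pochhammer (x + 1) n > 0" "pochhammer (y + 1) n > 0" "pochhammer (x + y + 1) n > 0"
      using x y by (auto intro!: pochhammer_pos)
    have "pochhammer (x + y + 1) n * 1 \<le> pochhammer (x + y + 1) n * pochhammer (x + y + 1 + real n) m"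
    proof (intro mult_left_mono)
      have "1 \<le> pochhammer z m" if "z \<ge> 1" for z :: real
      proof (induction m)
        case (Suc m)
        then show ?case using that mult_mono[of 1 "pochhammer z m" 1 "z + real m"]
          by (simp add: pochhammer_Suc)
      qed simp
      then show "1 \<le> pochhammer (x + y + 1 + real n) m" using x y by simp
    qed (use px in simp)
    also have "\<dots> = pochhammer (x + y + 1) (m + n)"
      by (simp add: pochhammer_product'[of _ n m] add.commute[of m n])
    also have "\<dots> \<le> norm (pochhammer (a + b + 1) (m + n))"
      using pochhammer_le_norm[of "a + b + 1" "m + n"] x y unfolding S by simp
    finally have den: "pochhammer (x + y + 1) n \<le> norm (pochhammer (a + b + 1) (m + n))" by simp
    have "norm (gauss_term a b m n) = norm (pochhammer a n) * norm (pochhammer b n)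
        / (fact n * norm (pochhammer (a + b + 1) (m + n)))"
      by (simp add: gauss_term_def norm_mult norm_divide)
    also have "\<dots> \<le> (A1 * pochhammer x n) * (A2 * pochhammer y n) / (fact n * pochhammer (x + y + 1) n)"
    proof (rule frac_le)
      show "norm (pochhammer a n) * norm (pochhammer b n) \<le> (A1 * pochhammer x n) * (A2 * pochhammer y n)"
        using order_trans[OF norm_ge_zero A1(2)] by (intro mult_mono A1 A2) auto
      then show "0 \<le> (A1 * pochhammer x n) * (A2 * pochhammer y n)"
        by (rule order_trans[rotated]) simp
    qed (use den px in auto)
    also have "\<dots> = A1 * A2 * x * y / ((real n + x) * (real n + y)) *
        (pochhammer (x + 1) n * pochhammer (y + 1) n / (fact n * pochhammer (x + y + 1) n))"
      unfolding shift[OF x, of n] shift[OF y, of n] by (simp add: mult_ac)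
    also have "\<dots> \<le> A1 * A2 * x * y / ((d * (real n + 1)) * (d * (real n + 1))) * B"
    proof (intro mult_mono)
      show "pochhammer (x + 1) n * pochhammer (y + 1) n / (fact n * pochhammer (x + y + 1) n) \<le> B"
        using B(2)[of n] px by (simp add: divide_le_eq)
      show "A1 * A2 * x * y / ((real n + x) * (real n + y)) \<le> A1 * A2 * x * y / ((d * (real n + 1)) * (d * (real n + 1)))"
        using x y d A1 A2 low[OF d(3), of n] low[OF d(4), of n]
        by (intro divide_left_mono mult_mono mult_pos_pos) (auto simp: add_nonneg_pos)
    qed (use A1 A2 x y px in auto)
    also have "\<dots> = (A1 * A2 * x * y * B / d ^ 2) / (real n + 1) ^ 2" by (simp add: power2_eq_square mult_ac)
    finally show ?thesis .
  qed
  then show ?thesis by blast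
qed

definition gauss_sum :: "complex \<Rightarrow> complex \<Rightarrow> nat \<Rightarrow> complex" where
  "gauss_sum a b m = (\<Sum>\<^sub>\<infinity>n. gauss_term a b m n)"

lemma gauss_sum_commute: "gauss_sum a b = gauss_sum b a"
  by (simp add: gauss_sum_def gauss_term_commute[of a] fun_eq_iff)

lemma gauss_term_abs_summable:
  assumes "Re a > 0" and "Re b > 0"
  shows "(\<lambda>n. norm (gauss_term a b m n)) summable_on UNIV"
proof -
  obtain c where "\<And>m n. norm (gauss_term a b m n) \<le> c / (real n + 1) ^ 2"
    using norm_gauss_term_le[OF assms] by blast
  then show ?thesis
    by (intro Infinite_Sum.abs_summable_on_comparison_test'[OF summable_inverse_square[of c]])
qed

text \<open>A Wilf-Zeilberger proof: the difference of the terms of both sides telescopes, with the certificate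
  \<open>n * gauss_term a b m n\<close>.\<close>

lemma gauss_sum_Suc:
  assumes a: "Re a > 0" and b: "Re b > 0"
  shows "(of_nat m + (a + 1)) * (of_nat m + (b + 1)) * gauss_sum a b (Suc m) = of_nat (Suc m) * gauss_sum a b m"
proof -
  \<comment> \<open>The certificate: \<open>f (n + 1) - f n\<close> is the difference of the terms of both sides, and \<open>f\<close> vanishes at \<open>0\<close>
    and at infinity.\<close>
  define f where "f n = of_nat n * gauss_term a b m n" for n
  have sums: "gauss_term a b m sums gauss_sum a b m" for m
    unfolding gauss_sum_def
    by (rule has_sum_imp_sums[OF has_sum_infsum[OF abs_summable_summable[OF gauss_term_abs_summable[OF a b]]]])
  obtain c where c: "\<And>m n. norm (gauss_term a b m n) \<le> c / (real n + 1) ^ 2"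
    using norm_gauss_term_le[OF a b] by blast
  have c0: "0 \<le> c" using order_trans[OF norm_ge_zero c[of 0 0]] by simp
  have "f \<longlonglongrightarrow> 0"
  proof (rule Lim_null_comparison)
    show "\<forall>\<^sub>F n in sequentially. norm (f n) \<le> c / (real (Suc n))"
    proof (intro always_eventually allI)
      fix n
      have "norm (f n) \<le> (real n + 1) * (c / (real n + 1) ^ 2)"
        unfolding f_def norm_mult norm_of_nat using c[of m n] by (intro mult_mono) auto
      also have "\<dots> = c / real (Suc n)" by (simp add: power2_eq_square add.commute)
      finally show "norm (f n) \<le> c / real (Suc n)" .
    qed
    show "(\<lambda>n. c / real (Suc n)) \<longlonglongrightarrow> 0"
      by (rule LIMSEQ_Suc[OF lim_const_over_n])
  qed
  then have "(\<lambda>n. f (Suc n) - f n) sums (0 - f 0)" by (rule telescope_sums)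
  moreover have "f (Suc n) - f n = (of_nat m + (a + 1)) * (of_nat m + (b + 1)) * gauss_term a b (Suc m) n
      - of_nat (Suc m) * gauss_term a b m n" for n
  proof -
    define D where "D = of_nat m + of_nat n + (a + b + 1)"
    have D: "D \<noteq> 0" using of_nat_add_neq_0[of "a + b + 1" "m + n"] a b by (simp add: D_def)
    have n1: "of_nat n + 1 \<noteq> (0 :: complex)" using of_nat_add_neq_0[of 1 n] by simp
    have "gauss_term a b m (Suc n) = gauss_term a b m n * ((a + of_nat n) * (b + of_nat n)) / ((of_nat n + 1) * D)"
      by (simp add: gauss_term_def pochhammer_Suc D_def add_ac mult_ac)
    then have 1: "f (Suc n) = gauss_term a b m n * ((a + of_nat n) * (b + of_nat n)) / D"
      using n1 by (simp add: f_def add.commute)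
    have 2: "gauss_term a b (Suc m) n = gauss_term a b m n / D" by (simp add: gauss_term_Suc D_def)
    have "f n = of_nat n * gauss_term a b m n / D * D" using D by (simp add: f_def)
    moreover have "of_nat (Suc m) * gauss_term a b m n = of_nat (Suc m) * gauss_term a b m n / D * D" using D by simp
    ultimately show ?thesis unfolding 1 2 by (simp add: D_def divide_inverse) algebra
  qed
  moreover have "(\<lambda>n. (of_nat m + (a + 1)) * (of_nat m + (b + 1)) * gauss_term a b (Suc m) n
      - of_nat (Suc m) * gauss_term a b m n) sums
      ((of_nat m + (a + 1)) * (of_nat m + (b + 1)) * gauss_sum a b (Suc m) - of_nat (Suc m) * gauss_sum a b m)"
    by (intro sums_diff sums_mult sums)
  ultimately have "(of_nat m + (a + 1)) * (of_nat m + (b + 1)) * gauss_sum a b (Suc m) - of_nat (Suc m) * gauss_sum a b m = 0 - f 0"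
    by (simp add: sums_iff)
  then show ?thesis by (simp add: f_def)
qed

text \<open>Gauss's summation formula relative to the value at \<open>m = 0\<close>, which enters the duality as a symmetric and
  nonzero constant.\<close>

lemma gauss_sum_eq:
  assumes a: "Re a > 0" and b: "Re b > 0"
  shows "gauss_sum a b m = gauss_sum a b 0 * fact m / (pochhammer (a + 1) m * pochhammer (b + 1) m)"
proof (induction m)
  case (Suc m)
  have nz: "of_nat m + (a + 1) \<noteq> 0" "of_nat m + (b + 1) \<noteq> 0"
    using of_nat_add_neq_0[of "a + 1" m] of_nat_add_neq_0[of "b + 1" m] a b by auto
  have "gauss_sum a b (Suc m) = of_nat (Suc m) * gauss_sum a b m / ((of_nat m + (a + 1)) * (of_nat m + (b + 1)))"
    using gauss_sum_Suc[OF a b, of m] nz by (subst nonzero_eq_divide_eq) (simp_all only: mult_ac mult_eq_0_iff simp_thms)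
  then show ?case unfolding Suc by (simp add: pochhammer_Suc add_ac mult_ac)
qed simp

text \<open>If it vanished, so would the sums for all \<open>m\<close>. But after normalising the term \<open>n = 0\<close> to \<open>1\<close>, the sum of the
  other terms tends to \<open>0\<close> as \<open>m\<close> grows.\<close>

lemma gauss_sum_0_neq_0:
  assumes a: "Re a > 0" and b: "Re b > 0"
  shows "gauss_sum a b 0 \<noteq> 0"
proof
  assume 0: "gauss_sum a b 0 = 0"
  define s where "s = a + b + 1"
  have s: "Re s > 0" using a b by (simp add: s_def)
  define T where "T = (\<Sum>\<^sub>\<infinity>n. norm (gauss_term a b 0 n))"
  obtain m :: nat where m: "T * norm s < real m" using reals_Archimedean2 by blast
  \<comment> \<open>The terms for this \<open>m\<close>, normalised by \<open>t 0 = 1\<close>. The choice of \<open>m\<close> bounds the sum of the others below \<open>1\<close>.\<close>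
  define t where "t n = pochhammer s m * gauss_term a b m n" for n
  have t0: "t 0 = 1" using pochhammer_neq_0[OF s, of m] by (simp add: t_def gauss_term_def s_def)
  have su: "(\<lambda>n. norm (t n)) summable_on A" for A
    unfolding t_def norm_mult
    by (rule summable_on_subset[OF summable_on_cmult_right[OF gauss_term_abs_summable[OF a b]]]) auto
  have sn: "real m \<le> norm (s + of_nat m)"
    using norm_add_of_nat_ge[OF s, of m] s by (simp add: add.commute)
  have "s + of_nat m \<noteq> 0" using of_nat_add_neq_0[OF s, of m] by (simp add: add.commute)
  have le: "norm (t n) \<le> norm (gauss_term a b 0 n) * (norm s / norm (s + of_nat m))" if n: "n \<ge> 1" for n
  proof -
    obtain k where k: "n = Suc k" using n by (cases n) auto
    have "pochhammer s (m + n) = pochhammer s m * pochhammer (s + of_nat m) n" by (rule pochhammer_product')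
    then have "t n = gauss_term a b 0 n * (pochhammer s n / pochhammer (s + of_nat m) n)"
      using pochhammer_neq_0[OF s] by (simp add: t_def gauss_term_def s_def[symmetric])
    also have "pochhammer s n = s * pochhammer (s + 1) k" unfolding k by (rule pochhammer_rec)
    also have "pochhammer (s + of_nat m) n = (s + of_nat m) * pochhammer (s + of_nat m + 1) k" unfolding k by (rule pochhammer_rec)
    finally have "norm (t n) = norm (gauss_term a b 0 n) * (norm s / norm (s + of_nat m)) *
        (norm (pochhammer (s + 1) k) / norm (pochhammer (s + of_nat m + 1) k))"
      by (simp add: norm_mult norm_divide)
    also have "\<dots> \<le> norm (gauss_term a b 0 n) * (norm s / norm (s + of_nat m)) * 1"
    proof (intro mult_left_mono)
      have "norm (pochhammer (s + 1) k) \<le> norm (pochhammer (s + of_nat m + 1) k)"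
      proof (induction k)
        case (Suc k)
        have "norm (s + 1 + of_nat k) \<le> norm (s + of_nat m + 1 + of_nat k)"
          using s unfolding cmod_def by (intro real_sqrt_le_mono add_mono) (auto intro!: power_mono)
        then show ?case using Suc unfolding pochhammer_Suc norm_mult by (intro mult_mono) auto
      qed simp
      then show "norm (pochhammer (s + 1) k) / norm (pochhammer (s + of_nat m + 1) k) \<le> 1"
        by (simp add: divide_le_eq)
    qed simp
    finally show ?thesis by simp
  qed
  have "gauss_sum a b m = 0" using gauss_sum_eq[OF a b, of m] 0 by simp
  then have "infsum t UNIV = 0" by (simp add: t_def[abs_def] infsum_cmult_right' gauss_sum_def)
  moreover have "infsum t UNIV = t 0 + infsum t (UNIV - {0})"
    using infsum_insert[of t "UNIV - {0}" 0] abs_summable_summable[OF su] by (simp add: insert_absorb)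
  ultimately have "norm (infsum t (UNIV - {0})) = 1"
    using t0 by (metis add_eq_0_iff norm_minus_cancel norm_one)
  moreover have "norm (infsum t (UNIV - {0})) \<le> T * (norm s / norm (s + of_nat m))"
  proof -
    have "norm (infsum t (UNIV - {0})) \<le> (\<Sum>\<^sub>\<infinity>n\<in>UNIV - {0}. norm (t n))" by (rule norm_infsum_bound) (rule su)
    also have "\<dots> \<le> (\<Sum>\<^sub>\<infinity>n. norm (gauss_term a b 0 n) * (norm s / norm (s + of_nat m)))"
      by (rule infsum_mono_neutral[OF su summable_on_cmult_left[OF gauss_term_abs_summable[OF a b]]])
        (use le in auto)
    also have "\<dots> = T * (norm s / norm (s + of_nat m))" by (simp only: infsum_cmult_left' T_def)
    finally show ?thesis .
  qed
  moreover have "T * (norm s / norm (s + of_nat m)) < 1"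
  proof -
    have "T * norm s < norm (s + of_nat m)" using m sn by linarith
    then show ?thesis using \<open>s + of_nat m \<noteq> 0\<close> by (simp add: divide_less_eq)
  qed
  ultimately show False by linarith
qed

context connector_params
begin

lemma endpoint_eq:
  "endpoint m = gauss_sum (a - l) b 0 * (of_nat m + b) * pochhammer (b - l) m * fact m
     / (pochhammer (a - l + 1) m * pochhammer (b + 1) m)"
proof -
  have "weight b a n * connector a b l m n = (of_nat m + b) * pochhammer (b - l) m * gauss_term (a - l) b m n" for n
  proof -
    have "a - l + b + 1 = a + b + 1 - l" by simp
    then show ?thesis using of_nat_add_neq_0[OF a, of n]
      by (simp only: gauss_term_def) (simp add: weight_def connector_def mult_ac)
  qed
  then have "endpoint m = (of_nat m + b) * pochhammer (b - l) m * gauss_sum (a - l) b m"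
    by (simp add: endpoint_def gauss_sum_def infsum_cmult_right')
  also have "\<dots> = gauss_sum (a - l) b 0 * (of_nat m + b) * pochhammer (b - l) m * fact m
     / (pochhammer (a - l + 1) m * pochhammer (b + 1) m)"
    unfolding gauss_sum_eq[OF al b, of m] by (simp add: mult_ac)
  finally show ?thesis .
qed

end

lemma word_op_cmult: "word_op b l w (\<lambda>j. c * f j) m = c * word_op b l w f m"
proof (induction w arbitrary: m)
  case (Cons e w)
  have "letter_op b l e (\<lambda>j. c * g j) m = c * letter_op b l e g m" for g
    by (simp only: letter_op_def mult.left_commute[of _ c] infsum_cmult_right')
  moreover have "word_op b l w (\<lambda>j. c * f j) = (\<lambda>j. c * word_op b l w f j)" using Cons by (intro ext)
  ultimately show ?case by simp
qed simp

text \<open>The final factor \<open>m! / (a)\<^bsub>m + 1\<^esub>\<close> of \<open>Z\<close>, deformed like a variable followed by a strict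
  inequality. This matches the convention \<open>c\<^sub>p = 1\<close>.\<close>

definition tail_weight :: "complex \<Rightarrow> complex \<Rightarrow> nat \<Rightarrow> complex" where
  "tail_weight a l m = (of_nat m + a) / (of_nat m + (a - l)) * (fact m / pochhammer a (Suc m))"

lemma pochhammer_shift:
  assumes "Re z > 0" shows "pochhammer z m / pochhammer (z + 1) m = z / (of_nat m + (z :: complex))"
proof -
  have "pochhammer (z + 1) m \<noteq> 0" "of_nat m + z \<noteq> 0"
    using assms pochhammer_neq_0[of "z + 1" m] of_nat_add_neq_0[of z m] by auto
  moreover have "z * pochhammer (z + 1) m = (of_nat m + z) * pochhammer z m"
    using pochhammer_rec[of z m] pochhammer_rec'[of z m] by (simp add: add.commute)
  ultimately show ?thesis by (simp add: field_simps)
qed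

context connector_params
begin

text \<open>The constant in front of \<open>tail_weight\<close> is symmetric in \<open>a\<close> and \<open>b\<close>, so it cancels in the duality.\<close>

lemma endpoint_l0:
  assumes "l = 0" shows "endpoint m = gauss_sum a b 0 * (a * b) * tail_weight a 0 m"
proof -
  have nz: "of_nat m + a \<noteq> 0" "of_nat m + b \<noteq> 0" using a b by (auto simp: of_nat_add_neq_0)
  have "endpoint m = gauss_sum a b 0 * fact m * ((of_nat m + b) * (pochhammer b m / pochhammer (b + 1) m)) / pochhammer (a + 1) m"
    unfolding endpoint_eq unfolding assms by (simp add: mult_ac)
  also have "(of_nat m + b) * (pochhammer b m / pochhammer (b + 1) m) = b"
    unfolding pochhammer_shift[OF b] using nz by simp
  also have "gauss_sum a b 0 * fact m * b / pochhammer (a + 1) m = gauss_sum a b 0 * (a * b) * (fact m / pochhammer a (Suc m))"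
    unfolding pochhammer_rec[of a] using a by auto
  finally show ?thesis using nz by (simp add: tail_weight_def)
qed

text \<open>With \<open>a = b\<close> the two ends of the connected sum are the same, so the constant cancels for any \<open>l\<close>.\<close>

lemma endpoint_same:
  assumes "b = a" shows "endpoint m = gauss_sum (a - l) a 0 * ((a - l) * a) * tail_weight a l m"
proof -
  have nz: "of_nat m + a \<noteq> 0" "of_nat m + (a - l) \<noteq> 0" using a al by (auto simp: of_nat_add_neq_0)
  have "endpoint m = gauss_sum (a - l) a 0 * (of_nat m + a) * (pochhammer (a - l) m / pochhammer (a - l + 1) m) * fact m / pochhammer (a + 1) m"
    unfolding endpoint_eq unfolding assms by (simp add: mult_ac)
  also have "\<dots> = gauss_sum (a - l) a 0 * ((a - l) * a) * tail_weight a l m"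
    unfolding pochhammer_shift[OF al] tail_weight_def pochhammer_rec[of a] using a by auto
  finally show ?thesis .
qed

end

text \<open>The series \<open>Z\<close> of the word \<open>x\<^sub>1 w x\<^sub>-\<^sub>1\<close> in operator form (see \<open>Z_term_has_sum\<close>), deformed by \<open>l\<close>.\<close>

definition pairing :: "complex \<Rightarrow> complex \<Rightarrow> complex \<Rightarrow> word \<Rightarrow> complex" where
  "pairing a b l w = (\<Sum>\<^sub>\<infinity>m. weight a b m * word_op b l w (tail_weight a l) m)"

lemma pairing_duality_aux:
  assumes p: "connector_params a b l" and w: "set w \<subseteq> {-1, 0, 1}" and c: "c \<noteq> 0"
    and 1: "connector_params.endpoint a b l = (\<lambda>m. c * tail_weight a l m)"
    and 2: "connector_params.endpoint b a l = (\<lambda>m. c * tail_weight b l m)"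
  shows "pairing a b l w = pairing b a l (map uminus (rev w))"
  using connector_params.connected_sum_duality[OF p w] c
  by (simp add: 1 2 word_op_cmult pairing_def mult.left_commute[of _ c] infsum_cmult_right')

theorem pairing_duality:
  assumes "Re a > 0" "Re b > 0" and w: "set w \<subseteq> {-1, 0, 1}"
  shows "pairing a b 0 w = pairing b a 0 (map uminus (rev w))"
proof -
  interpret connector_params a b 0 using assms by unfold_locales auto
  interpret flip: connector_params b a 0 by (rule flip)
  show ?thesis
  proof (rule pairing_duality_aux[OF connector_params_axioms w])
    show "gauss_sum a b 0 * (a * b) \<noteq> 0" using gauss_sum_0_neq_0[OF a b] a b by auto
    show "endpoint = (\<lambda>m. gauss_sum a b 0 * (a * b) * tail_weight a 0 m)"
      by (intro ext endpoint_l0) simp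
    show "flip.endpoint = (\<lambda>m. gauss_sum a b 0 * (a * b) * tail_weight b 0 m)"
      by (intro ext) (simp add: flip.endpoint_l0 gauss_sum_commute[of b] mult_ac)
  qed
qed

theorem pairing_duality_same:
  assumes "Re a > 0" "Re (a - l) > 0" and w: "set w \<subseteq> {-1, 0, 1}"
  shows "pairing a a l w = pairing a a l (map uminus (rev w))"
proof -
  interpret connector_params a a l using assms by unfold_locales auto
  show ?thesis
  proof (rule pairing_duality_aux[OF connector_params_axioms w])
    show "gauss_sum (a - l) a 0 * ((a - l) * a) \<noteq> 0" using gauss_sum_0_neq_0[OF al a] a al by auto
  qed (intro ext endpoint_same refl)+
qed

section \<open>Chain sums as iterated operators\<close>

definition strict_factor :: "complex \<Rightarrow> complex \<Rightarrow> nat \<Rightarrow> nat \<Rightarrow> complex" where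
  "strict_factor b l c m = (if c = 1 then (of_nat m + b) / (of_nat m + (b - l)) else 1)"

definition chain_prod :: "complex \<Rightarrow> complex \<Rightarrow> index \<Rightarrow> (nat \<Rightarrow> nat) \<Rightarrow> complex" where
  "chain_prod b l s m = (\<Prod>i=1..<length s. strict_factor b l (cc s i) (m i) / (of_nat (m i) + b) ^ kk s i) *
     (1 / (of_nat (m (length s)) + b) ^ kk s (length s))"

definition proper :: "index \<Rightarrow> bool" where
  "proper s \<longleftrightarrow> (\<forall>(c, k)\<in>set s. c \<in> {0, 1} \<and> k \<ge> 1)"

lemma letter_kernel_eq:
  assumes "c \<in> {0, 1}"
  shows "letter_kernel b l (int c) m j = (if ltc c m j then strict_factor b l c m * (1 / (of_nat j + b)) else 0)"
  using assms by (auto simp: letter_kernel_def strict_factor_def ltc_def)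

lemma letter_op_minus_1: "letter_op b l (-1) f m = f m / (of_nat m + b)"
proof -
  have "letter_kernel b l (-1) m j * f j = (if j = m then f j / (of_nat j + b) else 0)" for j
    by (simp add: letter_kernel_def)
  then show ?thesis
    using infsumI[OF has_sum_single[of m "\<lambda>j. f j / (of_nat j + b)"]] by (simp add: letter_op_def)
qed

lemma word_op_replicate: "word_op b l (replicate k (-1)) f = (\<lambda>m. f m / (of_nat m + b) ^ k)"
  by (induction k) (simp_all add: fun_eq_iff letter_op_minus_1)

lemma Z_dom_snoc_bij:
  assumes p: "p = length s" "p > 0"
  shows "bij_betw (\<lambda>(m, j). m(Suc p := j)) (SIGMA m:Z_dom s. {j. ltc c (m p) j}) (Z_dom (s @ [(c, k)]))"
proof (rule bij_betw_byWitness[where f' = "\<lambda>m. (restrict m {1..p}, m (Suc p))"])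
  have cc1: "cc (s @ [(c, k)]) i = cc s i" if "i \<in> {1..<p}" for i
    using that p by (simp add: cc_def nth_append)
  have cc2: "cc (s @ [(c, k)]) p = c" using p by (simp add: cc_def)
  show "\<forall>x\<in>SIGMA m:Z_dom s. {j. ltc c (m p) j}. (\<lambda>m. (restrict m {1..p}, m (Suc p))) ((\<lambda>(m, j). m(Suc p := j)) x) = x"
  proof
    fix x assume "x \<in> (SIGMA m:Z_dom s. {j. ltc c (m p) j})"
    then obtain m j where x: "x = (m, j)" and "m \<in> Z_dom s" by auto
    then have "m \<in> extensional {1..p}" using p by (simp add: Z_dom_def PiE_iff)
    then show "(\<lambda>m. (restrict m {1..p}, m (Suc p))) ((\<lambda>(m, j). m(Suc p := j)) x) = x"
      by (auto simp: fun_eq_iff restrict_def extensional_def x)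
  qed
  show "\<forall>m\<in>Z_dom (s @ [(c, k)]). (\<lambda>(m, j). m(Suc p := j)) ((\<lambda>m. (restrict m {1..p}, m (Suc p))) m) = m"
  proof
    fix m assume "m \<in> Z_dom (s @ [(c, k)])"
    then have "m \<in> extensional {1..Suc p}" using p by (simp add: Z_dom_def PiE_iff)
    then show "(\<lambda>(m, j). m(Suc p := j)) ((\<lambda>m. (restrict m {1..p}, m (Suc p))) m) = m"
      by (auto simp: fun_eq_iff restrict_def extensional_def)
  qed
  show "(\<lambda>(m, j). m(Suc p := j)) ` (SIGMA m:Z_dom s. {j. ltc c (m p) j}) \<subseteq> Z_dom (s @ [(c, k)])"
  proof safe
    fix m j assume m: "m \<in> Z_dom s" and j: "ltc c (m p) j"
    have "ltc (cc (s @ [(c, k)]) i) ((m(Suc p := j)) i) ((m(Suc p := j)) (i + 1))" if "i \<in> {1..<Suc p}" for i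
    proof (cases "i = p")
      case True then show ?thesis using j cc2 by simp
    next
      case False
      then have "i \<in> {1..<p}" using that by auto
      then show ?thesis using m cc1[of i] p by (auto simp: Z_dom_def)
    qed
    moreover have "m(Suc p := j) \<in> {1..Suc p} \<rightarrow>\<^sub>E UNIV"
      using m p by (auto simp: Z_dom_def PiE_iff extensional_def)
    ultimately show "(m(Suc p := j)) \<in> Z_dom (s @ [(c, k)])" using p by (simp add: Z_dom_def)
  qed
  show "(\<lambda>m. (restrict m {1..p}, m (Suc p))) ` Z_dom (s @ [(c, k)]) \<subseteq> (SIGMA m:Z_dom s. {j. ltc c (m p) j})"
  proof safe
    fix m assume m: "m \<in> Z_dom (s @ [(c, k)])"
    have *: "ltc (cc (s @ [(c, k)]) i) (m i) (m (i + 1))" if "i \<in> {1..p}" for i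
      using m that p by (auto simp: Z_dom_def)
    have "ltc (cc s i) (restrict m {1..p} i) (restrict m {1..p} (i + 1))" if "i \<in> {1..<p}" for i
      using *[of i] that cc1[of i] by auto
    then show "restrict m {1..p} \<in> Z_dom s" using p by (auto simp: Z_dom_def)
    show "ltc c (restrict m {1..p} p) (m (Suc p))" using *[of p] p(2) cc2 by (simp add: Suc_le_eq)
  qed
qed

lemma Z_dom_singleton_bij: "bij_betw (\<lambda>j. \<lambda>i\<in>{1}. j) UNIV (Z_dom [(c, k)])"
proof (rule bij_betw_byWitness[where f' = "\<lambda>m. m 1"])
  show "\<forall>m\<in>Z_dom [(c, k)]. (\<lambda>i\<in>{1}. m 1) = m"
    by (auto simp: Z_dom_def PiE_iff extensional_def fun_eq_iff)
qed (auto simp: Z_dom_def PiE_iff extensional_def)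

lemma chain_prod_snoc:
  assumes p: "p = length s" "p > 0"
  shows "chain_prod b l (s @ [(c, k)]) m
    = chain_prod b l s m * strict_factor b l c (m p) * (1 / (of_nat (m (Suc p)) + b) ^ k)"
proof -
  have 1: "cc (s @ [(c, k)]) i = cc s i" "kk (s @ [(c, k)]) i = kk s i" if "i \<in> {1..<p}" for i
    using that p by (auto simp: cc_def kk_def nth_append)
  have 2: "cc (s @ [(c, k)]) p = c" "kk (s @ [(c, k)]) p = kk s p" "kk (s @ [(c, k)]) (Suc p) = k"
    using p by (auto simp: cc_def kk_def nth_append)
  have "(\<Prod>i=1..<Suc p. strict_factor b l (cc (s @ [(c, k)]) i) (m i) / (of_nat (m i) + b) ^ kk (s @ [(c, k)]) i)
      = (\<Prod>i=1..<p. strict_factor b l (cc s i) (m i) / (of_nat (m i) + b) ^ kk s i) *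
        (strict_factor b l c (m p) / (of_nat (m p) + b) ^ kk s p)"
  proof -
    have "(\<Prod>i=1..<p. strict_factor b l (cc (s @ [(c, k)]) i) (m i) / (of_nat (m i) + b) ^ kk (s @ [(c, k)]) i)
        = (\<Prod>i=1..<p. strict_factor b l (cc s i) (m i) / (of_nat (m i) + b) ^ kk s i)"
      by (intro prod.cong refl) (simp add: 1)
    then show ?thesis using p(2) by (simp add: prod.atLeastLessThan_Suc 2)
  qed
  moreover have "length (s @ [(c, k)]) = Suc p" using p by simp
  ultimately show ?thesis unfolding chain_prod_def p(1)[symmetric] by (simp only: 2) (simp add: mult_ac)
qed

text \<open>Summing over the last variable first turns the last factor \<open>z\<^sub>c(k)\<close> into the operator of its letters,
  applied to \<open>h\<close>. The statement therefore is for arbitrary functions \<open>h\<close> of the last variable, and the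
  induction removes factors at the end of the index.\<close>

lemma chain_has_sum:
  assumes b: "Re b > 0" and l: "Re (b - l) > 0" and \<sigma>: "\<sigma> > 0"
    and g: "tame \<sigma> (\<lambda>m. g m / (of_nat m + b))" and s: "s \<noteq> []" "proper s" and h: "decays \<sigma> h"
  shows "(\<lambda>m. norm (g (m 1) * chain_prod b l s m * h (m (length s)))) summable_on Z_dom s \<and>
    ((\<lambda>m. g (m 1) * chain_prod b l s m * h (m (length s))) has_sum
      (\<Sum>\<^sub>\<infinity>m. g m / (of_nat m + b) * word_op b l (tl (word_of s)) h m)) (Z_dom s)"
  using s h
proof (induction s arbitrary: h rule: rev_nonempty_induct)
  case (single x)
  obtain c k where x: "x = (c, k)" by (cases x)
  have k: "k \<ge> 1" using single by (simp add: x proper_def)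
  define T where "T j = g j / (of_nat j + b) * word_op b l (replicate (k - 1) (-1)) h j" for j
  have sT: "(\<lambda>j. norm (T j)) summable_on UNIV"
    unfolding T_def by (rule tame_abs_summable[OF g decays_word_op[OF b l \<sigma> single(2)]])
  have eq: "g ((\<lambda>i\<in>{1}. j) 1) * chain_prod b l [x] (\<lambda>i\<in>{1}. j) * h ((\<lambda>i\<in>{1}. j) (length [x])) = T j" for j
  proof -
    obtain k' where "k = Suc k'" using k by (cases k) auto
    then show ?thesis by (simp add: chain_prod_def x kk_def T_def word_op_replicate)
  qed
  have w: "tl (word_of [x]) = replicate (k - 1) (-1)" by (simp add: word_of_def x zword_def)
  have bij: "bij_betw (\<lambda>j. \<lambda>i\<in>{1}. j) UNIV (Z_dom [x])" unfolding x by (rule Z_dom_singleton_bij)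
  show ?case
    unfolding has_sum_reindex_bij_betw[OF bij, symmetric] summable_on_reindex_bij_betw[OF bij, symmetric] eq w
    using sT has_sum_infsum[OF abs_summable_summable[OF sT]] by (simp add: T_def)
next
  case (snoc x s)
  obtain c k where x: "x = (c, k)" by (cases x)
  have c: "c \<in> {0, 1}" and k: "k \<ge> 1" and s': "proper s" using snoc.prems by (auto simp: x proper_def)
  define p where "p = length s"
  have p: "p = length s" "p > 0" using snoc.hyps by (auto simp: p_def)
  define h2 where "h2 = word_op b l (replicate (k - 1) (-1)) h"
  have h2: "decays \<sigma> h2" unfolding h2_def by (rule decays_word_op[OF b l \<sigma> snoc.prems(2)])
  define h3 where "h3 = letter_op b l (int c) h2"
  have h3: "decays \<sigma> h3" using decays_word_op[OF b l \<sigma> h2, of "[int c]"] by (simp add: h3_def)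
  \<comment> \<open>The sum of absolute values over the last variable. It decays as well, so the induction hypothesis for it
    gives absolute convergence of the longer chain sum.\<close>
  define h4 where "h4 m = complex_of_real (\<Sum>\<^sub>\<infinity>j. norm (letter_kernel b l (int c) m j * h2 j))" for m
  have ks: "(\<lambda>j. norm (letter_kernel b l (int c) m j * h2 j)) summable_on UNIV" for m
    by (rule tame_abs_summable[OF tame_letter_kernel[OF b l \<sigma>] h2])
  have h4: "decays \<sigma> h4"
  proof -
    obtain C where "dominated \<sigma> C h2" using h2 by (auto simp: decays_def)
    then obtain K where K: "\<And>m. (\<Sum>\<^sub>\<infinity>j. norm (letter_kernel b l (int c) m j * h2 j)) \<le> K * C * phi \<sigma> m"
      using letter_op_abs_le[OF b l \<sigma>] by blast
    have "norm (h4 m) \<le> (K * C) * phi \<sigma> m" for m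
    proof -
      have "0 \<le> (\<Sum>\<^sub>\<infinity>j. norm (letter_kernel b l (int c) m j * h2 j))" by (rule infsum_nonneg) simp
      then show ?thesis using K[of m] by (simp add: h4_def)
    qed
    then show ?thesis unfolding decays_def dominated_def by (intro exI allI)
  qed
  define F where "F m = g (m 1) * chain_prod b l s m" for m
  define A where "A = (SIGMA m:Z_dom s. {j. ltc c (m p) j})"
  define G where "G = (\<lambda>(m, j). F m * (letter_kernel b l (int c) (m p) j * h2 j))"
  have bij: "bij_betw (\<lambda>(m, j). m(Suc p := j)) A (Z_dom (s @ [x]))"
    unfolding x A_def by (rule Z_dom_snoc_bij[OF p])
  have eq: "g ((case x of (m, j) \<Rightarrow> m(Suc p := j)) 1) * chain_prod b l (s @ [(c, k)]) (case x of (m, j) \<Rightarrow> m(Suc p := j)) *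
      h ((case x of (m, j) \<Rightarrow> m(Suc p := j)) (Suc p)) = G x" if "x \<in> A" for x
  proof -
    obtain m j where x: "x = (m, j)" "m \<in> Z_dom s" "ltc c (m p) j" using \<open>x \<in> A\<close> by (auto simp: A_def)
    obtain k' where k': "k = Suc k'" using k by (cases k) auto
    have "chain_prod b l s (m(Suc p := j)) = chain_prod b l s m"
      using p by (auto simp: chain_prod_def intro!: prod.cong)
    moreover have "Suc p \<noteq> 1" using p by simp
    ultimately show ?thesis using p(2)
      by (simp add: chain_prod_snoc[OF p] x letter_kernel_eq[OF c] G_def F_def h2_def word_op_replicate k')
  qed
  have neutral: "((\<lambda>j. letter_kernel b l (int c) m j * h2 j) has_sum S) {j. ltc c m j}
      \<longleftrightarrow> ((\<lambda>j. letter_kernel b l (int c) m j * h2 j) has_sum S) UNIV" for m S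
    by (rule has_sum_cong_neutral) (auto simp: letter_kernel_eq[OF c])
  have neutral': "((\<lambda>j. norm (letter_kernel b l (int c) m j * h2 j)) has_sum S) {j. ltc c m j}
      \<longleftrightarrow> ((\<lambda>j. norm (letter_kernel b l (int c) m j * h2 j)) has_sum S) UNIV" for m S
    by (rule has_sum_cong_neutral) (auto simp: letter_kernel_eq[OF c])
  have sumG: "(\<lambda>x. norm (G x)) summable_on A"
    unfolding A_def
  proof (rule summable_on_SigmaI)
    fix m
    have "((\<lambda>j. norm (letter_kernel b l (int c) (m p) j * h2 j)) has_sum (\<Sum>\<^sub>\<infinity>j. norm (letter_kernel b l (int c) (m p) j * h2 j))) {j. ltc c (m p) j}"
      unfolding neutral' by (rule has_sum_infsum[OF ks])
    then show "((\<lambda>j. norm (G (m, j))) has_sum norm (F m) * (\<Sum>\<^sub>\<infinity>j. norm (letter_kernel b l (int c) (m p) j * h2 j))) {j. ltc c (m p) j}"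
      unfolding G_def prod.case norm_mult[of "F m"] by (rule has_sum_cmult_right)
  next
    have "norm (F m * h4 (m p)) = norm (F m) * (\<Sum>\<^sub>\<infinity>j. norm (letter_kernel b l (int c) (m p) j * h2 j))" for m
    proof -
      have "0 \<le> (\<Sum>\<^sub>\<infinity>j. norm (letter_kernel b l (int c) (m p) j * h2 j))" by (rule infsum_nonneg) simp
      then show ?thesis by (simp add: norm_mult h4_def)
    qed
    moreover have "(\<lambda>m. norm (F m * h4 (m p))) summable_on Z_dom s"
      using snoc.IH[OF s' h4] by (simp add: F_def p(1))
    ultimately show "(\<lambda>m. norm (F m) * (\<Sum>\<^sub>\<infinity>j. norm (letter_kernel b l (int c) (m p) j * h2 j))) summable_on Z_dom s" by simp
  qed simp
  have "(G has_sum (\<Sum>\<^sub>\<infinity>m. g m / (of_nat m + b) * word_op b l (tl (word_of s)) h3 m)) A"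
    unfolding A_def
  proof (rule has_sum_SigmaI)
    fix m
    have "((\<lambda>j. letter_kernel b l (int c) (m p) j * h2 j) has_sum h3 (m p)) {j. ltc c (m p) j}"
      unfolding neutral h3_def letter_op_def by (rule has_sum_infsum[OF abs_summable_summable[OF ks]])
    then show "((\<lambda>j. G (m, j)) has_sum F m * h3 (m p)) {j. ltc c (m p) j}"
      unfolding G_def prod.case by (rule has_sum_cmult_right)
  next
    show "((\<lambda>m. F m * h3 (m p)) has_sum (\<Sum>\<^sub>\<infinity>m. g m / (of_nat m + b) * word_op b l (tl (word_of s)) h3 m)) (Z_dom s)"
      using snoc.IH[OF s' h3] by (simp add: F_def p(1))
  next
    show "G summable_on (SIGMA m:Z_dom s. {j. ltc c (m p) j})"
      using abs_summable_summable[OF sumG] by (simp add: A_def)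
  qed
  moreover have w: "word_op b l (tl (word_of (s @ [x]))) h = word_op b l (tl (word_of s)) h3"
  proof -
    have "word_of s \<noteq> []" using snoc.hyps by (cases s) (auto simp: word_of_def zword_def)
    moreover have "word_of (s @ [x]) = word_of s @ int c # replicate (k - 1) (-1)"
      by (simp add: word_of_def x zword_def)
    ultimately show ?thesis by (simp add: h3_def h2_def)
  qed
  moreover have "length (s @ [x]) = Suc p" using p by simp
  ultimately show ?case
    unfolding has_sum_reindex_bij_betw[OF bij, symmetric] summable_on_reindex_bij_betw[OF bij, symmetric]
    unfolding w unfolding x using sumG eq by (simp cong: has_sum_cong summable_on_cong)
qed

section \<open>Power series over compositions\<close>

lemma summable_on_prod_PiE_nonneg:
  fixes f :: "'i \<Rightarrow> 'k \<Rightarrow> real"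
  assumes I: "finite I" and f: "\<And>i. i \<in> I \<Longrightarrow> f i summable_on UNIV" and nonneg: "\<And>i k. i \<in> I \<Longrightarrow> 0 \<le> f i k"
  shows "(\<lambda>\<rho>. \<Prod>i\<in>I. f i (\<rho> i)) summable_on (I \<rightarrow>\<^sub>E UNIV)"
proof (cases "(\<Prod>i\<in>I. infsum (f i) UNIV) = 0")
  case True
  then obtain i where i: "i \<in> I" "infsum (f i) UNIV = 0" using I by auto
  then have "f i k = 0" for k
    using nonneg_infsum_le_0D[of "f i" UNIV] f nonneg by fastforce
  \<comment> \<open>A vanishing factor on the right makes all products vanish, as the terms are nonnegative.\<close>
  then have "(\<Prod>i\<in>I. f i (\<rho> i)) = 0" for \<rho> using i(1) I by (auto simp: prod_zero_iff)
  then show ?thesis by simp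
next
  case False
  have "infsum (\<lambda>\<rho>. \<Prod>i\<in>I. f i (\<rho> i)) (I \<rightarrow>\<^sub>E UNIV) = (\<Prod>i\<in>I. infsum (f i) UNIV)"
    using f summable_on_iff_abs_summable_on_real by (intro infsum_prod_PiE_abs I) blast
  \<comment> \<open>A divergent \<open>infsum\<close> would have the value \<open>0\<close>.\<close>
  with False show ?thesis using infsum_not_exists by fastforce
qed

lemma prod_PiE_abs:
  fixes f :: "'i \<Rightarrow> 'k \<Rightarrow> complex"
  assumes I: "finite I" and f: "\<And>i. i \<in> I \<Longrightarrow> (\<lambda>k. norm (f i k)) summable_on UNIV"
  shows "(\<lambda>\<rho>. norm (\<Prod>i\<in>I. f i (\<rho> i))) summable_on (I \<rightarrow>\<^sub>E UNIV)"
    and "(\<Sum>\<^sub>\<infinity>\<rho>\<in>I \<rightarrow>\<^sub>E UNIV. \<Prod>i\<in>I. f i (\<rho> i)) = (\<Prod>i\<in>I. \<Sum>\<^sub>\<infinity>k. f i k)"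
proof -
  show "(\<lambda>\<rho>. norm (\<Prod>i\<in>I. f i (\<rho> i))) summable_on (I \<rightarrow>\<^sub>E UNIV)"
    unfolding prod_norm[symmetric] using assms by (intro summable_on_prod_PiE_nonneg) auto
  show "(\<Sum>\<^sub>\<infinity>\<rho>\<in>I \<rightarrow>\<^sub>E UNIV. \<Prod>i\<in>I. f i (\<rho> i)) = (\<Prod>i\<in>I. \<Sum>\<^sub>\<infinity>k. f i k)"
    using assms by (intro infsum_prod_PiE_abs)
qed

text \<open>The summation range of \<open>sigma_b1\<close>; those of \<open>sigma_r\<close> and of the right-hand side of (i) are
  subsets of it, and are extended to it by coefficients that vanish.\<close>

definition compositions :: "nat \<Rightarrow> nat \<Rightarrow> (nat \<Rightarrow> nat) set" where
  "compositions p n = {\<rho>. \<rho> \<in> {1..p} \<rightarrow>\<^sub>E UNIV \<and> (\<Sum>i=1..p. \<rho> i) = n}"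

lemma finite_compositions: "finite (compositions p n)"
  unfolding compositions_def by (rule finite_sigma_b1_range)

lemma bij_compositions:
  "bij_betw (\<lambda>\<rho>. (\<Sum>i=1..p. \<rho> i, \<rho>)) ({1..p} \<rightarrow>\<^sub>E UNIV) (SIGMA n:UNIV. compositions p n)"
  by (rule bij_betw_byWitness[where f' = snd]) (auto simp: compositions_def)

text \<open>The common form of the three generating functions: a power series is attached to each of the \<open>p\<close> variables
  of a summation index \<open>m\<close>, and their product is summed over \<open>m\<close>. Absolute convergence at \<open>\<bar>z\<bar> = r\<close> allows
  sorting by total degree before summing over \<open>m\<close>.\<close>

lemma power_series_family:
  fixes T :: "'m \<Rightarrow> complex" and a :: "'m \<Rightarrow> nat \<Rightarrow> nat \<Rightarrow> complex"
  assumes r: "r > 0"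
    and a: "\<And>m i. m \<in> A \<Longrightarrow> i \<in> {1..p} \<Longrightarrow> (\<lambda>k. norm (a m i k) * r ^ k) summable_on UNIV"
    and B: "(\<lambda>m. norm (T m) * (\<Prod>i=1..p. \<Sum>\<^sub>\<infinity>k. norm (a m i k) * r ^ k)) summable_on A"
  shows power_series_family_summable:
      "\<And>\<rho>. \<rho> \<in> {1..p} \<rightarrow>\<^sub>E UNIV \<Longrightarrow> (\<lambda>m. norm (T m * (\<Prod>i=1..p. a m i (\<rho> i)))) summable_on A"
    and power_series_family_sums: "\<And>z. norm z \<le> r \<Longrightarrow>
      (\<lambda>n. (\<Sum>\<rho>\<in>compositions p n. \<Sum>\<^sub>\<infinity>m\<in>A. T m * (\<Prod>i=1..p. a m i (\<rho> i))) * z ^ n) sums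
      (\<Sum>\<^sub>\<infinity>m\<in>A. T m * (\<Prod>i=1..p. \<Sum>\<^sub>\<infinity>k. a m i k * z ^ k))"
proof -
  define P where "P = {1..p} \<rightarrow>\<^sub>E (UNIV :: nat set)"
  define N where "N = (\<lambda>(m, \<rho>). norm (T m) * (\<Prod>i=1..p. norm (a m i (\<rho> i)) * r ^ \<rho> i))"
  have N0: "0 \<le> N x" for x using r by (cases x) (auto simp: N_def intro!: mult_nonneg_nonneg prod_nonneg)
  have inner: "((\<lambda>\<rho>. N (m, \<rho>)) has_sum norm (T m) * (\<Prod>i=1..p. \<Sum>\<^sub>\<infinity>k. norm (a m i k) * r ^ k)) P"
    if m: "m \<in> A" for m
  proof -
    have "(\<lambda>\<rho>. \<Prod>i=1..p. norm (a m i (\<rho> i)) * r ^ \<rho> i) summable_on P"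
      unfolding P_def using a[OF m] r by (intro summable_on_prod_PiE_nonneg) auto
    moreover have "infsum (\<lambda>\<rho>. \<Prod>i=1..p. norm (a m i (\<rho> i)) * r ^ \<rho> i) P = (\<Prod>i=1..p. \<Sum>\<^sub>\<infinity>k. norm (a m i k) * r ^ k)"
      unfolding P_def using a[OF m] r by (intro infsum_prod_PiE_abs) auto
    ultimately show ?thesis unfolding N_def prod.case
      by (intro has_sum_cmult_right) (simp add: has_sum_iff)
  qed
  have sumN: "N summable_on A \<times> P"
    by (rule summable_on_SigmaI[OF inner B N0])
  show "(\<lambda>m. norm (T m * (\<Prod>i=1..p. a m i (\<rho> i)))) summable_on A" if \<rho>: "\<rho> \<in> {1..p} \<rightarrow>\<^sub>E UNIV" for \<rho>
  proof -
    define c where "c = inverse (\<Prod>i=1..p. r ^ \<rho> i)"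
    have "inj_on (\<lambda>m. (m, \<rho>)) A" by (rule inj_onI) simp
    moreover have "N summable_on (\<lambda>m. (m, \<rho>)) ` A" by (rule summable_on_subset[OF sumN]) (use \<rho> in \<open>auto simp: P_def\<close>)
    ultimately have "(\<lambda>m. N (m, \<rho>)) summable_on A" by (simp add: summable_on_reindex o_def)
    then have "(\<lambda>m. c * N (m, \<rho>)) summable_on A" by (rule summable_on_cmult_right)
    moreover have "c * N (m, \<rho>) = norm (T m * (\<Prod>i=1..p. a m i (\<rho> i)))" for m
    proof -
      have "(\<Prod>i=1..p. r ^ \<rho> i) \<noteq> 0" using r by (simp add: prod_zero_iff)
      then show ?thesis by (simp add: c_def N_def prod.distrib norm_mult prod_norm)
    qed
    ultimately show ?thesis by simp
  qed
  fix z :: complex assume z: "norm z \<le> r"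
  define F where "F = (\<lambda>(m, \<rho>). T m * (\<Prod>i=1..p. a m i (\<rho> i) * z ^ \<rho> i))"
  have FN: "norm (F x) \<le> N x" for x
  proof (cases x)
    case (Pair m \<rho>)
    have "(\<Prod>i=1..p. norm (a m i (\<rho> i) * z ^ \<rho> i)) \<le> (\<Prod>i=1..p. norm (a m i (\<rho> i)) * r ^ \<rho> i)"
      using z by (intro prod_mono) (auto simp: norm_mult norm_power intro!: mult_left_mono power_mono)
    then show ?thesis by (simp add: Pair F_def N_def norm_mult prod_norm[symmetric] mult_left_mono)
  qed
  have sumF: "F summable_on A \<times> P"
    by (rule abs_summable_summable[OF Infinite_Sum.abs_summable_on_comparison_test'[OF sumN FN]])
  define g where "g \<rho> = (\<Sum>\<^sub>\<infinity>m\<in>A. T m * (\<Prod>i=1..p. a m i (\<rho> i)))" for \<rho>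
  have g: "(\<Sum>\<^sub>\<infinity>m\<in>A. F (m, \<rho>)) = g \<rho> * z ^ (\<Sum>i=1..p. \<rho> i)" for \<rho>
  proof -
    have "F (m, \<rho>) = T m * (\<Prod>i=1..p. a m i (\<rho> i)) * z ^ (\<Sum>i=1..p. \<rho> i)" for m
      by (simp add: F_def prod.distrib power_sum mult_ac)
    then show ?thesis by (simp only: g_def infsum_cmult_left')
  qed
  have S: "(\<Sum>\<^sub>\<infinity>\<rho>\<in>P. F (m, \<rho>)) = T m * (\<Prod>i=1..p. \<Sum>\<^sub>\<infinity>k. a m i k * z ^ k)" if m: "m \<in> A" for m
  proof -
    have "(\<lambda>k. norm (a m i k * z ^ k)) summable_on UNIV" if "i \<in> {1..p}" for i
      by (rule Infinite_Sum.abs_summable_on_comparison_test'[OF a[OF m that]])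
        (use z in \<open>auto simp: norm_mult norm_power intro!: mult_left_mono power_mono\<close>)
    from prod_PiE_abs(2)[of "{1..p}" "\<lambda>i k. a m i k * z ^ k", OF _ this] show ?thesis
      by (simp add: F_def P_def infsum_cmult_right')
  qed
  have sumF': "(\<lambda>(\<rho>, m). F (m, \<rho>)) summable_on P \<times> A" using summable_on_swap[of F A P] sumF by simp
  have "(\<Sum>\<^sub>\<infinity>\<rho>\<in>P. \<Sum>\<^sub>\<infinity>m\<in>A. F (m, \<rho>)) = (\<Sum>\<^sub>\<infinity>m\<in>A. \<Sum>\<^sub>\<infinity>\<rho>\<in>P. F (m, \<rho>))"
    using infsum_swap_banach[of "\<lambda>m \<rho>. F (m, \<rho>)" A P] sumF by simp
  also have "\<dots> = (\<Sum>\<^sub>\<infinity>m\<in>A. T m * (\<Prod>i=1..p. \<Sum>\<^sub>\<infinity>k. a m i k * z ^ k))" (is "_ = ?S")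
    by (intro infsum_cong S)
  finally have infP: "(\<Sum>\<^sub>\<infinity>\<rho>\<in>P. g \<rho> * z ^ (\<Sum>i=1..p. \<rho> i)) = ?S" by (simp only: g)
  have "(\<lambda>\<rho>. \<Sum>\<^sub>\<infinity>m\<in>A. F (m, \<rho>)) summable_on P"
    using summable_on_Sigma_banach[of "\<lambda>\<rho> m. F (m, \<rho>)" P "\<lambda>_. A"] sumF' by simp
  then have "((\<lambda>\<rho>. g \<rho> * z ^ (\<Sum>i=1..p. \<rho> i)) has_sum ?S) P"
    using infP by (simp add: g has_sum_iff)
  then have "((\<lambda>(n, \<rho>). g \<rho> * z ^ n) has_sum ?S) (SIGMA n:UNIV. compositions p n)"
    using has_sum_reindex_bij_betw[OF bij_compositions[of p], of "\<lambda>(n, \<rho>). g \<rho> * z ^ n" ?S] by (simp add: P_def)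
  moreover have "((\<lambda>\<rho>. case (n, \<rho>) of (n, \<rho>) \<Rightarrow> g \<rho> * z ^ n) has_sum (\<Sum>\<rho>\<in>compositions p n. g \<rho>) * z ^ n) (compositions p n)" for n
    by (rule has_sum_finiteI[OF finite_compositions]) (simp add: sum_distrib_right)
  ultimately have "((\<lambda>n. (\<Sum>\<rho>\<in>compositions p n. g \<rho>) * z ^ n) has_sum ?S) UNIV"
    by (rule has_sum_SigmaD)
  from has_sum_imp_sums[OF this] show
    "(\<lambda>n. (\<Sum>\<rho>\<in>compositions p n. \<Sum>\<^sub>\<infinity>m\<in>A. T m * (\<Prod>i=1..p. a m i (\<rho> i))) * z ^ n) sums ?S"
    by (simp add: g_def)
qed

text \<open>The case in which the sums over \<open>k\<close> are bounded uniformly in \<open>m\<close>; it applies to \<open>sigma_b1\<close> and \<open>sigma_r\<close>.\<close>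

lemma power_series_family_sums_bounded:
  fixes T :: "'m \<Rightarrow> complex" and a :: "'m \<Rightarrow> nat \<Rightarrow> nat \<Rightarrow> complex"
  assumes r: "r > 0" and z: "norm z \<le> r" and T: "(\<lambda>m. norm (T m)) summable_on A"
    and a: "\<And>m i. i \<in> {1..p} \<Longrightarrow> (\<lambda>k. norm (a m i k) * r ^ k) summable_on UNIV"
    and B: "\<And>m i. i \<in> {1..p} \<Longrightarrow> (\<Sum>\<^sub>\<infinity>k. norm (a m i k) * r ^ k) \<le> B i"
  shows "(\<lambda>n. (\<Sum>\<rho>\<in>compositions p n. \<Sum>\<^sub>\<infinity>m\<in>A. T m * (\<Prod>i=1..p. a m i (\<rho> i))) * z ^ n) sums
      (\<Sum>\<^sub>\<infinity>m\<in>A. T m * (\<Prod>i=1..p. \<Sum>\<^sub>\<infinity>k. a m i k * z ^ k))"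
proof (rule power_series_family_sums[OF r a _ z])
  have nonneg: "0 \<le> (\<Sum>\<^sub>\<infinity>k. norm (a m i k) * r ^ k)" for m i using r by (intro infsum_nonneg) simp
  have "(\<lambda>m. norm (T m) * (\<Prod>i=1..p. B i)) summable_on A" by (rule summable_on_cmult_left[OF T])
  then show "(\<lambda>m. norm (T m) * (\<Prod>i=1..p. \<Sum>\<^sub>\<infinity>k. norm (a m i k) * r ^ k)) summable_on A"
    by (rule summable_on_comparison_test)
      (intro mult_left_mono mult_nonneg_nonneg prod_mono prod_nonneg conjI ballI nonneg B norm_ge_zero; assumption)+
qed

text \<open>The coefficients are determined by the sum in a neighbourhood of \<open>0\<close>.\<close>

lemma power_series_coeff_eq:
  fixes x y :: "nat \<Rightarrow> complex"
  assumes r: "r > 0" and "\<And>z. norm z \<le> r \<Longrightarrow> (\<lambda>n. x n * z ^ n) sums f z" "\<And>z. norm z \<le> r \<Longrightarrow> (\<lambda>n. y n * z ^ n) sums f z"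
  shows "x n = y n"
proof -
  have rad: "fps_conv_radius (Abs_fps w) > 0" if "\<And>z. norm z \<le> r \<Longrightarrow> (\<lambda>n. w n * z ^ n) sums f z" for w
  proof -
    have "norm (complex_of_real r) \<le> conv_radius w"
      using that[of "of_real r"] r by (intro conv_radius_geI) (auto simp: sums_iff)
    then show ?thesis using r unfolding fps_conv_radius_def by (simp add: less_le_trans[of 0 "ereal r"])
  qed
  have "eventually (\<lambda>z :: complex. norm z \<le> r) (nhds 0)"
    using eventually_nhds_ball[OF r, of 0] by eventually_elim (simp add: dist_norm)
  then have "eventually (\<lambda>z. eval_fps (Abs_fps x) z = eval_fps (Abs_fps y) z) (nhds 0)"
    by eventually_elim (use assms in \<open>auto simp: eval_fps_def sums_iff\<close>)
  then have "Abs_fps x = Abs_fps y" by (intro eval_fps_eqD rad assms)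
  then show ?thesis by (metis fps_nth_Abs_fps)
qed

lemma negative_binomial_sums:
  fixes x :: complex
  assumes x: "norm x < 1" and k: "k \<ge> 1"
  shows "(\<lambda>n. of_nat ((k + n - 1) choose n) * x ^ n) sums (1 / (1 - x) ^ k)"
proof -
  have "(\<lambda>n. ((- of_nat k) gchoose n) * (- x) ^ n) sums (1 + (- x)) powr (- of_nat k)"
    using x by (intro gen_binomial_complex) simp
  moreover have "((- of_nat k) gchoose n) * (- x) ^ n = of_nat ((k + n - 1) choose n) * x ^ n" for n
  proof -
    have "of_nat k + of_nat n - 1 = (of_nat (k + n - 1) :: complex)" using k by (simp add: of_nat_diff)
    then have "((- of_nat k) gchoose n) = (-1) ^ n * (of_nat ((k + n - 1) choose n) :: complex)"
      by (simp add: gbinomial_minus binomial_gbinomial)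
    moreover have "(- x) ^ n = (-1) ^ n * x ^ n" by (rule power_minus)
    ultimately have "((- of_nat k) gchoose n) * (- x) ^ n
        = ((-1) ^ n * (-1) ^ n) * (of_nat ((k + n - 1) choose n) * x ^ n)"
      by (simp only: mult_ac)
    then show ?thesis by simp
  qed
  moreover have "(1 + (- x)) powr (- of_nat k) = 1 / (1 - x) ^ k"
  proof -
    have "1 - x \<noteq> 0" using x by auto
    then show ?thesis by (simp add: powr_minus powr_nat divide_inverse)
  qed
  ultimately show ?thesis by simp
qed

lemma negative_binomial_has_sum:
  fixes w z :: complex
  assumes r: "norm z \<le> r" "r < norm w" and k: "k \<ge> 1"
  shows "((\<lambda>n. norm (of_nat ((k + n - 1) choose n) / w ^ n :: complex) * r ^ n) has_sum (1 / (1 - r / norm w) ^ k)) UNIV"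
    and "((\<lambda>n. of_nat ((k + n - 1) choose n) / w ^ n * z ^ n) has_sum (1 / (1 - z / w) ^ k)) UNIV"
proof -
  have r0: "0 \<le> r" using norm_ge_zero[of z] r by linarith
  have w: "norm w > 0" using r0 r by linarith
  have "norm (complex_of_real (r / norm w)) < 1" using r0 r w by (simp add: norm_divide)
  from negative_binomial_sums[OF this k]
  have "(\<lambda>n. complex_of_real (of_nat ((k + n - 1) choose n) * (r / norm w) ^ n)) sums complex_of_real (1 / (1 - r / norm w) ^ k)"
    by simp
  then have "(\<lambda>n. of_nat ((k + n - 1) choose n) * (r / norm w) ^ n) sums (1 / (1 - r / norm w) ^ k)"
    by (simp only: sums_of_real_iff)
  then have 1: "((\<lambda>n. of_nat ((k + n - 1) choose n) * (r / norm w) ^ n) has_sum (1 / (1 - r / norm w) ^ k)) UNIV"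
    using r0 by (intro sums_nonneg_imp_has_sum) auto
  have "norm (of_nat ((k + n - 1) choose n) / w ^ n :: complex) * r ^ n = of_nat ((k + n - 1) choose n) * (r / norm w) ^ n" for n
    by (simp add: norm_divide norm_power power_divide)
  with 1 show 2: "((\<lambda>n. norm (of_nat ((k + n - 1) choose n) / w ^ n :: complex) * r ^ n) has_sum (1 / (1 - r / norm w) ^ k)) UNIV"
    by simp
  have "norm (z / w) < 1" using r w by (simp add: norm_divide)
  from negative_binomial_sums[OF this k]
  have "(\<lambda>n. of_nat ((k + n - 1) choose n) / w ^ n * z ^ n) sums (1 / (1 - z / w) ^ k)"
    by (simp add: power_divide)
  moreover have "(\<lambda>n. norm (of_nat ((k + n - 1) choose n) / w ^ n * z ^ n)) summable_on UNIV"
    by (rule Infinite_Sum.abs_summable_on_comparison_test'[OF has_sum_imp_summable[OF 2]])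
      (unfold norm_mult[of "_ / _"] norm_power, use r in \<open>intro mult_left_mono power_mono; simp\<close>)
  ultimately show "((\<lambda>n. of_nat ((k + n - 1) choose n) / w ^ n * z ^ n) has_sum (1 / (1 - z / w) ^ k)) UNIV"
    by (intro norm_summable_imp_has_sum summable_on_imp_summable)
qed

section \<open>The generating function of the left-hand side of (i)\<close>

text \<open>A nonempty word of \<open>B\<^sup>0\<close> without its first letter \<open>x\<^sub>1\<close> and its last letter \<open>x\<^sub>-\<^sub>1\<close>.\<close>

definition core_word :: "word \<Rightarrow> word" where
  "core_word w = butlast (tl w)"

text \<open>The summand of \<open>Z\<close>, deformed by \<open>l\<close>; for \<open>l = 0\<close> it is the summand in \<open>Z_word\<close>.\<close>

definition Z_term :: "complex \<Rightarrow> complex \<Rightarrow> complex \<Rightarrow> index \<Rightarrow> (nat \<Rightarrow> nat) \<Rightarrow> complex" where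
  "Z_term a b l s m = pochhammer a (m 1) / fact (m 1) *
     (\<Prod>i=1..<length s. strict_factor b l (cc s i) (m i) / (of_nat (m i) + b) ^ kk s i) *
     (1 / (of_nat (m (length s)) + b) ^ (kk s (length s) - 1)) * tail_weight a l (m (length s))"

lemma decays_tail_weight:
  assumes a: "Re a > 0" and al: "Re (a - l) > 0"
  shows "decays (Re a) (tail_weight a l)"
proof -
  obtain c where c: "c > 0" "\<And>m. norm (of_nat m + a) \<le> c * (real m + Re (a - l))"
    using norm_add_of_nat_le[OF a al] by blast
  have "norm (tail_weight a l m) \<le> (c / Re a) * phi (Re a) m" for m
  proof -
    have "norm (of_nat m + a) \<le> c * norm (of_nat m + (a - l))"
      using order_trans[OF c(2) mult_left_mono[OF norm_add_of_nat_ge[OF al]]] c(1) by simp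
    moreover have "0 < norm (of_nat m + (a - l))" using of_nat_add_neq_0[OF al, of m] by simp
    ultimately have 1: "norm ((of_nat m + a) / (of_nat m + (a - l))) \<le> c" by (simp add: norm_divide divide_le_eq)
    have p: "pochhammer (Re a) (Suc m) > 0" by (rule pochhammer_pos[OF a])
    have 2: "norm (fact m / pochhammer a (Suc m)) \<le> fact m / pochhammer (Re a) (Suc m)"
      unfolding norm_divide norm_fact by (rule divide_left_mono[OF pochhammer_le_norm[OF a]])
        (use p pochhammer_le_norm[OF a, of "Suc m"] in \<open>auto intro!: mult_pos_pos\<close>)
    have "norm (tail_weight a l m) \<le> c * (fact m / pochhammer (Re a) (Suc m))"
      unfolding tail_weight_def norm_mult using c(1) by (intro mult_mono 1 2) auto
    then show ?thesis by (simp add: phi_def pochhammer_rec mult_ac)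
  qed
  then show ?thesis unfolding decays_def dominated_def by (intro exI allI)
qed

lemma Z_dom_cong:
  assumes "length s = length t" "\<And>i. i \<in> {1..<length s} \<Longrightarrow> cc s i = cc t i"
  shows "Z_dom s = Z_dom t"
  using assms by (auto simp: Z_dom_def)

lemma indices_dest:
  assumes "s \<in> indices" "s \<noteq> []"
  shows "length s > 0" "\<And>i. cc s i \<in> {0, 1}" "\<And>i. i \<in> {1..length s} \<Longrightarrow> kk s i \<ge> 1"
    "kk s (length s) \<ge> 2" "cc s 0 = 1" "cc s (length s) = 1"
proof -
  show "length s > 0" using assms by simp
  show 2: "kk s (length s) \<ge> 2" "cc s 0 = 1" using assms by (auto simp: indices_def)
  show "cc s i \<in> {0, 1}" for i
    using assms by (cases "i < length s") (auto simp: indices_def cc_def)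
  show "kk s i \<ge> 1" if "i \<in> {1..length s}" for i
    using assms 2 that by (cases "i = length s") (auto simp: indices_def)
qed (simp add: cc_def)

text \<open>The last letter \<open>x\<^sub>-\<^sub>1\<close> of the word has no counterpart in the summand, where the last exponent is \<open>k\<^sub>p - 1\<close>.
  Removing it gives a chain sum.\<close>

lemma Z_term_has_sum:
  assumes a: "Re a > 0" and b: "Re b > 0" and al: "Re (a - l) > 0" and bl: "Re (b - l) > 0"
    and s: "s \<in> indices" "s \<noteq> []"
  shows Z_term_abs_summable: "(\<lambda>m. norm (Z_term a b l s m)) summable_on Z_dom s"
    and Z_term_has_sum_pairing: "(Z_term a b l s has_sum pairing a b l (core_word (word_of s))) (Z_dom s)"
proof -
  interpret connector_params a b l using a b al bl by unfold_locales
  obtain u c k where u: "s = u @ [(c, k)]" using s(2) by (metis rev_exhaust surj_pair)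
  have st: "\<forall>(c, k)\<in>set s. c \<in> {0, 1} \<and> k \<ge> 1" "k \<ge> 2" "fst (hd s) = 1"
    using s by (auto simp: indices_iff u)
  define t where "t = u @ [(c, k - 1)]"
  have len: "length t = length s" by (simp add: t_def u)
  have cct: "cc t i = cc s i" for i by (simp add: cc_def t_def u nth_append)
  have kt: "kk t i = kk s i" if "i \<in> {1..<length s}" for i
    using that by (auto simp: kk_def t_def u nth_append)
  have kl: "kk t (length s) = kk s (length s) - 1" by (simp add: kk_def t_def u)
  have dom: "Z_dom t = Z_dom s" by (rule Z_dom_cong) (simp_all add: len cct)
  have pr: "proper t" using st by (auto simp: proper_def t_def u)
  have ws: "word_of s = word_of t @ [-1]"
  proof -
    obtain k' where "k = Suc (Suc k')" using st(2) by (metis Suc_le_D numeral_2_eq_2 Suc_le_mono)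
    then show ?thesis by (simp add: u t_def word_of_def zword_def replicate_append_same)
  qed
  have "word_of t \<noteq> []" by (simp add: t_def word_of_def zword_def)
  then have core_word: "core_word (word_of s) = tl (word_of t)" by (simp add: core_word_def ws)
  have eq: "pochhammer a (m 1) / fact (m 1) * chain_prod b l t m * tail_weight a l (m (length t)) = Z_term a b l s m" for m
  proof -
    have "(\<Prod>i=1..<length s. strict_factor b l (cc t i) (m i) / (of_nat (m i) + b) ^ kk t i)
        = (\<Prod>i=1..<length s. strict_factor b l (cc s i) (m i) / (of_nat (m i) + b) ^ kk s i)"
      by (intro prod.cong refl) (simp add: cct kt)
    then show ?thesis unfolding chain_prod_def Z_term_def len kl by (simp add: mult_ac)
  qed
  have w: "pochhammer a m / fact m / (of_nat m + b) = weight a b m" for m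
    by (simp add: weight_def)
  have "tame (Re a) (\<lambda>m. pochhammer a m / fact m / (of_nat m + b))"
    unfolding w using tame_weight by simp
  note main = chain_has_sum[OF b bl a this _ pr decays_tail_weight[OF a al]]
  show "(\<lambda>m. norm (Z_term a b l s m)) summable_on Z_dom s"
    using main unfolding eq w dom by (simp add: t_def)
  have "t \<noteq> []" by (simp add: t_def)
  from main[OF this] have "((\<lambda>m. Z_term a b l s m) has_sum
    (\<Sum>\<^sub>\<infinity>m. weight a b m * word_op b l (tl (word_of t)) (tail_weight a l) m)) (Z_dom s)"
    unfolding eq w dom by blast
  then show "(Z_term a b l s has_sum pairing a b l (core_word (word_of s))) (Z_dom s)"
    by (simp add: pairing_def core_word)
qed

lemma word_of_neq_Nil: "s \<noteq> [] \<Longrightarrow> word_of s \<noteq> []"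
  by (cases s) (auto simp: word_of_def zword_def)

lemma tail_weight_0: "Re a > 0 \<Longrightarrow> tail_weight a 0 m = fact m / pochhammer a (Suc m)"
  using of_nat_add_neq_0[of a m] by (simp add: tail_weight_def)

lemma strict_factor_0: "Re b > 0 \<Longrightarrow> strict_factor b 0 c m = 1"
  using of_nat_add_neq_0[of b m] by (simp add: strict_factor_def)

lemma Z_word_eq:
  assumes a: "Re a > 0" and b: "Re b > 0" and s: "s \<in> indices" "s \<noteq> []"
  shows "Z_word (word_of s) a b = (\<Sum>\<^sub>\<infinity>m\<in>Z_dom s. Z_term a b 0 s m)"
  using s
  by (simp add: Z_word_def index_of_word_of word_of_neq_Nil Let_def Z_term_def tail_weight_0[OF a]
      strict_factor_0[OF b] mult_ac)

lemma Z_sum_single: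
  assumes "finite R"
  shows "Z (\<Sum>r\<in>R. Poly_Mapping.single (f r) (g r)) a b = (\<Sum>r\<in>R. of_rat (g r) * Z_word (f r) a b)"
proof -
  have superset: "Z h a b = (\<Sum>w\<in>K. of_rat (Poly_Mapping.lookup h w) * Z_word w a b)"
    if "finite K" "Poly_Mapping.keys h \<subseteq> K" for h K
    unfolding Z_def using that by (intro sum.mono_neutral_left) (auto simp: in_keys_iff)
  have add: "Z (h + k) a b = Z h a b + Z k a b" for h k
  proof -
    let ?K = "Poly_Mapping.keys h \<union> Poly_Mapping.keys k"
    have "Z (h + k) a b = (\<Sum>w\<in>?K. of_rat (Poly_Mapping.lookup (h + k) w) * Z_word w a b)"
      by (intro superset Poly_Mapping.keys_add) simp
    also have "\<dots> = Z h a b + Z k a b"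
      by (subst (1 2) superset[of ?K]) (auto simp: lookup_add of_rat_add distrib_right sum.distrib)
    finally show ?thesis .
  qed
  have single: "Z (Poly_Mapping.single w q) a b = of_rat q * Z_word w a b" for w q
    by (subst superset[of "{w}"]) auto
  show ?thesis using assms
    by (induction R rule: finite_induct) (simp_all add: add single, simp add: Z_def)
qed

text \<open>The indices in the definitions of \<open>sigma_b1\<close> and, as \<open>r\<^sub>i = c\<^sub>i r\<^sub>i\<close> there, of \<open>sigma_r\<close>.\<close>

definition shift_index :: "index \<Rightarrow> (nat \<Rightarrow> nat) \<Rightarrow> index" where
  "shift_index s r = map (\<lambda>i. (cc s (i - 1), kk s i + r i)) [1..<length s + 1]"

lemma shift_index_indices: "s \<in> indices \<Longrightarrow> shift_index s r \<in> indices"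
  unfolding shift_index_def by (rule indices_add)

lemma length_shift_index [simp]: "length (shift_index s r) = length s"
  by (simp add: shift_index_def del: upt_Suc)

lemma nth_shift_index: "i < length s \<Longrightarrow> shift_index s r ! i = (cc s i, kk s (Suc i) + r (Suc i))"
  by (simp add: shift_index_def del: upt_Suc)

lemma cc_shift_index: "cc (shift_index s r) i = cc s i"
  by (simp add: cc_def nth_shift_index)

lemma kk_shift_index: "i \<in> {1..length s} \<Longrightarrow> kk (shift_index s r) i = kk s i + r i"
  by (cases i) (auto simp: kk_def[of "shift_index s r"] nth_shift_index)

lemma Z_term_shift_index:
  assumes s: "s \<in> indices" "s \<noteq> []"
  shows "Z_term a b l (shift_index s r) m = Z_term a b l s m * (\<Prod>i=1..length s. 1 / (of_nat (m i) + b) ^ r i)"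
proof -
  define p where "p = length s"
  have p: "p > 0" "kk s p \<ge> 2" using indices_dest[OF s] by (auto simp: p_def)
  have split: "(\<Prod>i=1..p. f i) = (\<Prod>i=1..<p. f i) * f p" for f :: "nat \<Rightarrow> complex"
    using p by (simp add: prod.last_plus mult.commute atLeastLessThanSuc_atLeastAtMost[symmetric])
  have 1: "(\<Prod>i=1..<p. strict_factor b l (cc s i) (m i) / (of_nat (m i) + b) ^ kk (shift_index s r) i)
    = (\<Prod>i=1..<p. strict_factor b l (cc s i) (m i) / (of_nat (m i) + b) ^ kk s i) * (\<Prod>i=1..<p. 1 / (of_nat (m i) + b) ^ r i)"
    unfolding prod.distrib[symmetric]
    by (intro prod.cong refl) (auto simp: kk_shift_index p_def power_add)
  have 2: "1 / (of_nat (m p) + b) ^ (kk (shift_index s r) p - 1)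
    = 1 / (of_nat (m p) + b) ^ (kk s p - 1) * (1 / (of_nat (m p) + b) ^ r p)"
  proof -
    have "kk (shift_index s r) p - 1 = kk s p - 1 + r p"
      by (subst kk_shift_index) (use p in \<open>auto simp: p_def Suc_le_eq\<close>)
    then show ?thesis by (simp add: power_add)
  qed
  show ?thesis unfolding Z_term_def length_shift_index cc_shift_index p_def[symmetric] 1 2 split
    by (simp only: mult_ac)
qed

lemma Z_word_shift_index:
  assumes a: "Re a > 0" and b: "Re b > 0" and s: "s \<in> indices" "s \<noteq> []"
  shows "Z_word (word_of (shift_index s r)) a b
    = (\<Sum>\<^sub>\<infinity>m\<in>Z_dom s. Z_term a b 0 s m * (\<Prod>i=1..length s. 1 / (of_nat (m i) + b) ^ r i))"
proof -
  have "shift_index s r \<noteq> []" using s(2) by (metis length_0_conv length_shift_index)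
  moreover have "Z_dom (shift_index s r) = Z_dom s" by (rule Z_dom_cong) (simp_all add: cc_shift_index)
  ultimately show ?thesis
    using Z_word_eq[OF a b shift_index_indices[OF s(1)], of r] by (simp add: Z_term_shift_index[OF s])
qed

lemma Z_sigma_b1:
  assumes a: "Re a > 0" and b: "Re b > 0" and s: "s \<in> indices" "s \<noteq> []"
  shows "Z (sigma_b1 n (word_of s)) a b = (\<Sum>\<rho>\<in>compositions (length s) n. \<Sum>\<^sub>\<infinity>m\<in>Z_dom s. Z_term a b 0 s m *
    (\<Prod>i=1..length s. of_nat (((if i = length s then kk s i - 1 else kk s i) + \<rho> i - 1) choose \<rho> i) / (of_nat (m i) + b) ^ \<rho> i))"
proof -
  define p where "p = length s"
  have p: "p > 0" "kk s p \<ge> 2" using indices_dest[OF s] by (auto simp: p_def)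
  define C where "C \<rho> i = ((if i = p then kk s i - 1 else kk s i) + \<rho> i - 1) choose \<rho> i" for \<rho> i
  have C: "(\<Prod>i=1..<p. (kk s i + \<rho> i - 1) choose \<rho> i) * ((kk s p + \<rho> p - 2) choose \<rho> p) = (\<Prod>i=1..p. C \<rho> i)" for \<rho>
  proof -
    have "{1..p} = insert p {1..<p}" using p by auto
    moreover have "kk s p - 1 + \<rho> p - 1 = kk s p + \<rho> p - 2" using p by simp
    ultimately show ?thesis by (simp add: C_def mult.commute)
  qed
  have "sigma_b1 n (word_of s) = (\<Sum>\<rho>\<in>compositions p n. Poly_Mapping.single (word_of (shift_index s \<rho>)) (of_nat (\<Prod>i=1..p. C \<rho> i)))"
    unfolding sigma_b1_def Let_def index_of_word_of[OF s(1)] if_not_P[OF word_of_neq_Nil[OF s(2)]]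
      shift_index_def compositions_def p_def[symmetric] C by (rule refl)
  then have "Z (sigma_b1 n (word_of s)) a b = (\<Sum>\<rho>\<in>compositions p n. of_rat (of_nat (\<Prod>i=1..p. C \<rho> i)) * Z_word (word_of (shift_index s \<rho>)) a b)"
    by (simp only: Z_sum_single[OF finite_compositions])
  also have "\<dots> = (\<Sum>\<rho>\<in>compositions p n. \<Sum>\<^sub>\<infinity>m\<in>Z_dom s. Z_term a b 0 s m * (\<Prod>i=1..p. of_nat (C \<rho> i) / (of_nat (m i) + b) ^ \<rho> i))"
  proof (rule sum.cong[OF refl])
    fix \<rho>
    have "of_rat (of_nat (\<Prod>i=1..p. C \<rho> i)) * Z_word (word_of (shift_index s \<rho>)) a b
      = (\<Sum>\<^sub>\<infinity>m\<in>Z_dom s. of_nat (\<Prod>i=1..p. C \<rho> i) * (Z_term a b 0 s m * (\<Prod>i=1..p. 1 / (of_nat (m i) + b) ^ \<rho> i)))"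
      unfolding Z_word_shift_index[OF a b s] infsum_cmult_right' p_def of_rat_of_nat_eq by (rule refl)
    also have "\<dots> = (\<Sum>\<^sub>\<infinity>m\<in>Z_dom s. Z_term a b 0 s m * (\<Prod>i=1..p. of_nat (C \<rho> i) / (of_nat (m i) + b) ^ \<rho> i))"
      by (intro infsum_cong) (simp add: prod_dividef)
    finally show "of_rat (of_nat (\<Prod>i=1..p. C \<rho> i)) * Z_word (word_of (shift_index s \<rho>)) a b = \<dots>" .
  qed
  finally show ?thesis by (simp add: C_def p_def)
qed

lemma norm_ratio_less:
  assumes "r < Re b" and z: "norm z \<le> r"
  shows "r < norm (of_nat m + b :: complex)" "norm (z / (of_nat m + b)) < 1" "of_nat m + b \<noteq> 0" "of_nat m + (b - z) \<noteq> 0"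
proof -
  have r: "0 \<le> r" using norm_ge_zero[of z] z by linarith
  have b: "Re b > 0" using assms(1) r by linarith
  show 1: "r < norm (of_nat m + b)" using norm_add_of_nat_ge[OF b, of m] assms(1) by simp
  show "norm (z / (of_nat m + b)) < 1" using 1 z r by (simp add: norm_divide divide_less_eq)
  show "of_nat m + b \<noteq> 0" by (rule of_nat_add_neq_0[OF b])
  show "of_nat m + (b - z) \<noteq> 0" using 1 z by (metis add_diff_eq diff_self eq_iff_diff_eq_0 less_le_not_le)
qed

text \<open>The binomial coefficients are those of \<open>(1 - z / (m\<^sub>i + b))\<^bsup>-k\<^esup>\<close>, so the series over the exponents
  replaces \<open>b\<close> by \<open>b - z\<close> in every denominator.\<close>

lemma Z_sigma_b1_sums:
  assumes a: "Re a > 0" and r: "r > 0" "r < Re b" and s: "s \<in> indices" "s \<noteq> []" and z: "norm z \<le> r"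
  shows "(\<lambda>n. Z (sigma_b1 n (word_of s)) a b * z ^ n) sums pairing a (b - z) 0 (core_word (word_of s))"
proof -
  have b: "Re b > 0" using r by simp
  define p where "p = length s"
  have p: "p > 0" "kk s p \<ge> 2" using indices_dest[OF s] by (auto simp: p_def)
  define K where "K i = (if i = p then kk s i - 1 else kk s i)" for i
  have K: "K i \<ge> 1" if "i \<in> {1..p}" for i using indices_dest(3)[OF s, of i] that p by (auto simp: K_def p_def)
  define A where "A m i k = (of_nat ((K i + k - 1) choose k) / (of_nat (m i) + b) ^ k :: complex)" for m :: "nat \<Rightarrow> nat" and i k
  have rn: "norm (complex_of_real r) \<le> r" using r by simp
  have A: "((\<lambda>k. norm (A m i k) * r ^ k) has_sum (1 / (1 - r / norm (of_nat (m i) + b)) ^ K i)) UNIV"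
    if "i \<in> {1..p}" for m i
    unfolding A_def by (rule negative_binomial_has_sum(1)[OF rn norm_ratio_less(1)[OF r(2) rn] K[OF that]])
  have "(\<lambda>n. (\<Sum>\<rho>\<in>compositions p n. \<Sum>\<^sub>\<infinity>m\<in>Z_dom s. Z_term a b 0 s m * (\<Prod>i=1..p. A m i (\<rho> i))) * z ^ n) sums
      (\<Sum>\<^sub>\<infinity>m\<in>Z_dom s. Z_term a b 0 s m * (\<Prod>i=1..p. \<Sum>\<^sub>\<infinity>k. A m i k * z ^ k))"
  proof (rule power_series_family_sums_bounded[OF r(1) z])
    show "(\<lambda>m. norm (Z_term a b 0 s m)) summable_on Z_dom s"
      using a b by (intro Z_term_abs_summable s) auto
    fix m i assume i: "i \<in> {1..p}"
    show "(\<lambda>k. norm (A m i k) * r ^ k) summable_on UNIV" using A[OF i] by (rule has_sum_imp_summable)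
    have n: "Re b \<le> norm (of_nat (m i) + b)" using norm_add_of_nat_ge[OF b, of "m i"] by simp
    have "r / norm (of_nat (m i) + b) \<le> r / Re b" using n r b by (intro divide_left_mono mult_pos_pos) auto
    moreover have "r / Re b < 1" using r b by simp
    ultimately show "(\<Sum>\<^sub>\<infinity>k. norm (A m i k) * r ^ k) \<le> 1 / (1 - r / Re b) ^ K i"
      unfolding infsumI[OF A[OF i]] by (intro divide_left_mono power_mono mult_pos_pos zero_less_power) auto
  qed
  moreover have "Z_term a b 0 s m * (\<Prod>i=1..p. \<Sum>\<^sub>\<infinity>k. A m i k * z ^ k) = Z_term a (b - z) 0 s m" for m
  proof -
    have bz: "Re (b - z) > 0" using r z abs_Re_le_cmod[of z] by simp
    have f: "1 / (of_nat j + b) ^ k * (1 / (1 - z / (of_nat j + b)) ^ k) = 1 / (of_nat j + (b - z)) ^ k" for j k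
    proof -
      have "(of_nat j + b) * (1 - z / (of_nat j + b)) = of_nat j + (b - z)"
        using norm_ratio_less(3)[OF r(2) z, of j] by (simp add: field_simps)
      then show ?thesis by (simp add: power_mult_distrib[symmetric])
    qed
    have "(\<Prod>i=1..p. \<Sum>\<^sub>\<infinity>k. A m i k * z ^ k) = (\<Prod>i=1..p. 1 / (1 - z / (of_nat (m i) + b)) ^ K i)"
      unfolding A_def
      by (intro prod.cong refl infsumI negative_binomial_has_sum(2)[OF z norm_ratio_less(1)[OF r(2) z] K])
    also have "\<dots> = (\<Prod>i=1..<p. 1 / (1 - z / (of_nat (m i) + b)) ^ kk s i) * (1 / (1 - z / (of_nat (m p) + b)) ^ (kk s p - 1))"
    proof -
      have "{1..p} = insert p {1..<p}" using p by auto
      then show ?thesis by (simp add: K_def mult.commute)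
    qed
    finally have "Z_term a b 0 s m * (\<Prod>i=1..p. \<Sum>\<^sub>\<infinity>k. A m i k * z ^ k) = pochhammer a (m 1) / fact (m 1) *
      ((\<Prod>i=1..<p. 1 / (of_nat (m i) + b) ^ kk s i) * (\<Prod>i=1..<p. 1 / (1 - z / (of_nat (m i) + b)) ^ kk s i)) *
      (1 / (of_nat (m p) + b) ^ (kk s p - 1) * (1 / (1 - z / (of_nat (m p) + b)) ^ (kk s p - 1))) * tail_weight a 0 (m p)"
      by (simp add: Z_term_def strict_factor_0[OF b] p_def mult_ac)
    also have "\<dots> = Z_term a (b - z) 0 s m"
      unfolding prod.distrib[symmetric] f by (simp add: Z_term_def strict_factor_0[OF bz] p_def)
    finally show ?thesis .
  qed
  moreover have "(\<Sum>\<^sub>\<infinity>m\<in>Z_dom s. Z_term a (b - z) 0 s m) = pairing a (b - z) 0 (core_word (word_of s))"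
    using a r z abs_Re_le_cmod[of z] by (intro infsumI Z_term_has_sum_pairing s) auto
  ultimately show ?thesis by (simp add: Z_sigma_b1[OF a b s] A_def K_def p_def)
qed

section \<open>The generating function in (ii)\<close>

text \<open>The weight of an exponent that is free for \<open>c = 1\<close> and pinned to \<open>0\<close> for \<open>c = 0\<close>.\<close>

definition optional_power :: "nat \<Rightarrow> complex \<Rightarrow> nat \<Rightarrow> complex" where
  "optional_power c w k = (if c = 1 \<or> k = 0 then 1 / w ^ k else 0)"

lemma optional_power_has_sum:
  assumes r: "norm z \<le> r" "r < norm w"
  shows "((\<lambda>k. norm (optional_power c w k) * r ^ k) has_sum (if c = 1 then 1 / (1 - r / norm w) else 1)) UNIV"
    and "((\<lambda>k. optional_power c w k * z ^ k) has_sum (if c = 1 then 1 / (1 - z / w) else 1)) UNIV"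
proof -
  have 0: "optional_power c w k = (if k = 0 then 1 else 0)" if "c \<noteq> 1" for k
    using that by (simp add: optional_power_def)
  have 1: "((\<lambda>k. if k = 0 then 1 else 0) has_sum (1 :: 'x :: {topological_comm_monoid_add, t2_space, one})) (UNIV :: nat set)"
    by (rule has_sum_finite_neutralI[of "{0}"]) auto
  have 2: "norm (optional_power c w k) * r ^ k = (if k = 0 then 1 else 0)" if "c \<noteq> 1" for k
    using 0[OF that] by simp
  have 3: "optional_power c w k * z ^ k = (if k = 0 then 1 else 0)" if "c \<noteq> 1" for k
    using 0[OF that] by simp
  show "((\<lambda>k. norm (optional_power c w k) * r ^ k) has_sum (if c = 1 then 1 / (1 - r / norm w) else 1)) UNIV"
    using negative_binomial_has_sum(1)[OF r, of 1] 1 2 by (cases "c = 1") (simp_all add: optional_power_def)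
  show "((\<lambda>k. optional_power c w k * z ^ k) has_sum (if c = 1 then 1 / (1 - z / w) else 1)) UNIV"
    using negative_binomial_has_sum(2)[OF r, of 1] 1 3 by (cases "c = 1") (simp_all add: optional_power_def)
qed

lemma Z_sigma_r:
  assumes a: "Re a > 0" and s: "s \<in> indices" "s \<noteq> []"
  shows "Z1 (sigma_r n (word_of s)) a = (\<Sum>\<rho>\<in>compositions (length s) n. \<Sum>\<^sub>\<infinity>m\<in>Z_dom s. Z_term a a 0 s m *
    (\<Prod>i=1..length s. optional_power (cc s i) (of_nat (m i) + a) (\<rho> i)))"
proof -
  define p where "p = length s"
  have p: "p > 0" "cc s p = 1" and cc01: "cc s i \<in> {0, 1}" for i using indices_dest[OF s] by (auto simp: p_def)
  define R where "R = {r. r \<in> {1..p} \<rightarrow>\<^sub>E UNIV \<and> (\<forall>i\<in>{1..<p}. cc s i = 0 \<longrightarrow> r i = 0) \<and>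
               (\<Sum>i=1..<p. cc s i * r i) + r p = n}"
  have split: "{1..p} = insert p {1..<p}" using p by auto
  have cr: "cc s i * r i = r i" if "\<forall>i\<in>{1..<p}. cc s i = 0 \<longrightarrow> r i = 0" "i \<in> {1..<p}" for r :: "nat \<Rightarrow> nat" and i
    using that cc01[of i] by auto
  have tot: "(\<Sum>i=1..<p. cc s i * r i) + r p = (\<Sum>i=1..p. r i)"
    if "\<forall>i\<in>{1..<p}. cc s i = 0 \<longrightarrow> r i = 0" for r
  proof -
    have "(\<Sum>i=1..<p. cc s i * r i) = (\<Sum>i=1..<p. r i)" by (intro sum.cong refl cr[OF that])
    then show ?thesis unfolding split by simp
  qed
  have R: "R = {r \<in> compositions p n. \<forall>i\<in>{1..<p}. cc s i = 0 \<longrightarrow> r i = 0}"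
    unfolding R_def compositions_def using tot by fastforce
  have fin: "finite R" unfolding R using finite_compositions by simp
  have "sigma_r n (word_of s) = (\<Sum>r\<in>R. Poly_Mapping.single
         (word_of (map (\<lambda>i. (cc s (i - 1), kk s i + cc s i * r i)) [1..<p] @ [(cc s (p - 1), kk s p + r p)])) 1)"
    unfolding sigma_r_def Let_def index_of_word_of[OF s(1)] if_not_P[OF word_of_neq_Nil[OF s(2)]] R_def p_def
    by (rule refl)
  also have "\<dots> = (\<Sum>r\<in>R. Poly_Mapping.single (word_of (shift_index s r)) 1)"
  proof (rule sum.cong[OF refl])
    fix r assume "r \<in> R"
    then have r: "\<forall>i\<in>{1..<p}. cc s i = 0 \<longrightarrow> r i = 0" by (simp add: R)
    have "[1..<p + 1] = [1..<p] @ [p]" using p by (simp add: Suc_le_eq)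
    then have "shift_index s r = map (\<lambda>i. (cc s (i - 1), kk s i + r i)) [1..<p] @ [(cc s (p - 1), kk s p + r p)]"
      by (simp only: shift_index_def p_def[symmetric] map_append list.map)
    also have "map (\<lambda>i. (cc s (i - 1), kk s i + r i)) [1..<p] = map (\<lambda>i. (cc s (i - 1), kk s i + cc s i * r i)) [1..<p]"
      by (rule map_cong[OF refl]) (simp add: cr[OF r])
    finally show "Poly_Mapping.single (word_of (map (\<lambda>i. (cc s (i - 1), kk s i + cc s i * r i)) [1..<p] @ [(cc s (p - 1), kk s p + r p)])) (1 :: rat)
       = Poly_Mapping.single (word_of (shift_index s r)) 1" by simp
  qed
  finally have "Z1 (sigma_r n (word_of s)) a = (\<Sum>r\<in>R. of_rat 1 * Z_word (word_of (shift_index s r)) a a)"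
    unfolding Z1_def by (simp only: Z_sum_single[OF fin])
  also have "\<dots> = (\<Sum>r\<in>R. \<Sum>\<^sub>\<infinity>m\<in>Z_dom s. Z_term a a 0 s m * (\<Prod>i=1..p. optional_power (cc s i) (of_nat (m i) + a) (r i)))"
  proof (rule sum.cong[OF refl])
    fix r assume "r \<in> R"
    then have "1 / (of_nat (m i) + a) ^ r i = optional_power (cc s i) (of_nat (m i) + a) (r i)" if "i \<in> {1..p}" for i m
      using that cc01[of i] p by (cases "i = p") (auto simp: R optional_power_def)
    then show "of_rat 1 * Z_word (word_of (shift_index s r)) a a
      = (\<Sum>\<^sub>\<infinity>m\<in>Z_dom s. Z_term a a 0 s m * (\<Prod>i=1..p. optional_power (cc s i) (of_nat (m i) + a) (r i)))"
      unfolding Z_word_shift_index[OF a a s] p_def[symmetric] by simp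
  qed
  also have "\<dots> = (\<Sum>r\<in>compositions p n. \<Sum>\<^sub>\<infinity>m\<in>Z_dom s. Z_term a a 0 s m * (\<Prod>i=1..p. optional_power (cc s i) (of_nat (m i) + a) (r i)))"
  proof (rule sum.mono_neutral_left[OF finite_compositions])
    show "R \<subseteq> compositions p n" by (auto simp: R)
    show "\<forall>r\<in>compositions p n - R. (\<Sum>\<^sub>\<infinity>m\<in>Z_dom s. Z_term a a 0 s m * (\<Prod>i=1..p. optional_power (cc s i) (of_nat (m i) + a) (r i))) = 0"
    proof
      fix r assume "r \<in> compositions p n - R"
      then obtain i where "i \<in> {1..<p}" "cc s i = 0" "r i \<noteq> 0" by (auto simp: R)
      then have "(\<Prod>i=1..p. optional_power (cc s i) (of_nat (m i) + a) (r i)) = 0" for m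
        by (intro prod_zero bexI[of _ i]) (auto simp: optional_power_def)
      then show "(\<Sum>\<^sub>\<infinity>m\<in>Z_dom s. Z_term a a 0 s m * (\<Prod>i=1..p. optional_power (cc s i) (of_nat (m i) + a) (r i))) = 0"
        by (simp only: mult_zero_right infsum_0_simp)
    qed
  qed
  finally show ?thesis by (simp add: p_def)
qed

text \<open>A geometric series at every variable followed by a strict inequality, the last one included; this is the
  deformation by \<open>l = z\<close>.\<close>

lemma Z_sigma_r_sums:
  assumes r: "r > 0" "r < Re a" and s: "s \<in> indices" "s \<noteq> []" and z: "norm z \<le> r"
  shows "(\<lambda>n. Z1 (sigma_r n (word_of s)) a * z ^ n) sums pairing a a z (core_word (word_of s))"
proof -
  have a: "Re a > 0" using r by simp
  have az: "Re (a - z) > 0" using r z abs_Re_le_cmod[of z] by simp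
  define p where "p = length s"
  have p: "p > 0" "cc s p = 1" using indices_dest[OF s] by (auto simp: p_def)
  define A where "A m i k = optional_power (cc s i) (of_nat (m i) + a) k" for m :: "nat \<Rightarrow> nat" and i k
  have rn: "norm (complex_of_real r) \<le> r" using r by simp
  have A: "((\<lambda>k. norm (A m i k) * r ^ k) has_sum (if cc s i = 1 then 1 / (1 - r / norm (of_nat (m i) + a)) else 1)) UNIV" for m i
    unfolding A_def by (rule optional_power_has_sum(1)[OF rn norm_ratio_less(1)[OF r(2) rn]])
  have "(\<lambda>n. (\<Sum>\<rho>\<in>compositions p n. \<Sum>\<^sub>\<infinity>m\<in>Z_dom s. Z_term a a 0 s m * (\<Prod>i=1..p. A m i (\<rho> i))) * z ^ n) sums
      (\<Sum>\<^sub>\<infinity>m\<in>Z_dom s. Z_term a a 0 s m * (\<Prod>i=1..p. \<Sum>\<^sub>\<infinity>k. A m i k * z ^ k))"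
  proof (rule power_series_family_sums_bounded[OF r(1) z])
    show "(\<lambda>m. norm (Z_term a a 0 s m)) summable_on Z_dom s"
      using a by (intro Z_term_abs_summable s) auto
    fix m i
    show "(\<lambda>k. norm (A m i k) * r ^ k) summable_on UNIV" using A by (rule has_sum_imp_summable)
    have n: "Re a \<le> norm (of_nat (m i) + a)" using norm_add_of_nat_ge[OF a, of "m i"] by simp
    have "r / norm (of_nat (m i) + a) \<le> r / Re a" using n r a by (intro divide_left_mono mult_pos_pos) auto
    moreover have "r / Re a < 1" using r a by simp
    moreover have "0 \<le> r / Re a" using r a by simp
    ultimately show "(\<Sum>\<^sub>\<infinity>k. norm (A m i k) * r ^ k) \<le> 1 / (1 - r / Re a)"
      unfolding infsumI[OF A] by (auto intro!: divide_left_mono mult_pos_pos)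
  qed
  moreover have "Z_term a a 0 s m * (\<Prod>i=1..p. \<Sum>\<^sub>\<infinity>k. A m i k * z ^ k) = Z_term a a z s m" for m
  proof -
    have f: "1 / (1 - z / (of_nat j + a)) = (of_nat j + a) / (of_nat j + (a - z))" for j
      using norm_ratio_less(3,4)[OF r(2) z, of j] by (simp add: field_simps)
    have "(\<Prod>i=1..p. \<Sum>\<^sub>\<infinity>k. A m i k * z ^ k) = (\<Prod>i=1..p. strict_factor a z (cc s i) (m i))"
    proof (intro prod.cong refl infsumI)
      fix i
      have "((\<lambda>k. A m i k * z ^ k) has_sum (if cc s i = 1 then 1 / (1 - z / (of_nat (m i) + a)) else 1)) UNIV"
        unfolding A_def by (rule optional_power_has_sum(2)[OF z norm_ratio_less(1)[OF r(2) z]])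
      then show "((\<lambda>k. A m i k * z ^ k) has_sum strict_factor a z (cc s i) (m i)) UNIV"
        unfolding strict_factor_def f .
    qed
    also have "\<dots> = (\<Prod>i=1..<p. strict_factor a z (cc s i) (m i)) * strict_factor a z 1 (m p)"
    proof -
      have "{1..p} = insert p {1..<p}" using p by auto
      then show ?thesis using p by (simp add: mult.commute)
    qed
    finally have "Z_term a a 0 s m * (\<Prod>i=1..p. \<Sum>\<^sub>\<infinity>k. A m i k * z ^ k) = pochhammer a (m 1) / fact (m 1) *
      ((\<Prod>i=1..<p. strict_factor a z (cc s i) (m i)) * (\<Prod>i=1..<p. 1 / (of_nat (m i) + a) ^ kk s i)) *
      (1 / (of_nat (m p) + a) ^ (kk s p - 1)) * (strict_factor a z 1 (m p) * tail_weight a 0 (m p))"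
      by (simp add: Z_term_def strict_factor_0[OF a] p_def mult_ac)
    also have "strict_factor a z 1 (m p) * tail_weight a 0 (m p) = tail_weight a z (m p)"
      by (simp add: strict_factor_def tail_weight_0[OF a] tail_weight_def)
    finally show ?thesis
      unfolding prod.distrib[symmetric] by (simp add: Z_term_def p_def)
  qed
  moreover have "(\<Sum>\<^sub>\<infinity>m\<in>Z_dom s. Z_term a a z s m) = pairing a a z (core_word (word_of s))"
    using a az by (intro infsumI Z_term_has_sum_pairing s) auto
  ultimately show ?thesis by (simp add: Z_sigma_r[OF a s] A_def p_def)
qed

lemma core_word_tau: "w \<noteq> [] \<Longrightarrow> core_word (tau w) = map uminus (rev (core_word w))"
  by (simp add: core_word_def tau_def butlast_append)

lemma core_word_letters:
  assumes "w \<in> B0" shows "set (core_word w) \<subseteq> {-1, 0, 1}"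
proof (cases "w = []")
  case False
  then have "set (core_word w) \<subseteq> set w" by (auto simp: core_word_def dest!: in_set_butlastD list.set_sel(2))
  then show ?thesis using assms False by (auto simp: B0_iff)
qed (simp add: core_word_def)

lemma sigma_r_tau:
  assumes v: "v \<in> B0" and a: "Re a > 0"
  shows "Z1 (sigma_r n v) a = Z1 (sigma_r n (tau v)) a"
proof (cases "v = []")
  case True
  then show ?thesis by (simp add: tau_def)
next
  case False
  then have tv: "tau v \<noteq> []" by (simp add: tau_def)
  obtain s where s: "s \<in> indices" "v = word_of s" using v by (auto simp: B0_def)
  obtain t where t: "t \<in> indices" "tau v = word_of t" using tau_B0[OF v] by (auto simp: B0_def)
  have ne: "s \<noteq> []" "t \<noteq> []" using s t False tv by (auto simp: word_of_def)
  have r: "Re a / 2 > 0" "Re a / 2 < Re a" using a by auto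
  show ?thesis
  proof (rule power_series_coeff_eq[OF r(1)])
    fix z :: complex assume z: "norm z \<le> Re a / 2"
    show "(\<lambda>n. Z1 (sigma_r n v) a * z ^ n) sums pairing a a z (core_word v)"
      using Z_sigma_r_sums[OF r s(1) ne(1) z] s by simp
    have "Re (a - z) > 0" using z a abs_Re_le_cmod[of z] by simp
    then have "pairing a a z (core_word v) = pairing a a z (core_word (tau v))"
      using pairing_duality_same[OF a _ core_word_letters[OF v]] core_word_tau[OF False] by simp
    then show "(\<lambda>n. Z1 (sigma_r n (tau v)) a * z ^ n) sums pairing a a z (core_word v)"
      using Z_sigma_r_sums[OF r t(1) ne(2) z] t by simp
  qed
qed

section \<open>Sums over weakly increasing chains\<close>

text \<open>With \<open>J\<close> the interval between \<open>m\<^bsub>i-1\<^esub>\<close> and \<open>m\<^sub>i\<close>, these are the admissible tuples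
  \<open>M\<^sup>(\<^sup>i\<^sup>)\<^sub>1 \<le> \<dots> \<le> M\<^sup>(\<^sup>i\<^sup>)\<^sub>k\<close>, in the encoding of \<open>Zstar_dom\<close>.\<close>

definition weak_chains :: "nat \<Rightarrow> nat set \<Rightarrow> (nat \<Rightarrow> nat) set" where
  "weak_chains k J = {f \<in> {1..k} \<rightarrow>\<^sub>E J. \<forall>j\<in>{1..<k}. f j \<le> f (j + 1)}"

text \<open>The complete homogeneous symmetric polynomial of degree \<open>k\<close> in the \<open>y j\<close> for \<open>j \<in> J\<close>.\<close>

definition hsym :: "(nat \<Rightarrow> 'a :: comm_ring_1) \<Rightarrow> nat set \<Rightarrow> nat \<Rightarrow> 'a" where
  "hsym y J k = (\<Sum>f\<in>weak_chains k J. \<Prod>j=1..k. y (f j))"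

lemma weak_chains_mono:
  fixes f :: "nat \<Rightarrow> nat"
  assumes f: "\<forall>j\<in>{1..<k}. f j \<le> f (j + 1)" and i: "1 \<le> i" and j: "i \<le> j" "j \<le> k"
  shows "f i \<le> f j"
  using j
proof (induction j rule: dec_induct)
  case (step j)
  then have "f j \<le> f (j + 1)" using f i by auto
  then show ?case using step by simp
qed simp

lemma finite_weak_chains: "finite J \<Longrightarrow> finite (weak_chains k J)"
  unfolding weak_chains_def by (rule finite_subset[of _ "{1..k} \<rightarrow>\<^sub>E J"]) (auto intro: finite_PiE)

lemma weak_chains_0: "weak_chains 0 J = {\<lambda>_. undefined}"
  by (auto simp: weak_chains_def)

lemma hsym_0 [simp]: "hsym y J 0 = 1"
  by (simp add: hsym_def weak_chains_0)

lemma weak_chains_Suc_empty: "weak_chains (Suc k) {} = {}"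
  by (auto simp: weak_chains_def PiE_eq_empty_iff)

text \<open>A chain whose last entry is not the largest element \<open>x\<close> avoids \<open>x\<close> altogether.\<close>

lemma weak_chains_Suc_insert:
  assumes x: "\<forall>j\<in>J. j < x"
  shows "weak_chains (Suc k) (insert x J) = weak_chains (Suc k) J \<union> (\<lambda>f. f(Suc k := x)) ` weak_chains k (insert x J)"
proof (intro equalityI subsetI)
  fix f assume "f \<in> weak_chains (Suc k) (insert x J)"
  then have f: "f \<in> {1..Suc k} \<rightarrow>\<^sub>E insert x J" and mono: "\<forall>j\<in>{1..<Suc k}. f j \<le> f (j + 1)"
    by (auto simp: weak_chains_def)
  show "f \<in> weak_chains (Suc k) J \<union> (\<lambda>f. f(Suc k := x)) ` weak_chains k (insert x J)"
  proof (cases "f (Suc k) = x")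
    case True
    have "f = (restrict f {1..k})(Suc k := x)"
      using f True by (auto simp: fun_eq_iff PiE_iff extensional_def)
    moreover have "restrict f {1..k} \<in> weak_chains k (insert x J)"
      using f mono by (auto simp: weak_chains_def PiE_iff)
    ultimately show ?thesis by blast
  next
    case False
    then have last: "f (Suc k) < x" using f x by (auto simp: PiE_iff)
    have "f j \<in> J" if j: "j \<in> {1..Suc k}" for j
    proof -
      have "f j \<le> f (Suc k)" by (rule weak_chains_mono[OF mono]) (use j in auto)
      then have "f j \<noteq> x" using last by simp
      then show ?thesis using f j by (auto simp: PiE_iff)
    qed
    then show ?thesis using f mono by (auto simp: weak_chains_def PiE_iff)
  qed
next
  fix f assume "f \<in> weak_chains (Suc k) J \<union> (\<lambda>f. f(Suc k := x)) ` weak_chains k (insert x J)"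
  then consider "f \<in> weak_chains (Suc k) J" | g where "g \<in> weak_chains k (insert x J)" "f = g(Suc k := x)" by auto
  then show "f \<in> weak_chains (Suc k) (insert x J)"
  proof cases
    case 1
    then show ?thesis by (auto simp: weak_chains_def PiE_iff)
  next
    case 2
    have "g k \<le> x" if "k \<ge> 1"
    proof -
      have "g k \<in> insert x J" using 2(1) that by (auto simp: weak_chains_def PiE_iff)
      then show ?thesis using x by (auto intro: less_imp_le)
    qed
    then have "(g(Suc k := x)) j \<le> (g(Suc k := x)) (j + 1)" if "j \<in> {1..<Suc k}" for j
      using 2(1) that by (cases "j = k") (auto simp: weak_chains_def)
    then show ?thesis using 2 by (auto simp: weak_chains_def PiE_iff extensional_def)
  qed
qed

lemma hsym_Suc_insert:
  assumes J: "finite J" and x: "\<forall>j\<in>J. j < x"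
  shows "hsym y (insert x J) (Suc k) = hsym y J (Suc k) + y x * hsym y (insert x J) k"
proof -
  have disj: "weak_chains (Suc k) J \<inter> (\<lambda>f. f(Suc k := x)) ` weak_chains k (insert x J) = {}"
  proof -
    have "f (Suc k) \<noteq> x" if "f \<in> weak_chains (Suc k) J" for f
    proof -
      have "f (Suc k) \<in> J" using that by (auto simp: weak_chains_def PiE_iff)
      then show ?thesis using x by blast
    qed
    then show ?thesis by (metis (no_types, lifting) disjoint_iff fun_upd_same imageE)
  qed
  have inj: "inj_on (\<lambda>f. f(Suc k := x)) (weak_chains k (insert x J))"
  proof (rule inj_onI)
    fix f g assume f: "f \<in> weak_chains k (insert x J)" and g: "g \<in> weak_chains k (insert x J)"
      and eq: "f(Suc k := x) = g(Suc k := x)"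
    have "f j = g j" for j
      using f g fun_cong[OF eq, of j] by (cases "j = Suc k") (auto simp: weak_chains_def PiE_iff extensional_def)
    then show "f = g" by blast
  qed
  have "hsym y (insert x J) (Suc k) = hsym y J (Suc k) +
      (\<Sum>f\<in>(\<lambda>f. f(Suc k := x)) ` weak_chains k (insert x J). \<Prod>j=1..Suc k. y (f j))"
    unfolding hsym_def weak_chains_Suc_insert[OF x]
    by (rule sum.union_disjoint[OF finite_weak_chains[OF J] _ disj]) (use finite_weak_chains J in auto)
  also have "(\<Sum>f\<in>(\<lambda>f. f(Suc k := x)) ` weak_chains k (insert x J). \<Prod>j=1..Suc k. y (f j))
      = (\<Sum>f\<in>weak_chains k (insert x J). y x * (\<Prod>j=1..k. y (f j)))"
    unfolding sum.reindex[OF inj] o_def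
  proof (rule sum.cong[OF refl])
    fix f
    have "(\<Prod>j=1..k. y ((f(Suc k := x)) j)) = (\<Prod>j=1..k. y (f j))" by (rule prod.cong) auto
    then show "(\<Prod>j=1..Suc k. y ((f(Suc k := x)) j)) = y x * (\<Prod>j=1..k. y (f j))"
      by (simp add: mult.commute)
  qed
  finally show ?thesis by (simp add: hsym_def sum_distrib_left)
qed

lemma hsym_insert:
  assumes J: "finite J" and x: "\<forall>j\<in>J. j < x"
  shows "hsym y (insert x J) k = (\<Sum>i\<le>k. y x ^ i * hsym y J (k - i))"
proof (induction k)
  case (Suc k)
  have "(\<Sum>i\<le>Suc k. y x ^ i * hsym y J (Suc k - i)) = hsym y J (Suc k) + y x * (\<Sum>i\<le>k. y x ^ i * hsym y J (k - i))"
    unfolding sum.atMost_Suc_shift by (simp add: sum_distrib_left mult.assoc)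
  then show ?case by (simp only: hsym_Suc_insert[OF J x] Suc)
qed simp

text \<open>Adjoining a new largest element to \<open>J\<close> multiplies the generating function by a geometric series.\<close>

lemma hsym_sums:
  fixes y :: "nat \<Rightarrow> 'a :: {real_normed_field, banach}"
  assumes "finite J" and "\<And>j. j \<in> J \<Longrightarrow> norm (y j * z) < 1"
  shows "summable (\<lambda>k. norm (hsym y J k * z ^ k)) \<and> (\<lambda>k. hsym y J k * z ^ k) sums (\<Prod>j\<in>J. 1 / (1 - y j * z))"
  using assms
proof (induction J rule: finite_linorder_max_induct)
  case empty
  have 0: "hsym y {} k * z ^ k = (if k = 0 then 1 else 0)" for k
    by (cases k) (simp_all add: hsym_def[of _ _ "Suc _"] weak_chains_Suc_empty)
  have "summable (\<lambda>k. norm (if k = 0 then 1 else 0 :: 'a))"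
    by (rule summable_finite[of "{0}"]) auto
  moreover have "(\<lambda>k. if k = 0 then 1 else 0 :: 'a) sums 1" using sums_single[of 0 "\<lambda>_. 1 :: 'a"] by simp
  ultimately show ?case by (simp add: 0)
next
  case (insert x J)
  define u where "u k = (y x * z) ^ k" for k
  define v where "v k = hsym y J k * z ^ k" for k
  have IH: "summable (\<lambda>k. norm (v k))" "v sums (\<Prod>j\<in>J. 1 / (1 - y j * z))"
    using insert.IH insert.prems by (auto simp: v_def[abs_def])
  have n: "norm (y x * z) < 1" using insert.prems by simp
  have u: "summable (\<lambda>k. norm (u k))" "u sums (1 / (1 - y x * z))"
    using n geometric_sums[OF n] by (simp_all add: u_def[abs_def] norm_power summable_geometric)
  have eq: "hsym y (insert x J) k * z ^ k = (\<Sum>i\<le>k. u i * v (k - i))" for k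
  proof -
    have "z ^ k = z ^ i * z ^ (k - i)" if "i \<le> k" for i using that by (simp add: power_add[symmetric])
    then have "y x ^ i * hsym y J (k - i) * z ^ k = u i * v (k - i)" if "i \<le> k" for i
      using that by (simp add: u_def v_def power_mult_distrib mult_ac)
    then show ?thesis
      using insert.hyps by (simp add: hsym_insert sum_distrib_right)
  qed
  have "summable (\<lambda>k. norm (\<Sum>i\<le>k. u i * v (k - i)))"
  proof (rule summable_comparison_test')
    show "summable (\<lambda>k. \<Sum>i\<le>k. norm (u i) * norm (v (k - i)))"
      using u IH by (intro summable_Cauchy_product) simp_all
    show "norm (norm (\<Sum>i\<le>k. u i * v (k - i))) \<le> (\<Sum>i\<le>k. norm (u i) * norm (v (k - i)))" for k
      by (simp add: sum_norm_le norm_mult)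
  qed
  moreover have "(\<lambda>k. \<Sum>i\<le>k. u i * v (k - i)) sums (1 / (1 - y x * z) * (\<Prod>j\<in>J. 1 / (1 - y j * z)))"
    using Cauchy_product_sums[OF u(1) IH(1)] u(2) IH(2) by (simp add: sums_iff)
  moreover have "x \<notin> J" using insert.hyps by auto
  ultimately show ?case using insert.hyps by (simp add: eq)
qed

text \<open>The range of the variables \<open>M\<^sup>(\<^sup>i\<^sup>)\<^sub>j\<close>.\<close>

definition gap :: "index \<Rightarrow> (nat \<Rightarrow> nat) \<Rightarrow> nat \<Rightarrow> nat set" where
  "gap s m i = {j. ltc (cc s (i - 1)) (m (i - 1)) j \<and> ltc (1 - cc s i) j (m i)}"

lemma finite_gap: "finite (gap s m i)"
  by (rule finite_subset[of _ "{..m i}"]) (auto simp: gap_def ltc_def split: if_splits)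

lemma chain_in_gap_iff:
  assumes c: "c \<in> {0, 1}" "c' \<in> {0, 1}" and k: "k > 0" and f: "f \<in> {1..k} \<rightarrow>\<^sub>E UNIV"
  shows "(ltc c a (f 1) \<and> (\<forall>j\<in>{1..<k}. f j \<le> f (j + 1)) \<and> ltc (1 - c') (f k) b) \<longleftrightarrow>
     ltc c a b \<and> f \<in> weak_chains k {j. ltc c a j \<and> ltc (1 - c') j b}" (is "?L \<longleftrightarrow> ?R")
proof
  assume L: ?L
  then have mono: "\<forall>j\<in>{1..<k}. f j \<le> f (j + 1)" by blast
  have "ltc c a (f j) \<and> ltc (1 - c') (f j) b" if "j \<in> {1..k}" for j
  proof -
    have "f 1 \<le> f j" "f j \<le> f k" using that by (auto intro!: weak_chains_mono[OF mono])
    then show ?thesis using L c by (auto simp: ltc_def)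
  qed
  moreover have "ltc c a b"
  proof -
    have "f 1 \<le> f k" using k by (intro weak_chains_mono[OF mono]) auto
    then show ?thesis using L c by (auto simp: ltc_def)
  qed
  ultimately show ?R using f mono by (auto simp: weak_chains_def PiE_iff)
next
  assume R: ?R
  then show ?L using k by (auto simp: weak_chains_def PiE_iff)
qed

text \<open>The inequalities between the \<open>m\<^sub>i\<close> themselves are implied whenever there is a variable between them, so they
  can be separated from the conditions on the \<open>M\<^sup>(\<^sup>i\<^sup>)\<^sub>j\<close>.\<close>

lemma Zstar_dom_eq:
  assumes c: "\<And>i. cc s i \<in> {0, 1}"
  shows "Zstar_dom r s = (SIGMA m:Z_dom s. \<Pi>\<^sub>E i\<in>{2..length s}. weak_chains (r i) (gap s m i))"
proof -
  define q where "q = length s"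
  have key: "(if r i = 0 then ltc (cc s (i - 1)) (m (i - 1)) (m i)
        else ltc (cc s (i - 1)) (m (i - 1)) (M i 1) \<and> (\<forall>j\<in>{1..<r i}. M i j \<le> M i (j + 1)) \<and> ltc (1 - cc s i) (M i (r i)) (m i))
      \<longleftrightarrow> ltc (cc s (i - 1)) (m (i - 1)) (m i) \<and> M i \<in> weak_chains (r i) (gap s m i)"
    if "M i \<in> {1..r i} \<rightarrow>\<^sub>E UNIV" for m M i
  proof (cases "r i = 0")
    case True
    then have "M i = (\<lambda>_. undefined)" using that by simp
    then show ?thesis using True by (simp add: weak_chains_0)
  next
    case False
    then show ?thesis using chain_in_gap_iff[OF c c _ that] by (simp add: gap_def)
  qed
  have dom: "m \<in> Z_dom s \<longleftrightarrow> m \<in> {1..q} \<rightarrow>\<^sub>E UNIV \<and> (\<forall>i\<in>{2..q}. ltc (cc s (i - 1)) (m (i - 1)) (m i))" for m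
  proof -
    have "(\<forall>i\<in>{1..<q}. ltc (cc s i) (m i) (m (i + 1))) \<longleftrightarrow> (\<forall>i\<in>{2..q}. ltc (cc s (i - 1)) (m (i - 1)) (m i))"
    proof safe
      fix i assume 1: "\<forall>i\<in>{1..<q}. ltc (cc s i) (m i) (m (i + 1))" and i: "i \<in> {2..q}"
      then have "i - 1 \<in> {1..<q}" "i - 1 + 1 = i" by auto
      then show "ltc (cc s (i - 1)) (m (i - 1)) (m i)" using 1 by metis
    next
      fix i assume 1: "\<forall>i\<in>{2..q}. ltc (cc s (i - 1)) (m (i - 1)) (m i)" and i: "i \<in> {1..<q}"
      then have "i + 1 \<in> {2..q}" by auto
      then show "ltc (cc s i) (m i) (m (i + 1))" using 1 by fastforce
    qed
    then show ?thesis by (simp add: Z_dom_def q_def)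
  qed
  have "(m, M) \<in> Zstar_dom r s \<longleftrightarrow> (m, M) \<in> (SIGMA m:Z_dom s. \<Pi>\<^sub>E i\<in>{2..q}. weak_chains (r i) (gap s m i))" for m M
  proof -
    have "(m, M) \<in> Zstar_dom r s \<longleftrightarrow> m \<in> {1..q} \<rightarrow>\<^sub>E UNIV \<and> M \<in> (\<Pi>\<^sub>E i\<in>{2..q}. {1..r i} \<rightarrow>\<^sub>E UNIV) \<and>
       (\<forall>i\<in>{2..q}. ltc (cc s (i - 1)) (m (i - 1)) (m i) \<and> M i \<in> weak_chains (r i) (gap s m i))"
      unfolding Zstar_dom_def mem_Collect_eq prod.case q_def
      by (intro conj_cong refl ball_cong key) (auto simp: PiE_iff)
    also have "\<dots> \<longleftrightarrow> m \<in> Z_dom s \<and> M \<in> (\<Pi>\<^sub>E i\<in>{2..q}. weak_chains (r i) (gap s m i))"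
      unfolding dom by (auto simp: PiE_iff weak_chains_def)
    finally show ?thesis by simp
  qed
  then show ?thesis unfolding q_def by (auto simp del: mem_Sigma_iff)
qed

lemma Z_dom_increasing:
  assumes "m \<in> Z_dom s" "1 \<le> i" "i \<le> j" "j \<le> length s"
  shows "m i \<le> m j"
proof (rule weak_chains_mono[of "length s" m])
  have "ltc (cc s i) (m i) (m (i + 1))" if "i \<in> {1..<length s}" for i
    using assms(1) that by (simp add: Z_dom_def)
  then show "\<forall>i\<in>{1..<length s}. m i \<le> m (i + 1)" by (force simp: ltc_def split: if_splits)
qed (use assms in auto)

text \<open>The gaps are consecutive intervals: the value \<open>m\<^sub>i\<close> belongs to the gap before it if \<open>c\<^sub>i = 1\<close> and to
  the gap after it if \<open>c\<^sub>i = 0\<close>. The first factor stands for \<open>m\<^sub>1\<close>, which has no gap before it, and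
  \<open>m\<^sub>q\<close> is covered because of \<open>c\<^sub>q = 1\<close>.\<close>

lemma prod_gaps:
  fixes f :: "nat \<Rightarrow> 'a :: comm_monoid_mult"
  assumes c: "\<And>i. cc s i \<in> {0, 1}" and m: "m \<in> Z_dom s" and s: "s \<noteq> []"
  shows "(if cc s 1 = 1 then f (m 1) else 1) * (\<Prod>i=2..length s. \<Prod>j\<in>gap s m i. f j) = (\<Prod>j=m 1..m (length s). f j)"
proof -
  \<comment> \<open>The part of the interval that is covered by the gaps up to \<open>i\<close>.\<close>
  define U where "U i = {j. m 1 \<le> j \<and> ltc (1 - cc s i) j (m i)}" for i
  have "(if cc s 1 = 1 then f (m 1) else 1) * (\<Prod>i=2..p. \<Prod>j\<in>gap s m i. f j) = (\<Prod>j\<in>U p. f j)"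
    if "1 \<le> p" "p \<le> length s" for p
    using that
  proof (induction p rule: dec_induct)
    case base
    have "U 1 = (if cc s 1 = 1 then {m 1} else {})" using c[of 1] by (auto simp: U_def ltc_def)
    then show ?case by simp
  next
    case (step p)
    have p: "1 \<le> p" "p < length s" using step by auto
    have lt: "ltc (cc s p) (m p) (m (p + 1))" using m p by (simp add: Z_dom_def)
    have le: "m 1 \<le> m p" by (rule Z_dom_increasing[OF m]) (use p in auto)
    have "U (Suc p) = U p \<union> gap s m (Suc p)" "U p \<inter> gap s m (Suc p) = {}"
      using c[of p] c[of "Suc p"] lt le by (auto simp: U_def gap_def ltc_def split: if_splits)
    moreover have "finite (U p)"
      by (rule finite_subset[of _ "{..m p}"]) (auto simp: U_def ltc_def split: if_splits)
    ultimately have "(\<Prod>j\<in>U (Suc p). f j) = (\<Prod>j\<in>U p. f j) * (\<Prod>j\<in>gap s m (Suc p). f j)"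
      using finite_gap by (simp add: prod.union_disjoint)
    moreover have "{2..Suc p} = insert (Suc p) {2..p}" using p by auto
    ultimately show ?case using step by (simp add: mult_ac)
  qed
  moreover have "U (length s) = {m 1..m (length s)}" by (auto simp: U_def ltc_def cc_def)
  ultimately show ?thesis using s by (simp add: Suc_le_eq)
qed

text \<open>The part of the summand of \<open>Z\<close>, for \<open>l = 0\<close>, that does not depend on the first parameter.\<close>

definition Z_rest :: "complex \<Rightarrow> index \<Rightarrow> (nat \<Rightarrow> nat) \<Rightarrow> complex" where
  "Z_rest b s m = fact (m (length s)) / fact (m 1) * (\<Prod>i=1..<length s. 1 / (of_nat (m i) + b) ^ kk s i) *
     (1 / (of_nat (m (length s)) + b) ^ (kk s (length s) - 1))"

lemma Z_term_eq_Z_rest: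
  assumes a: "Re a > 0" and b: "Re b > 0" and m: "m \<in> Z_dom s" and s: "s \<noteq> []"
  shows "Z_term a b 0 s m = Z_rest b s m * (\<Prod>j=m 1..m (length s). 1 / (of_nat j + a))"
proof -
  let ?q = "length s"
  have le: "m 1 \<le> m ?q" by (rule Z_dom_increasing[OF m]) (use s in \<open>auto simp: Suc_le_eq\<close>)
  have "pochhammer a (Suc (m ?q)) = (\<Prod>j=0..m ?q. of_nat j + a)"
    unfolding pochhammer_Suc_prod by (simp add: add.commute)
  also have "{0..m ?q} = {0..<m 1} \<union> {m 1..m ?q}" using le by auto
  also have "(\<Prod>j\<in>\<dots>. of_nat j + a) = (\<Prod>j=0..<m 1. of_nat j + a) * (\<Prod>j=m 1..m ?q. of_nat j + a)"
    by (rule prod.union_disjoint) auto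
  also have "(\<Prod>j=0..<m 1. of_nat j + a) = pochhammer a (m 1)"
    by (simp add: pochhammer_prod add.commute)
  finally have "pochhammer a (m 1) / pochhammer a (Suc (m ?q)) = (\<Prod>j=m 1..m ?q. 1 / (of_nat j + a))"
    using pochhammer_neq_0[OF a, of "m 1"] by (simp add: prod_dividef)
  then have "(\<Prod>j=m 1..m ?q. 1 / (of_nat j + a)) = pochhammer a (m 1) / pochhammer a (Suc (m ?q))" by simp
  then show ?thesis
    by (simp only: Z_term_def Z_rest_def strict_factor_0[OF b] tail_weight_0[OF a]) simp
qed

section \<open>The generating function of the right-hand side of (i)\<close>

text \<open>What the sum over the \<open>M\<^sup>(\<^sup>i\<^sup>)\<^sub>j\<close> contributes for \<open>r\<^sub>i = k\<close>; for \<open>i = 1\<close>, the power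
  of \<open>1 / (m\<^sub>1 + \<beta>)\<close>, whose exponent is pinned to \<open>0\<close> unless \<open>c\<^sub>1 = 1\<close>.\<close>

definition star_coeff :: "complex \<Rightarrow> index \<Rightarrow> (nat \<Rightarrow> nat) \<Rightarrow> nat \<Rightarrow> nat \<Rightarrow> complex" where
  "star_coeff b s m i k =
     (if i = 1 then optional_power (cc s 1) (of_nat (m 1) + b) k
      else hsym (\<lambda>j. 1 / (of_nat j + b)) (gap s m i) k)"

text \<open>The same with absolute values inside the sum, which is what absolute convergence of the series \<open>Zstar\<close> in
  all its variables requires.\<close>

definition star_coeff_abs :: "complex \<Rightarrow> index \<Rightarrow> (nat \<Rightarrow> nat) \<Rightarrow> nat \<Rightarrow> nat \<Rightarrow> real" where
  "star_coeff_abs b s m i k =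
     (if i = 1 then norm (optional_power (cc s 1) (of_nat (m 1) + b) k)
      else hsym (\<lambda>j. 1 / norm (of_nat j + b)) (gap s m i) k)"

lemma star_coeff_abs_nonneg: "0 \<le> star_coeff_abs b s m i k"
  by (auto simp: star_coeff_abs_def hsym_def intro!: sum_nonneg prod_nonneg)

lemma norm_star_coeff_le: "norm (star_coeff b s m i k) \<le> star_coeff_abs b s m i k"
  by (auto simp: star_coeff_def star_coeff_abs_def hsym_def prod_norm[symmetric] norm_divide intro!: sum_norm_le)

lemma star_coeff_has_sum:
  assumes r: "r < Re b" and z: "norm z \<le> r"
  shows "((\<lambda>k. star_coeff b s m i k * z ^ k) has_sum
     (if i = 1 then (if cc s 1 = 1 then 1 / (1 - z / (of_nat (m 1) + b)) else 1)
      else (\<Prod>j\<in>gap s m i. 1 / (1 - z / (of_nat j + b))))) UNIV"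
    and "((\<lambda>k. star_coeff_abs b s m i k * r ^ k) has_sum
     (if i = 1 then (if cc s 1 = 1 then 1 / (1 - r / norm (of_nat (m 1) + b)) else 1)
      else (\<Prod>j\<in>gap s m i. 1 / (1 - r / norm (of_nat j + b))))) UNIV"
proof -
  have r0: "0 \<le> r" using norm_ge_zero[of z] z by linarith
  note nz = norm_ratio_less[OF r z]
  have n1: "norm (1 / (of_nat j + b) * z) < 1" for j using nz(2)[of j] by (simp add: norm_divide norm_mult)
  have n2: "norm (1 / norm (of_nat j + b) * r) < 1" for j using nz(1)[of j] r0 by (simp add: divide_less_eq)
  note h1 = hsym_sums[of "gap s m i" "\<lambda>j. 1 / (of_nat j + b)" z, OF finite_gap n1]
  note h2 = hsym_sums[of "gap s m i" "\<lambda>j. 1 / norm (of_nat j + b)" r, OF finite_gap n2]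
  show "((\<lambda>k. star_coeff b s m i k * z ^ k) has_sum
     (if i = 1 then (if cc s 1 = 1 then 1 / (1 - z / (of_nat (m 1) + b)) else 1)
      else (\<Prod>j\<in>gap s m i. 1 / (1 - z / (of_nat j + b))))) UNIV"
  proof (cases "i = 1")
    case True
    show ?thesis
      using optional_power_has_sum(2)[OF z nz(1)[of "m 1"], of "cc s 1"] by (simp add: star_coeff_def True del: One_nat_def)
  next
    case False
    then show ?thesis 
      using norm_summable_imp_has_sum[OF conjunct1[OF h1] conjunct2[OF h1]] by (simp add: star_coeff_def)
  qed
  show "((\<lambda>k. star_coeff_abs b s m i k * r ^ k) has_sum
     (if i = 1 then (if cc s 1 = 1 then 1 / (1 - r / norm (of_nat (m 1) + b)) else 1)
      else (\<Prod>j\<in>gap s m i. 1 / (1 - r / norm (of_nat j + b))))) UNIV"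
  proof (cases "i = 1")
    case True
    show ?thesis
      using optional_power_has_sum(1)[OF z nz(1)[of "m 1"], of "cc s 1"] by (simp add: star_coeff_abs_def True del: One_nat_def)
  next
    case False
    then show ?thesis 
      using norm_summable_imp_has_sum[OF conjunct1[OF h2] conjunct2[OF h2]] by (simp add: star_coeff_abs_def)
  qed
qed

lemma prod_star_coeff:
  fixes g :: "nat \<Rightarrow> 'a :: comm_monoid_mult"
  assumes s: "s \<in> indices" "s \<noteq> []" and m: "m \<in> Z_dom s"
  shows "(\<Prod>i=1..length s. if i = 1 then (if cc s 1 = 1 then g (m 1) else 1) else (\<Prod>j\<in>gap s m i. g j))
    = (\<Prod>j=m 1..m (length s). g j)"
proof -
  have "{1..length s} = insert 1 {2..length s}" using indices_dest(1)[OF s] by (auto simp: Suc_le_eq)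
  then have "(\<Prod>i=1..length s. if i = 1 then (if cc s 1 = 1 then g (m 1) else 1) else (\<Prod>j\<in>gap s m i. g j))
    = (if cc s 1 = 1 then g (m 1) else 1) * (\<Prod>i=2..length s. if i = 1 then (if cc s 1 = 1 then g (m 1) else 1) else (\<Prod>j\<in>gap s m i. g j))"
    by (simp only:) (subst prod.insert, auto)
  also have "(\<Prod>i=2..length s. if i = 1 then (if cc s 1 = 1 then g (m 1) else 1) else (\<Prod>j\<in>gap s m i. g j))
    = (\<Prod>i=2..length s. \<Prod>j\<in>gap s m i. g j)" by (rule prod.cong) auto
  finally show ?thesis using prod_gaps[OF indices_dest(2)[OF s] m s(2), of g] by simp
qed

text \<open>With \<open>\<bar>j + b\<bar> - r \<ge> j + Re b - r\<close>, the majorant is dominated by the absolute values of the summands of a series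
  \<open>Z\<close> with the first parameter \<open>Re b - r > 0\<close>.\<close>

lemma star_abs_summable:
  assumes a: "Re a > 0" and r: "r > 0" "r < Re b" and s: "s \<in> indices" "s \<noteq> []"
  shows "(\<lambda>m. norm (Z_term b a 0 s m) * (\<Prod>i=1..length s. \<Sum>\<^sub>\<infinity>k. star_coeff_abs b s m i k * r ^ k)) summable_on Z_dom s"
proof -
  have b: "Re b > 0" using r by simp
  define br where "br = complex_of_real (Re b - r)"
  have br: "Re br > 0" using r by (simp add: br_def)
  have rn: "norm (complex_of_real r) \<le> r" using r by simp
  have "(\<lambda>m. norm (Z_term br a 0 s m)) summable_on Z_dom s"
    using a br by (intro Z_term_abs_summable s) auto
  then show ?thesis
  proof (rule summable_on_comparison_test)
    fix m assume m: "m \<in> Z_dom s"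
    have "(\<Prod>i=1..length s. \<Sum>\<^sub>\<infinity>k. star_coeff_abs b s m i k * r ^ k) = (\<Prod>j=m 1..m (length s). 1 / (1 - r / norm (of_nat j + b)))"
      unfolding infsumI[OF star_coeff_has_sum(2)[OF r(2) rn]] by (rule prod_star_coeff[OF s m])
    then have "norm (Z_term b a 0 s m) * (\<Prod>i=1..length s. \<Sum>\<^sub>\<infinity>k. star_coeff_abs b s m i k * r ^ k)
      = norm (Z_rest a s m) * (\<Prod>j=m 1..m (length s). norm (1 / (of_nat j + b)) * (1 / (1 - r / norm (of_nat j + b))))"
      by (simp only: Z_term_eq_Z_rest[OF b a m s(2)] norm_mult prod_norm[symmetric] prod.distrib mult.assoc)
    also have "\<dots> \<le> norm (Z_rest a s m) * (\<Prod>j=m 1..m (length s). norm (1 / (of_nat j + br)))"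
    proof (intro mult_left_mono prod_mono conjI norm_ge_zero)
      fix j
      note n = norm_ratio_less(1)[OF r(2) rn, of j]
      have "norm (1 / (of_nat j + b)) * (1 / (1 - r / norm (of_nat j + b))) = 1 / (norm (of_nat j + b) - r)"
        using n r norm_ratio_less(3)[OF r(2) rn, of j] by (simp add: norm_divide field_simps)
      moreover have "norm (of_nat j + br) = real j + Re b - r"
        using r norm_of_real[of "real j + Re b - r", where 'a = complex] by (simp add: br_def add_diff_eq)
      moreover have "1 / (norm (of_nat j + b) - r) \<le> 1 / (real j + Re b - r)"
        using r norm_add_of_nat_ge[OF b, of j] by (intro divide_left_mono mult_pos_pos) auto
      ultimately show "norm (1 / (of_nat j + b)) * (1 / (1 - r / norm (of_nat j + b))) \<le> norm (1 / (of_nat j + br))"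
        by (simp only: norm_divide norm_one)
      show "0 \<le> norm (1 / (of_nat j + b)) * (1 / (1 - r / norm (of_nat j + b)))"
        using n r by (auto intro!: mult_nonneg_nonneg simp: divide_le_eq)
    qed
    also have "\<dots> = norm (Z_term br a 0 s m)"
      by (simp add: Z_term_eq_Z_rest[OF br a m s(2)] norm_mult prod_norm del: One_nat_def)
    finally show "norm (Z_term b a 0 s m) * (\<Prod>i=1..length s. \<Sum>\<^sub>\<infinity>k. star_coeff_abs b s m i k * r ^ k) \<le> norm (Z_term br a 0 s m)" .
    show "0 \<le> norm (Z_term b a 0 s m) * (\<Prod>i=1..length s. \<Sum>\<^sub>\<infinity>k. star_coeff_abs b s m i k * r ^ k)"
      using r by (intro mult_nonneg_nonneg prod_nonneg ballI infsum_nonneg star_coeff_abs_nonneg) auto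
  qed
qed

lemma Zstar_eq:
  assumes a: "Re a > 0" and b: "Re b > 0" and s: "s \<in> indices" "s \<noteq> []"
    and \<rho>: "\<rho> \<in> {1..length s} \<rightarrow>\<^sub>E UNIV" and \<rho>1: "cc s 1 = 0 \<longrightarrow> \<rho> 1 = 0"
  shows "Zstar \<rho> (word_of s) b a = (\<Sum>\<^sub>\<infinity>m\<in>Z_dom s. Z_term b a 0 s m * (\<Prod>i=1..length s. star_coeff b s m i (\<rho> i)))"
proof -
  define q where "q = length s"
  have q: "q > 0" "kk s q \<ge> 2" and c: "\<And>i. cc s i \<in> {0, 1}" using indices_dest[OF s] by (auto simp: q_def)
  have ins: "{1..q} = insert 1 {2..q}" using q by auto
  define y where "y j = 1 / (of_nat j + b)" for j :: nat
  define X where "X m = (\<Pi>\<^sub>E i\<in>{2..q}. weak_chains (\<rho> i) (gap s m i))" for m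
  define F where "F = (\<lambda>(m, M). Z_term b a 0 s m * (1 / (of_nat (m 1) + b) ^ \<rho> 1) * (\<Prod>i=2..q. \<Prod>j=1..\<rho> i. y (M i j)))"
  have fin: "finite (X m)" for m unfolding X_def by (intro finite_PiE finite_weak_chains finite_gap) simp
  have op: "1 / (of_nat (m 1) + b) ^ \<rho> 1 = optional_power (cc s 1) (of_nat (m 1) + b) (\<rho> 1)" for m :: "nat \<Rightarrow> nat"
    using \<rho>1 c[of 1] by (auto simp: optional_power_def)
  have "Zstar \<rho> (word_of s) b a = (\<Sum>\<^sub>\<infinity>x\<in>Zstar_dom \<rho> s. F x)"
  proof -
    have "pochhammer b (m 1) / fact (m 1) *
       (fact (m q) * (of_nat (m q) + a) / pochhammer b (m q + 1)) *
       (1 / ((of_nat (m 1) + b) ^ \<rho> 1 * (of_nat (m 1) + a) ^ kk s 1)) *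
       (\<Prod>i=2..q. (\<Prod>j=1..\<rho> i. 1 / (of_nat (M i j) + b)) * (1 / (of_nat (m i) + a) ^ kk s i)) = F (m, M)" for m :: "nat \<Rightarrow> nat" and M
    proof -
      have nz: "of_nat (m q) + a \<noteq> 0" by (rule of_nat_add_neq_0[OF a])
      obtain k where k: "kk s q = Suc (Suc k)" using q(2) by (metis Suc_le_D numeral_2_eq_2 Suc_le_mono)
      have "(1 / (of_nat (m 1) + a) ^ kk s 1) * (\<Prod>i=2..q. 1 / (of_nat (m i) + a) ^ kk s i) = (\<Prod>i=1..q. 1 / (of_nat (m i) + a) ^ kk s i)"
        unfolding ins by (subst prod.insert) auto
      also have "\<dots> = (\<Prod>i=1..<q. 1 / (of_nat (m i) + a) ^ kk s i) * (1 / (of_nat (m q) + a) ^ kk s q)"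
      proof -
        have "{1..q} = insert q {1..<q}" using q by auto
        then show ?thesis by (simp add: mult.commute)
      qed
      finally have P: "(of_nat (m q) + a) * ((1 / (of_nat (m 1) + a) ^ kk s 1) * (\<Prod>i=2..q. 1 / (of_nat (m i) + a) ^ kk s i))
        = (\<Prod>i=1..<q. 1 / (of_nat (m i) + a) ^ kk s i) * (1 / (of_nat (m q) + a) ^ (kk s q - 1))"
        using nz by (simp add: k)
      have "pochhammer b (m 1) / fact (m 1) *
       (fact (m q) * (of_nat (m q) + a) / pochhammer b (m q + 1)) *
       (1 / ((of_nat (m 1) + b) ^ \<rho> 1 * (of_nat (m 1) + a) ^ kk s 1)) *
       (\<Prod>i=2..q. (\<Prod>j=1..\<rho> i. 1 / (of_nat (M i j) + b)) * (1 / (of_nat (m i) + a) ^ kk s i))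
       = pochhammer b (m 1) / fact (m 1) * (fact (m q) / pochhammer b (Suc (m q))) *
         ((of_nat (m q) + a) * ((1 / (of_nat (m 1) + a) ^ kk s 1) * (\<Prod>i=2..q. 1 / (of_nat (m i) + a) ^ kk s i))) *
         (1 / (of_nat (m 1) + b) ^ \<rho> 1) * (\<Prod>i=2..q. \<Prod>j=1..\<rho> i. 1 / (of_nat (M i j) + b))"
        unfolding prod.distrib by (simp add: mult_ac Suc_eq_plus1 del: One_nat_def)
      also have "\<dots> = F (m, M)"
        unfolding P F_def prod.case Z_term_def q_def[symmetric] strict_factor_0[OF a] tail_weight_0[OF b] y_def
        by (simp only: mult_ac)
      finally show ?thesis .
    qed
    then show ?thesis
      unfolding Zstar_def Let_def index_of_word_of[OF s(1)] if_not_P[OF word_of_neq_Nil[OF s(2)]] q_def[symmetric]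
      by (simp only: case_prod_unfold prod.collapse)
  qed
  also have "Zstar_dom \<rho> s = (SIGMA m:Z_dom s. X m)" by (simp add: Zstar_dom_eq[OF c] X_def q_def)
  also have "(\<Sum>\<^sub>\<infinity>x\<in>(SIGMA m:Z_dom s. X m). F x) = (\<Sum>\<^sub>\<infinity>m\<in>Z_dom s. \<Sum>\<^sub>\<infinity>M\<in>X m. F (m, M))"
  proof (rule infsum_Sigma_banach[symmetric], rule abs_summable_summable, rule summable_on_SigmaI)
    fix m assume "m \<in> Z_dom s"
    show "((\<lambda>M. norm (F (m, M))) has_sum (\<Sum>M\<in>X m. norm (F (m, M)))) (X m)" by (rule has_sum_finite[OF fin])
  next
    \<comment> \<open>Any radius between \<open>0\<close> and \<open>Re b\<close> serves for the summability.\<close>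
    have r: "Re b / 2 > 0" "Re b / 2 < Re b" using b by auto
    have rn: "norm (complex_of_real (Re b / 2)) \<le> Re b / 2" using r(1) by simp
    have "(\<lambda>m. norm (Z_term b a 0 s m * (\<Prod>i=1..q. complex_of_real (star_coeff_abs b s m i (\<rho> i))))) summable_on Z_dom s"
    proof (rule power_series_family_summable[OF r(1), where a = "\<lambda>m i k. complex_of_real (star_coeff_abs b s m i k)"])
      show "(\<lambda>k. norm (complex_of_real (star_coeff_abs b s m i k)) * (Re b / 2) ^ k) summable_on UNIV" for m i
        using has_sum_imp_summable[OF star_coeff_has_sum(2)[OF r(2) rn]] by (simp add: star_coeff_abs_nonneg)
      show "(\<lambda>m. norm (Z_term b a 0 s m) * (\<Prod>i=1..q. \<Sum>\<^sub>\<infinity>k. norm (complex_of_real (star_coeff_abs b s m i k)) * (Re b / 2) ^ k)) summable_on Z_dom s"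
        using star_abs_summable[OF a r s] by (simp add: star_coeff_abs_nonneg q_def)
      show "\<rho> \<in> {1..q} \<rightarrow>\<^sub>E UNIV" using \<rho> by (simp add: q_def)
    qed
    moreover have "(\<Sum>M\<in>X m. norm (F (m, M))) = norm (Z_term b a 0 s m * (\<Prod>i=1..q. complex_of_real (star_coeff_abs b s m i (\<rho> i))))" for m
    proof -
      have "(\<Sum>M\<in>X m. norm (F (m, M))) = norm (Z_term b a 0 s m) * norm (optional_power (cc s 1) (of_nat (m 1) + b) (\<rho> 1)) *
          (\<Sum>M\<in>X m. \<Prod>i=2..q. \<Prod>j=1..\<rho> i. norm (y (M i j)))"
        by (simp add: F_def op norm_mult prod_norm sum_distrib_left del: One_nat_def)
      also have "(\<Sum>M\<in>X m. \<Prod>i=2..q. \<Prod>j=1..\<rho> i. norm (y (M i j))) = (\<Prod>i=2..q. \<Sum>f\<in>weak_chains (\<rho> i) (gap s m i). \<Prod>j=1..\<rho> i. norm (y (f j)))"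
        unfolding X_def by (intro prod_sum_PiE[symmetric] finite_weak_chains finite_gap) simp
      also have "\<dots> = (\<Prod>i=2..q. star_coeff_abs b s m i (\<rho> i))"
        by (intro prod.cong refl) (auto simp: star_coeff_abs_def hsym_def y_def norm_divide)
      also have "norm (Z_term b a 0 s m) * norm (optional_power (cc s 1) (of_nat (m 1) + b) (\<rho> 1)) * \<dots>
        = norm (Z_term b a 0 s m) * (\<Prod>i=1..q. star_coeff_abs b s m i (\<rho> i))"
        unfolding ins by (subst prod.insert) (auto simp: star_coeff_abs_def)
      also have "\<dots> = norm (Z_term b a 0 s m * (\<Prod>i=1..q. complex_of_real (star_coeff_abs b s m i (\<rho> i))))"
        by (simp add: norm_mult prod_norm[symmetric] star_coeff_abs_nonneg)
      finally show ?thesis .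
    qed
    ultimately show "(\<lambda>m. \<Sum>M\<in>X m. norm (F (m, M))) summable_on Z_dom s" by simp
  qed simp
  also have "\<dots> = (\<Sum>\<^sub>\<infinity>m\<in>Z_dom s. Z_term b a 0 s m * (\<Prod>i=1..q. star_coeff b s m i (\<rho> i)))"
  proof (rule infsum_cong)
    fix m
    have "(\<Sum>\<^sub>\<infinity>M\<in>X m. F (m, M)) = (\<Sum>M\<in>X m. F (m, M))" by (rule infsum_finite[OF fin])
    also have "\<dots> = Z_term b a 0 s m * (optional_power (cc s 1) (of_nat (m 1) + b) (\<rho> 1) *
          (\<Sum>M\<in>X m. \<Prod>i=2..q. \<Prod>j=1..\<rho> i. y (M i j)))"
      by (simp add: F_def op sum_distrib_left mult.assoc del: One_nat_def)
    also have "(\<Sum>M\<in>X m. \<Prod>i=2..q. \<Prod>j=1..\<rho> i. y (M i j)) = (\<Prod>i=2..q. \<Sum>f\<in>weak_chains (\<rho> i) (gap s m i). \<Prod>j=1..\<rho> i. y (f j))"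
      unfolding X_def by (intro prod_sum_PiE[symmetric] finite_weak_chains finite_gap) simp
    also have "\<dots> = (\<Prod>i=2..q. star_coeff b s m i (\<rho> i))"
      by (intro prod.cong refl) (auto simp: star_coeff_def hsym_def y_def)
    also have "optional_power (cc s 1) (of_nat (m 1) + b) (\<rho> 1) * \<dots> = (\<Prod>i=1..q. star_coeff b s m i (\<rho> i))"
      unfolding ins by (subst prod.insert) (auto simp: star_coeff_def)
    finally show "(\<Sum>\<^sub>\<infinity>M\<in>X m. F (m, M)) = Z_term b a 0 s m * (\<Prod>i=1..q. star_coeff b s m i (\<rho> i))" .
  qed
  finally show ?thesis by (simp add: q_def)
qed

text \<open>The right-hand side of (i).\<close>

definition star_sum :: "complex \<Rightarrow> complex \<Rightarrow> index \<Rightarrow> nat \<Rightarrow> complex" where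
  "star_sum b a s n = (\<Sum>\<rho> | \<rho> \<in> {1..length s} \<rightarrow>\<^sub>E UNIV \<and> (cc s 1 = 0 \<longrightarrow> \<rho> 1 = 0) \<and>
                      cc s 1 * \<rho> 1 + (\<Sum>i=2..length s. \<rho> i) = n.
             Zstar (\<rho>(1 := cc s 1 * \<rho> 1)) (word_of s) b a)"

lemma star_sum_eq:
  assumes a: "Re a > 0" and b: "Re b > 0" and s: "s \<in> indices" "s \<noteq> []"
  shows "star_sum b a s n = (\<Sum>\<rho>\<in>compositions (length s) n. \<Sum>\<^sub>\<infinity>m\<in>Z_dom s.
    Z_term b a 0 s m * (\<Prod>i=1..length s. star_coeff b s m i (\<rho> i)))"
proof -
  define q where "q = length s"
  have q: "q > 0" and c: "\<And>i. cc s i \<in> {0, 1}" using indices_dest[OF s] by (auto simp: q_def)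
  have ins: "{1..q} = insert 1 {2..q}" using q by auto
  define R where "R = {\<rho>. \<rho> \<in> {1..q} \<rightarrow>\<^sub>E UNIV \<and> (cc s 1 = 0 \<longrightarrow> \<rho> 1 = 0) \<and> cc s 1 * \<rho> 1 + (\<Sum>i=2..q. \<rho> i) = n}"
  have c1: "cc s 1 * \<rho> 1 = \<rho> 1" if "cc s 1 = 0 \<longrightarrow> \<rho> 1 = 0" for \<rho> :: "nat \<Rightarrow> nat" using that c[of 1] by auto
  have tot: "(\<Sum>i=1..q. \<rho> i) = \<rho> 1 + (\<Sum>i=2..q. \<rho> i)" for \<rho> :: "nat \<Rightarrow> nat"
    unfolding ins by (subst sum.insert) auto
  have R: "R = {\<rho> \<in> compositions q n. cc s 1 = 0 \<longrightarrow> \<rho> 1 = 0}"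
    unfolding R_def compositions_def using c1 by (auto simp: tot simp del: One_nat_def)
  have "star_sum b a s n = (\<Sum>\<rho>\<in>R. Zstar (\<rho>(1 := cc s 1 * \<rho> 1)) (word_of s) b a)"
    by (simp add: star_sum_def R_def q_def)
  also have "\<dots> = (\<Sum>\<rho>\<in>R. \<Sum>\<^sub>\<infinity>m\<in>Z_dom s. Z_term b a 0 s m * (\<Prod>i=1..q. star_coeff b s m i (\<rho> i)))"
  proof (rule sum.cong[OF refl])
    fix \<rho> assume "\<rho> \<in> R"
    then have \<rho>: "\<rho> \<in> {1..length s} \<rightarrow>\<^sub>E UNIV" "cc s 1 = 0 \<longrightarrow> \<rho> 1 = 0" by (auto simp: R_def q_def)
    have "\<rho>(1 := cc s 1 * \<rho> 1) = \<rho>" by (simp only: c1[of \<rho>, OF \<rho>(2)] fun_upd_triv)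
    then show "Zstar (\<rho>(1 := cc s 1 * \<rho> 1)) (word_of s) b a
      = (\<Sum>\<^sub>\<infinity>m\<in>Z_dom s. Z_term b a 0 s m * (\<Prod>i=1..q. star_coeff b s m i (\<rho> i)))"
      using Zstar_eq[OF a b s \<rho>] by (simp only: q_def)
  qed
  also have "\<dots> = (\<Sum>\<rho>\<in>compositions q n. \<Sum>\<^sub>\<infinity>m\<in>Z_dom s. Z_term b a 0 s m * (\<Prod>i=1..q. star_coeff b s m i (\<rho> i)))"
  proof (rule sum.mono_neutral_left[OF finite_compositions])
    show "R \<subseteq> compositions q n" by (auto simp: R)
    show "\<forall>\<rho>\<in>compositions q n - R. (\<Sum>\<^sub>\<infinity>m\<in>Z_dom s. Z_term b a 0 s m * (\<Prod>i=1..q. star_coeff b s m i (\<rho> i))) = 0"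
    proof
      fix \<rho> assume "\<rho> \<in> compositions q n - R"
      then have "cc s 1 = 0" "\<rho> 1 \<noteq> 0" by (auto simp: R)
      then have "(\<Prod>i=1..q. star_coeff b s m i (\<rho> i)) = 0" for m
        using q by (intro prod_zero bexI[of _ 1]) (auto simp: star_coeff_def optional_power_def)
      then show "(\<Sum>\<^sub>\<infinity>m\<in>Z_dom s. Z_term b a 0 s m * (\<Prod>i=1..q. star_coeff b s m i (\<rho> i))) = 0"
        by (simp only: mult_zero_right infsum_0_simp)
    qed
  qed
  finally show ?thesis by (simp add: q_def)
qed

text \<open>The products over the gaps combine to a product over \<open>m\<^sub>1 \<le> j \<le> m\<^sub>q\<close>, which replaces \<open>b\<close> by \<open>b - z\<close>
  in \<open>(b)\<^bsub>m\<^sub>1\<^esub> / (b)\<^bsub>m\<^sub>q + 1\<^esub>\<close>.\<close>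

lemma star_sum_sums:
  assumes a: "Re a > 0" and r: "r > 0" "r < Re b" and s: "s \<in> indices" "s \<noteq> []" and z: "norm z \<le> r"
  shows "(\<lambda>n. star_sum b a s n * z ^ n) sums pairing (b - z) a 0 (core_word (word_of s))"
proof -
  have b: "Re b > 0" using r by simp
  have bz: "Re (b - z) > 0" using r z abs_Re_le_cmod[of z] by simp
  have rn: "norm (complex_of_real r) \<le> r" using r by simp
  have su: "(\<lambda>k. norm (star_coeff b s m i k) * r ^ k) summable_on UNIV" for m i
    by (rule summable_on_comparison_test[OF has_sum_imp_summable[OF star_coeff_has_sum(2)[OF r(2) rn]]])
      (use r in \<open>auto intro!: mult_right_mono norm_star_coeff_le\<close>)
  have "(\<lambda>n. (\<Sum>\<rho>\<in>compositions (length s) n. \<Sum>\<^sub>\<infinity>m\<in>Z_dom s. Z_term b a 0 s m * (\<Prod>i=1..length s. star_coeff b s m i (\<rho> i))) * z ^ n) sums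
      (\<Sum>\<^sub>\<infinity>m\<in>Z_dom s. Z_term b a 0 s m * (\<Prod>i=1..length s. \<Sum>\<^sub>\<infinity>k. star_coeff b s m i k * z ^ k))"
  proof (rule power_series_family_sums[OF r(1) su _ z])
    show "(\<lambda>m. norm (Z_term b a 0 s m) * (\<Prod>i=1..length s. \<Sum>\<^sub>\<infinity>k. norm (star_coeff b s m i k) * r ^ k)) summable_on Z_dom s"
    proof (rule summable_on_comparison_test[OF star_abs_summable[OF a r s]])
      fix m
      show "norm (Z_term b a 0 s m) * (\<Prod>i=1..length s. \<Sum>\<^sub>\<infinity>k. norm (star_coeff b s m i k) * r ^ k)
        \<le> norm (Z_term b a 0 s m) * (\<Prod>i=1..length s. \<Sum>\<^sub>\<infinity>k. star_coeff_abs b s m i k * r ^ k)"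
      proof (intro mult_left_mono prod_mono conjI norm_ge_zero)
        fix i
        show "(\<Sum>\<^sub>\<infinity>k. norm (star_coeff b s m i k) * r ^ k) \<le> (\<Sum>\<^sub>\<infinity>k. star_coeff_abs b s m i k * r ^ k)"
          by (rule infsum_mono[OF su has_sum_imp_summable[OF star_coeff_has_sum(2)[OF r(2) rn]]])
            (use r in \<open>auto intro!: mult_right_mono norm_star_coeff_le\<close>)
        show "0 \<le> (\<Sum>\<^sub>\<infinity>k. norm (star_coeff b s m i k) * r ^ k)" using r by (intro infsum_nonneg) simp
      qed
      show "0 \<le> norm (Z_term b a 0 s m) * (\<Prod>i=1..length s. \<Sum>\<^sub>\<infinity>k. norm (star_coeff b s m i k) * r ^ k)"
        using r by (intro mult_nonneg_nonneg prod_nonneg ballI infsum_nonneg) auto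
    qed
  qed
  moreover have "Z_term b a 0 s m * (\<Prod>i=1..length s. \<Sum>\<^sub>\<infinity>k. star_coeff b s m i k * z ^ k) = Z_term (b - z) a 0 s m"
    if m: "m \<in> Z_dom s" for m
  proof -
    have f: "1 / (of_nat j + b) * (1 / (1 - z / (of_nat j + b))) = 1 / (of_nat j + (b - z))" for j
      using norm_ratio_less(3,4)[OF r(2) z, of j] by (simp add: field_simps)
    have "(\<Prod>i=1..length s. \<Sum>\<^sub>\<infinity>k. star_coeff b s m i k * z ^ k) = (\<Prod>j=m 1..m (length s). 1 / (1 - z / (of_nat j + b)))"
      unfolding infsumI[OF star_coeff_has_sum(1)[OF r(2) z]] by (rule prod_star_coeff[OF s m])
    then show ?thesis
      by (simp only: Z_term_eq_Z_rest[OF b a m s(2)] Z_term_eq_Z_rest[OF bz a m s(2)] mult.assoc prod.distrib[symmetric] f)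
  qed
  ultimately have "(\<lambda>n. star_sum b a s n * z ^ n) sums (\<Sum>\<^sub>\<infinity>m\<in>Z_dom s. Z_term (b - z) a 0 s m)"
    unfolding star_sum_eq[OF a b s] by (simp cong: infsum_cong)
  moreover have "(\<Sum>\<^sub>\<infinity>m\<in>Z_dom s. Z_term (b - z) a 0 s m) = pairing (b - z) a 0 (core_word (word_of s))"
    using a bz by (intro infsumI Z_term_has_sum_pairing s) auto
  ultimately show ?thesis by simp
qed

lemma sigma_b1_tau:
  assumes v: "v \<in> B0" "v \<noteq> []" and t: "t \<in> indices" "tau v = word_of t" and a: "Re a > 0" and b: "Re b > 0"
  shows "Z (sigma_b1 n v) a b = star_sum b a t n"
proof -
  obtain s where s: "s \<in> indices" "v = word_of s" using v by (auto simp: B0_def)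
  have tv: "tau v \<noteq> []" using v by (simp add: tau_def)
  have ne: "s \<noteq> []" "t \<noteq> []" using s t v(2) tv by (auto simp: word_of_def)
  have r: "Re b / 2 > 0" "Re b / 2 < Re b" using b by auto
  show ?thesis
  proof (rule power_series_coeff_eq[OF r(1)])
    fix z :: complex assume z: "norm z \<le> Re b / 2"
    show "(\<lambda>n. Z (sigma_b1 n v) a b * z ^ n) sums pairing a (b - z) 0 (core_word v)"
      using Z_sigma_b1_sums[OF a r s(1) ne(1) z] s by simp
    have "Re (b - z) > 0" using z b abs_Re_le_cmod[of z] by simp
    then have "pairing a (b - z) 0 (core_word v) = pairing (b - z) a 0 (core_word (tau v))"
      using pairing_duality[OF a _ core_word_letters[OF v(1)]] core_word_tau[OF v(2)] by simp
    then show "(\<lambda>n. star_sum b a t n * z ^ n) sums pairing a (b - z) 0 (core_word v)"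
      using star_sum_sums[OF a r t(1) ne(2) z] t by simp
  qed
qed

theorem theorem1p1:
  fixes v :: word and t :: index and q :: nat and c' :: "nat \<Rightarrow> nat"
  assumes "v \<in> B0"
    and "t \<in> indices" and "tau v = word_of t"
    and "q = length t" and "c' = cc t"
  shows
    "(\<forall>(r::nat) (\<alpha>::complex) (\<beta>::complex). Re \<alpha> > 0 \<and> Re \<beta> > 0 \<longrightarrow>
        Z (sigma_b1 r v) \<alpha> \<beta> =
          (if v = [] then 1
           else \<Sum>\<rho> | \<rho> \<in> {1..q} \<rightarrow>\<^sub>E UNIV \<and> (c' 1 = 0 \<longrightarrow> \<rho> 1 = 0) \<and>
                      c' 1 * \<rho> 1 + (\<Sum>i=2..q. \<rho> i) = r.
             Zstar (\<rho>(1 := c' 1 * \<rho> 1)) (tau v) \<beta> \<alpha>))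
     \<and> (\<forall>(r::nat) (\<alpha>::complex). Re \<alpha> > 0 \<longrightarrow>
        Z1 (sigma_r r v) \<alpha> = Z1 (sigma_r r (tau v)) \<alpha>)"
proof (intro conjI allI impI)
  fix r and \<alpha> \<beta> :: complex assume "Re \<alpha> > 0 \<and> Re \<beta> > 0"
  then show "Z (sigma_b1 r v) \<alpha> \<beta> =
          (if v = [] then 1
           else \<Sum>\<rho> | \<rho> \<in> {1..q} \<rightarrow>\<^sub>E UNIV \<and> (c' 1 = 0 \<longrightarrow> \<rho> 1 = 0) \<and>
                      c' 1 * \<rho> 1 + (\<Sum>i=2..q. \<rho> i) = r.
             Zstar (\<rho>(1 := c' 1 * \<rho> 1)) (tau v) \<beta> \<alpha>)"
    using sigma_b1_tau[OF assms(1) _ assms(2,3), of \<alpha> \<beta> r]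
    by (cases "v = []") (simp_all add: assms(3-5) star_sum_def sigma_b1_def Z_def Z_word_def)
next
  fix r and \<alpha> :: complex assume "Re \<alpha> > 0"
  then show "Z1 (sigma_r r v) \<alpha> = Z1 (sigma_r r (tau v)) \<alpha>" by (rule sigma_r_tau[OF assms(1)])
qed

end
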